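(* Let $T,S$ be commuting (invertible) measure-preserving transformations on a probability space $(\Omega,\mathcal F,\mu)$ with ergodic joint action. Let $F\in L^2(\mu)$ be real-valued and such that the process $(F\circ T^m\circ S^n)_{(m,n)\in\mathbb Z^2}$ is absolutely continuous. Let $\nu$ be the law of this process (taken over the indices $(m,n)\in\mathbb N^2$), and let $\nu_0$ be the law of the process $(F\circ T^m\circ S^n)_{(m,n)\in\mathbb N^2,\,(m,n)\neq(0,0)}$. Assume that $Se(F,T,S)$ is finite (which is equivalent to $H_{\mu F^{-1}\times\nu_0}(\nu)<\infty$). Then $\frac{1}{n^2}h_n^{(2)}$ converges $\mu$-almost everywhere and in $L^1(\mu)$ to $Se(F,T,S)$. In case $Se(F,T,S)=-\infty$, the convergence of $\frac{1}{n^2}h_n^{(2)}$ to $Se(F,T,S)$ still holds $\mu$-almost everywhere.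
   Context: Here $\mathbb N=\{0,1,2,\dots\}$ and $\log$ is the natural logarithm. A process $(X_g)_{g\in\mathbb Z^2}$ is absolutely continuous if for every finite $K\subset\mathbb Z^2$ the joint law of $(X_g)_{g\in K}$ is absolutely continuous with respect to $|K|$-dimensional Lebesgue measure. For $n\ge1$ let $F_{n^2}:=(F\circ T^i\circ S^j)_{0\le i,j\le n-1}$, let $f_{n^2}$ be the density of the law of $F_{n^2}$ with respect to $n^2$-dimensional Lebesgue measure, and put $$h_n^{(2)}:=-\log f_{n^2}\circ F_{n^2},\qquad H_n^{(2)}:=\int_\Omega h_n^{(2)}\,d\mu .$$ The Shannon entropy of the process is $Se(F,T,S):=\lim_n\frac1{n^2}H_n^{(2)}$, a limit which exists and may be $-\infty$. $\mu F^{-1}$ denotes the law of $F$ on $\mathbb R$, and $\mu F^{-1}\times\nu_0$ is regarded as a probability measure on $\mathbb R^{\mathbb N^2}$, with $\mu F^{-1}$ on the $(0,0)$ coordinate. For probability measures $P,Q$ on the same measurable space, the entropy of $P$ with respect to $Q$ is $H_Q(P):=\sup_\Pi\sum_{E\in\Pi}P(E)\log\frac{P(E)}{Q(E)}\in[0,+\infty]$, the supremum being over all finite measurable partitions $\Pi$ of the space.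
   Formalization: Of the parenthetical equivalence only "Se(F,T,S) finite implies H<∞" is stated and proved; the converse is false, e.g. for an i.i.d. process with bounded support and density f with ∫ f log f = +∞, where H=0 but Se=-∞. *)

theory Defs
  imports "HOL-Probability.Probability"
begin

definition invertible_measure_preserving :: "'a measure \<Rightarrow> ('a \<Rightarrow> 'a) \<Rightarrow> bool" where
  "invertible_measure_preserving M T \<longleftrightarrow>
     T \<in> M \<rightarrow>\<^sub>M M \<and> bij_betw T (space M) (space M) \<and>
     inv_into (space M) T \<in> M \<rightarrow>\<^sub>M M \<and> distr M M T = M"

definition commuting_on :: "'a measure \<Rightarrow> ('a \<Rightarrow> 'a) \<Rightarrow> ('a \<Rightarrow> 'a) \<Rightarrow> bool" where
  "commuting_on M T S \<longleftrightarrow> (\<forall>x\<in>space M. T (S x) = S (T x))"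

definition jointly_ergodic :: "'a measure \<Rightarrow> ('a \<Rightarrow> 'a) \<Rightarrow> ('a \<Rightarrow> 'a) \<Rightarrow> bool" where
  "jointly_ergodic M T S \<longleftrightarrow>
     (\<forall>A\<in>sets M. T -` A \<inter> space M = A \<and> S -` A \<inter> space M = A \<longrightarrow>
        measure M A = 0 \<or> measure M A = 1)"

text \<open>Integer powers, the inverse being taken on the underlying space only.\<close>

definition int_iterate :: "'a measure \<Rightarrow> ('a \<Rightarrow> 'a) \<Rightarrow> int \<Rightarrow> 'a \<Rightarrow> 'a" where
  "int_iterate M T k =
     (if 0 \<le> k then T ^^ nat k else inv_into (space M) T ^^ nat (- k))"

definition process ::
  "'a measure \<Rightarrow> ('a \<Rightarrow> real) \<Rightarrow> ('a \<Rightarrow> 'a) \<Rightarrow> ('a \<Rightarrow> 'a) \<Rightarrow> int \<times> int \<Rightarrow> 'a \<Rightarrow> real" where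
  "process M F T S g \<omega> = F (int_iterate M T (fst g) (int_iterate M S (snd g) \<omega>))"

definition process_restr ::
  "'a measure \<Rightarrow> ('a \<Rightarrow> real) \<Rightarrow> ('a \<Rightarrow> 'a) \<Rightarrow> ('a \<Rightarrow> 'a) \<Rightarrow> (int \<times> int) set \<Rightarrow>
     'a \<Rightarrow> (int \<times> int \<Rightarrow> real)" where
  "process_restr M F T S I \<omega> = (\<lambda>g\<in>I. process M F T S g \<omega>)"

definition process_law ::
  "'a measure \<Rightarrow> ('a \<Rightarrow> real) \<Rightarrow> ('a \<Rightarrow> 'a) \<Rightarrow> ('a \<Rightarrow> 'a) \<Rightarrow> (int \<times> int) set \<Rightarrow>
     (int \<times> int \<Rightarrow> real) measure" where
  "process_law M F T S I = distr M (\<Pi>\<^sub>M g\<in>I. borel) (process_restr M F T S I)"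

definition abs_cont_process ::
  "'a measure \<Rightarrow> ('a \<Rightarrow> real) \<Rightarrow> ('a \<Rightarrow> 'a) \<Rightarrow> ('a \<Rightarrow> 'a) \<Rightarrow> bool" where
  "abs_cont_process M F T S \<longleftrightarrow>
     (\<forall>K. finite K \<longrightarrow> absolutely_continuous (\<Pi>\<^sub>M g\<in>K. lborel) (process_law M F T S K))"

definition square :: "nat \<Rightarrow> (int \<times> int) set" where
  "square n = {0..<int n} \<times> {0..<int n}"

definition square_density ::
  "'a measure \<Rightarrow> ('a \<Rightarrow> real) \<Rightarrow> ('a \<Rightarrow> 'a) \<Rightarrow> ('a \<Rightarrow> 'a) \<Rightarrow> nat \<Rightarrow>
     (int \<times> int \<Rightarrow> real) \<Rightarrow> real" where
  "square_density M F T S n x =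
     enn2real (RN_deriv (\<Pi>\<^sub>M g\<in>square n. lborel) (process_law M F T S (square n)) x)"

text \<open>Under absolute continuity the density is almost surely positive and finite along the
  process, so the values chosen for the logarithm of \<open>0\<close> and for \<open>enn2real \<infinity>\<close> are immaterial.\<close>

definition information ::
  "'a measure \<Rightarrow> ('a \<Rightarrow> real) \<Rightarrow> ('a \<Rightarrow> 'a) \<Rightarrow> ('a \<Rightarrow> 'a) \<Rightarrow> nat \<Rightarrow> 'a \<Rightarrow> real" where
  "information M F T S n \<omega> =
     - ln (square_density M F T S n (process_restr M F T S (square n) \<omega>))"

text \<open>Integral with values in \<open>[-\<infinity>, \<infinity>]\<close>; meaningful when the positive or the negative part has
  finite integral. (The Bochner integral would yield \<open>0\<close> for an integral equal to \<open>-\<infinity>\<close>.)\<close>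

definition extended_integral :: "'a measure \<Rightarrow> ('a \<Rightarrow> real) \<Rightarrow> ereal" where
  "extended_integral M f =
     enn2ereal (\<integral>\<^sup>+ x. ennreal (f x) \<partial>M) - enn2ereal (\<integral>\<^sup>+ x. ennreal (- f x) \<partial>M)"

definition square_entropy ::
  "'a measure \<Rightarrow> ('a \<Rightarrow> real) \<Rightarrow> ('a \<Rightarrow> 'a) \<Rightarrow> ('a \<Rightarrow> 'a) \<Rightarrow> nat \<Rightarrow> ereal" where
  "square_entropy M F T S n = extended_integral M (information M F T S n)"

definition shannon_entropy ::
  "'a measure \<Rightarrow> ('a \<Rightarrow> real) \<Rightarrow> ('a \<Rightarrow> 'a) \<Rightarrow> ('a \<Rightarrow> 'a) \<Rightarrow> ereal" where
  "shannon_entropy M F T S = lim (\<lambda>n. square_entropy M F T S n / ereal (real (n\<^sup>2)))"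

text \<open>Conventions: \<open>0 log (0 / q) = 0\<close>, and \<open>p log (p / 0) = \<infinity>\<close> for \<open>p > 0\<close>.\<close>

definition relative_entropy :: "'b measure \<Rightarrow> 'b measure \<Rightarrow> ereal" where
  "relative_entropy Q P =
     (SUP C \<in> {C. finite C \<and> C \<subseteq> sets P \<and> partition_on (space P) C}.
        \<Sum>E\<in>C. (if measure P E = 0 then 0
               else if measure Q E = 0 then \<infinity>
               else ereal (measure P E * ln (measure P E / measure Q E))))"

definition quadrant :: "(int \<times> int) set" where
  "quadrant = {0..} \<times> {0..}"

text \<open>The product of the law of \<open>F\<close> with \<open>\<nu>\<^sub>0\<close>, transported to the product space over the
  whole quadrant by placing the first factor at the origin.\<close>

definition decoupled_law ::
  "'a measure \<Rightarrow> ('a \<Rightarrow> real) \<Rightarrow> ('a \<Rightarrow> 'a) \<Rightarrow> ('a \<Rightarrow> 'a) \<Rightarrow> (int \<times> int \<Rightarrow> real) measure" where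
  "decoupled_law M F T S =
     distr (distr M borel F \<Otimes>\<^sub>M process_law M F T S (quadrant - {(0, 0)}))
       (\<Pi>\<^sub>M g\<in>quadrant. borel) (\<lambda>(x, y). y((0, 0) := x))"

end

theory Submission
  imports Defs "HOL-Real_Asymp.Real_Asymp"
begin

text \<open>
  Comparing Lebesgue measure with a product of standard normal laws changes the information only by an
  ergodic sum of \<open>(x\<^sup>2 + ln (2 * pi)) / 2\<close>. Let \<open>R\<^sub>K\<close> be the density of the field on \<open>K\<close> relative to that
  product, evaluated along the process, and order the lattice by the lexicographic half-plane \<open>W\<close>, the past of
  \<open>g\<close> being \<open>g + W\<close>. A product of conditional densities, each given a part of the past, is a subprobability
  density. Hence, by Markov's inequality and Borel--Cantelli, \<open>ln R\<^sub>n\<close> on the \<open>n\<close>-square exceeds the sum of the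
  conditional gains given \<open>g + A\<close>, for any finite \<open>A \<subseteq> W\<close>, up to \<open>O(ln n)\<close>; and, comparing inside large boxes,
  it is at most the sum of the gains given the whole past plus \<open>O(ln n)\<close>. By the ergodic theorem both sums
  become means, and the mean gain given the whole past is the supremum \<open>a\<close> of the mean gains given finite \<open>A\<close>.
  If \<open>a\<close> is infinite the lower bound alone gives divergence. If it is finite, the chain rule bounds the mean of
  \<open>ln R\<^sub>n\<close> by \<open>n\<^sup>2 a\<close>, which upgrades the convergence to \<open>L\<^sup>1\<close>. Finally \<open>W\<close> contains the quadrant without the
  origin, so \<open>a\<close> also bounds the relative entropy with respect to the decoupled law.\<close>

section \<open>Ergodic averages over squares\<close>

text \<open>A pointwise argument over the sites of a square would have to dominate the gains
  uniformly over the different pasts that the sites see inside it. Instead only one number per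
  \<open>n\<close> is estimated, the integral of an exponential, and it is at most 1. The price,
  \<open>2 * ln (n + 1)\<close>, is negligible against \<open>n\<^sup>2\<close>, and no
  integrability of the gain is involved. The reference must have mass 1, which Lebesgue measure has
  not: then every gain has a negative part of mean at most 1, whatever the past. So integrability
  can fail only through large positive values, and a gain truncated from above serves as minorant in
  the divergent case. The square integrability of \<open>F\<close> makes the normal correction
  integrable. Pasts are infinite, while the conditional densities at hand belong to finite sets. The
  limit is therefore taken along finite sets in \<open>L\<^sup>1\<close>, where a Hellinger estimate
  turns a small increase of the mean into closeness. The case distinction is on boundedness of the
  mean gains, not on the entropy; each case computes the entropy, which is finite in one and
  -\<infinity> in the other.\<close>

lemma vitali_squares:
  fixes s :: "nat \<times> nat \<Rightarrow> nat"
  defines "Q \<equiv> \<lambda>g. {fst g..<fst g + s g} \<times> {snd g..<snd g + s g}"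
  assumes "finite G" "\<And>g. g \<in> G \<Longrightarrow> 0 < s g"
  shows "\<exists>H\<subseteq>G. (\<forall>g\<in>H. \<forall>h\<in>H. g \<noteq> h \<longrightarrow> Q g \<inter> Q h = {}) \<and> card G \<le> 4 * (\<Sum>h\<in>H. (s h)\<^sup>2)"
  using assms(2,3)
proof (induction "card G" arbitrary: G rule: less_induct)
  case less
  show ?case
  proof (cases "G = {}")
    case False
    \<comment> \<open>Greedy selection as in Vitali's covering lemma: a square of largest side is
      kept, and the induction continues with the anchors whose squares avoid it.\<close>
    have fin: "finite (s ` G)" "s ` G \<noteq> {}" using less False by auto
    obtain h where h: "h \<in> G" "s h = Max (s ` G)"
      using Max_in[OF fin] by (metis imageE)
    have hmax: "s g \<le> s h" if "g \<in> G" for g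
      using that h less(2) by simp
    define G' where "G' = {g\<in>G. Q g \<inter> Q h = {}}"
    have hQ: "fst h \<in> {fst h..<fst h + s h}" "snd h \<in> {snd h..<snd h + s h}"
      using less(3)[OF h(1)] by auto
    have "h \<notin> G'" using hQ unfolding G'_def Q_def by auto
    then have sub: "G' \<subset> G" using h(1) by (auto simp: G'_def)
    have finG': "finite G'" using less(2) by (simp add: G'_def)
    have lt: "card G' < card G" by (rule psubset_card_mono[OF less(2) sub])
    obtain H where H: "H \<subseteq> G'" "\<forall>g\<in>H. \<forall>h\<in>H. g \<noteq> h \<longrightarrow> Q g \<inter> Q h = {}"
      "card G' \<le> 4 * (\<Sum>h\<in>H. (s h)\<^sup>2)"
      using less(1)[OF lt finG'] less(3) sub by (smt (verit) psubsetD)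
    \<comment> \<open>A square meeting \<open>Q h\<close> is at most as large, so its anchor is less
      than \<open>s h\<close> away from \<open>h\<close> in each coordinate. This leaves fewer than
      \<open>2 * s h\<close> values per coordinate, hence the factor 4; truncated subtraction near
      the axes only shrinks the window.\<close>
    have "G - G' \<subseteq> {fst h + 1 - s h..<fst h + s h} \<times> {snd h + 1 - s h..<snd h + s h}"
    proof
      fix g assume g: "g \<in> G - G'"
      then obtain a b where "(a, b) \<in> Q g \<inter> Q h" unfolding G'_def by auto
      then show "g \<in> {fst h + 1 - s h..<fst h + s h} \<times> {snd h + 1 - s h..<snd h + s h}"
        using hmax[of g] g by (cases g) (auto simp: Q_def)
    qed
    then have "card (G - G') \<le> card ({fst h + 1 - s h..<fst h + s h} \<times> {snd h + 1 - s h..<snd h + s h})"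
      by (intro card_mono) auto
    also have "\<dots> \<le> (2 * s h) * (2 * s h)"
      unfolding card_cartesian_product by (intro mult_mono) auto
    finally have c: "card (G - G') \<le> 4 * (s h)\<^sup>2" by (simp add: power2_eq_square)
    have "card G = card (G - G') + card G'"
      using sub finG' less(2) by (simp add: card_Diff_subset card_mono less_imp_le)
    moreover have "h \<notin> H" "finite H" using H(1) \<open>h \<notin> G'\<close> finite_subset[OF H(1) finG']
      by auto
    ultimately have "card G \<le> 4 * (\<Sum>h\<in>insert h H. (s h)\<^sup>2)"
      using c H(3) by simp
    moreover have "\<forall>g\<in>insert h H. \<forall>k\<in>insert h H. g \<noteq> k \<longrightarrow> Q g \<inter> Q k = {}"
    proof (intro ballI impI)
      have hk: "Q k \<inter> Q h = {}" if "k \<in> H" for k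
        using that H(1) by (auto simp: G'_def)
      fix g k assume gk: "g \<in> insert h H" "k \<in> insert h H" "g \<noteq> k"
      then consider "g = h" "k \<in> H" | "k = h" "g \<in> H" | "g \<in> H" "k \<in> H" by auto
      then show "Q g \<inter> Q k = {}" using hk H(2) gk(3) by cases (blast, blast, blast)
    qed
    moreover have "insert h H \<subseteq> G" using h(1) H(1) sub by auto
    ultimately show ?thesis by (intro exI[of _ "insert h H"] conjI)
  qed auto
qed

locale ergodic_pair = prob_space M for M :: "'a measure" +
  fixes T S :: "'a \<Rightarrow> 'a"
  assumes T_meas [measurable]: "T \<in> M \<rightarrow>\<^sub>M M" and S_meas [measurable]: "S \<in> M \<rightarrow>\<^sub>M M"
    and distr_T: "distr M M T = M" and distr_S: "distr M M S = M"
    and comm: "commuting_on M T S" and erg: "jointly_ergodic M T S"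
begin

definition act :: "nat \<times> nat \<Rightarrow> 'a \<Rightarrow> 'a" where
  "act g x = (T ^^ fst g) ((S ^^ snd g) x)"

definition avg :: "('a \<Rightarrow> real) \<Rightarrow> nat \<Rightarrow> 'a \<Rightarrow> real" where
  "avg f n x = (\<Sum>g\<in>{..<n} \<times> {..<n}. f (act g x)) / (real n)\<^sup>2"

lemma space_T [simp]: "x \<in> space M \<Longrightarrow> T x \<in> space M"
  and space_S [simp]: "x \<in> space M \<Longrightarrow> S x \<in> space M"
  using measurable_space[OF T_meas] measurable_space[OF S_meas] by auto

lemma space_funpow [simp]:
  "x \<in> space M \<Longrightarrow> (T ^^ i) x \<in> space M" "x \<in> space M \<Longrightarrow> (S ^^ i) x \<in> space M"
  by (induction i) auto

lemma act_space [simp]: "x \<in> space M \<Longrightarrow> act g x \<in> space M"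
  by (simp add: act_def)

lemma T_S_funpow: "x \<in> space M \<Longrightarrow> T ((S ^^ j) x) = (S ^^ j) (T x)"
  using comm by (induction j) (auto simp: commuting_on_def)

lemma funpow_commute: "x \<in> space M \<Longrightarrow> (T ^^ i) ((S ^^ j) x) = (S ^^ j) ((T ^^ i) x)"
  by (induction i) (auto simp: T_S_funpow)

lemma act_act: "x \<in> space M \<Longrightarrow> act g (act h x) = act (g + h) x"
  by (simp add: act_def funpow_add funpow_commute[symmetric])

lemma act_0 [simp]: "act (0, 0) x = x"
  by (simp add: act_def)

lemma act_T: "x \<in> space M \<Longrightarrow> T (act g x) = act (g + (1, 0)) x"
  and act_S: "x \<in> space M \<Longrightarrow> S (act g x) = act (g + (0, 1)) x"
  and T_act: "x \<in> space M \<Longrightarrow> act g (T x) = act (g + (1, 0)) x"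
  and S_act: "x \<in> space M \<Longrightarrow> act g (S x) = act (g + (0, 1)) x"
  using act_act[of x "(1,0)" g] act_act[of x "(0,1)" g] act_act[of x g "(1,0)"] act_act[of x g "(0,1)"]
  by (auto simp: act_def add.commute)

lemma measurable_funpow:
  "(T ^^ i) \<in> M \<rightarrow>\<^sub>M M" "(S ^^ i) \<in> M \<rightarrow>\<^sub>M M"
  by (induction i) (auto simp: id_def intro: measurable_comp)

lemma distr_funpow:
  "distr M M (T ^^ i) = M" "distr M M (S ^^ i) = M"
proof (induction i)
  case (Suc i)
  { case 1 show ?case
      using distr_distr[OF T_meas measurable_funpow(1), of i] Suc(1) by (simp add: distr_T comp_def) }
  { case 2 show ?case
      using distr_distr[OF S_meas measurable_funpow(2), of i] Suc(2) by (simp add: distr_S comp_def) }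
qed (auto simp: id_def)

lemma act_eq: "act g = (T ^^ fst g) \<circ> (S ^^ snd g)"
  by (auto simp: act_def)

lemma act_measurable [measurable]: "act g \<in> M \<rightarrow>\<^sub>M M"
  unfolding act_eq by (rule measurable_comp[OF measurable_funpow(2) measurable_funpow(1)])

lemma distr_act: "distr M M (act g) = M"
  unfolding act_eq
  by (subst distr_distr[symmetric, OF measurable_funpow]) (simp add: distr_funpow)

lemma integral_act:
  fixes f :: "'a \<Rightarrow> real"
  assumes "f \<in> borel_measurable M"
  shows "(\<integral>x. f (act g x) \<partial>M) = (\<integral>x. f x \<partial>M)"
  using integral_distr[OF act_measurable assms] by (simp add: distr_act)

lemma integrable_act:
  fixes f :: "'a \<Rightarrow> real"
  assumes "integrable M f"
  shows "integrable M (\<lambda>x. f (act g x))"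
  using integrable_distr_eq[OF act_measurable, of f g] assms by (simp add: distr_act)

lemma nn_integral_act:
  assumes "f \<in> borel_measurable M"
  shows "(\<integral>\<^sup>+x. f (act g x) \<partial>M) = (\<integral>\<^sup>+x. f x \<partial>M)"
  using nn_integral_distr[OF act_measurable, of f g] assms by (simp add: distr_act)

lemma AE_act:
  assumes "AE x in M. P x"
  shows "AE x in M. P (act g x)"
  using assms AE_distrD[OF act_measurable, of P g] unfolding distr_act by blast

lemma avg_measurable [measurable]:
  assumes [measurable]: "f \<in> borel_measurable M"
  shows "avg f n \<in> borel_measurable M"
  unfolding avg_def by measurable

lemma integrable_avg: "integrable M f \<Longrightarrow> integrable M (avg f n)"
  unfolding avg_def by (intro integrable_divide Bochner_Integration.integrable_sum integrable_act)

lemma integral_avg: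
  assumes "integrable M f" "n \<ge> 1"
  shows "(\<integral>x. avg f n x \<partial>M) = (\<integral>x. f x \<partial>M)"
proof -
  have "(\<integral>x. avg f n x \<partial>M) = (\<Sum>g\<in>{..<n} \<times> {..<n}. (\<integral>x. f x \<partial>M)) / (real n)\<^sup>2"
    unfolding avg_def using assms by (simp add: integrable_act integral_act)
  also have "\<dots> = (\<integral>x. f x \<partial>M)"
    using assms(2) by (simp add: power2_eq_square)
  finally show ?thesis .
qed

text \<open>Transference: the covering argument runs in the index set, on the sites of the orbit of
  \<open>x\<close> that lie in \<open>E\<close>. Each such site carries a square with average above
  \<open>l\<close>, disjoint squares may be added up because \<open>f\<close> is nonnegative, and a
  side of at most \<open>N\<close> keeps them inside the square of side
  \<open>2 * N\<close>.\<close>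

lemma maximal_pointwise:
  fixes f :: "'a \<Rightarrow> real" and N :: nat
  assumes nonneg: "\<And>x. f x \<ge> 0" and l: "l > 0" and x: "x \<in> space M"
  defines "E \<equiv> {x \<in> space M. \<exists>n\<in>{1..N}. avg f n x > l}"
  shows "l * (\<Sum>g\<in>{..<N} \<times> {..<N}. indicator E (act g x))
     \<le> 4 * (\<Sum>g\<in>{..<2*N} \<times> {..<2*N}. f (act g x))"
proof -
  define G where "G = {g\<in>{..<N} \<times> {..<N}. act g x \<in> E}"
  have "\<forall>g\<in>G. \<exists>n\<in>{1..N}. avg f n (act g x) > l" by (auto simp: G_def E_def)
  then obtain s where s: "\<And>g. g \<in> G \<Longrightarrow> s g \<in> {1..N}" "\<And>g. g \<in> G \<Longrightarrow> avg f (s g) (act g x) > l"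
    by metis
  define Q where "Q = (\<lambda>g. {fst g..<fst g + s g} \<times> {snd g..<snd g + s g})"
  have finG: "finite G" unfolding G_def by auto
  have nz: "0 < s g" if "g \<in> G" for g using s(1)[OF that] by auto
  have "\<exists>H\<subseteq>G. (\<forall>g\<in>H. \<forall>h\<in>H. g \<noteq> h \<longrightarrow> Q g \<inter> Q h = {}) \<and> card G \<le> 4 * (\<Sum>h\<in>H. (s h)\<^sup>2)"
    unfolding Q_def by (rule vitali_squares[OF finG nz])
  then obtain H where H: "H \<subseteq> G" "\<forall>g\<in>H. \<forall>h\<in>H. g \<noteq> h \<longrightarrow> Q g \<inter> Q h = {}"
      "card G \<le> 4 * (\<Sum>h\<in>H. (s h)\<^sup>2)"
    by (elim exE conjE)
  have finH: "finite H" using H(1) finG finite_subset by blast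
  have sq: "l * (real (s h))\<^sup>2 \<le> (\<Sum>g\<in>Q h. f (act g x))" if h: "h \<in> H" for h
  proof -
    have hG: "h \<in> G" using h H by auto
    have "(\<Sum>g\<in>Q h. f (act g x)) = (\<Sum>g\<in>{..<s h} \<times> {..<s h}. f (act (g + h) x))"
      by (rule sum.reindex_bij_witness[of _ "\<lambda>g. g + h" "\<lambda>g. (fst g - fst h, snd g - snd h)"])
         (auto simp: Q_def plus_prod_def)
    also have "\<dots> = (\<Sum>g\<in>{..<s h} \<times> {..<s h}. f (act g (act h x)))"
      using x by (simp add: act_act)
    also have "\<dots> = avg f (s h) (act h x) * (real (s h))\<^sup>2"
      using nz[OF hG] by (simp add: avg_def)
    also have "\<dots> \<ge> l * (real (s h))\<^sup>2"
      using s(2)[OF hG] by (intro mult_right_mono) auto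
    finally show ?thesis .
  qed
  have "(\<Sum>g\<in>{..<N} \<times> {..<N}. indicator E (act g x)) = real (card G)"
    by (simp add: G_def sum.If_cases indicator_def Int_def)
  then have "l * (\<Sum>g\<in>{..<N} \<times> {..<N}. indicator E (act g x)) = l * real (card G)"
    by simp
  also have "\<dots> \<le> l * (4 * (\<Sum>h\<in>H. (real (s h))\<^sup>2))"
  proof (intro mult_left_mono)
    have "real (card G) \<le> real (4 * (\<Sum>h\<in>H. (s h)\<^sup>2))" using H(3) by (simp only: of_nat_le_iff)
    then show "real (card G) \<le> 4 * (\<Sum>h\<in>H. (real (s h))\<^sup>2)" by simp
  qed (use l in simp)
  also have "\<dots> = 4 * (\<Sum>h\<in>H. l * (real (s h))\<^sup>2)"
    by (simp add: sum_distrib_left mult.left_commute)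
  also have "\<dots> \<le> 4 * (\<Sum>h\<in>H. \<Sum>g\<in>Q h. f (act g x))"
    using sq by (intro mult_left_mono sum_mono) auto
  also have "(\<Sum>h\<in>H. \<Sum>g\<in>Q h. f (act g x)) = (\<Sum>g\<in>\<Union>(Q ` H). f (act g x))"
    using H(2) finH by (subst sum.UNION_disjoint) (auto simp: Q_def)
  also have "\<dots> \<le> (\<Sum>g\<in>{..<2*N} \<times> {..<2*N}. f (act g x))"
  proof (rule sum_mono2)
    show "\<Union>(Q ` H) \<subseteq> {..<2*N} \<times> {..<2*N}"
    proof
      fix z assume "z \<in> \<Union>(Q ` H)"
      then obtain h where h: "h \<in> H" "z \<in> Q h" by auto
      then have "h \<in> G" using H by auto
      then show "z \<in> {..<2*N} \<times> {..<2*N}" using s(1)[of h] h by (auto simp: Q_def G_def)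
    qed
  qed (auto simp: nonneg)
  finally show ?thesis by simp
qed

text \<open>Integrating the orbitwise bound over \<open>M\<close> replaces each shifted term by its
  mean, and \<open>N * N\<close> cancels. The constant is 4 from the covering times 4 from the
  doubled side.\<close>

lemma maximal_finite:
  fixes f :: "'a \<Rightarrow> real"
  assumes nonneg: "\<And>x. f x \<ge> 0" and l: "l > 0" and f: "integrable M f"
  shows "l * measure M {x \<in> space M. \<exists>n\<in>{1..N}. avg f n x > l} \<le> 16 * (\<integral>x. f x \<partial>M)"
proof (cases "N = 0")
  case True
  then show ?thesis using nonneg by (simp add: integral_nonneg_AE)
next
  case False
  have [measurable]: "f \<in> borel_measurable M" using f by auto
  define E where "E = {x \<in> space M. \<exists>n\<in>{1..N}. avg f n x > l}"
  have [measurable]: "E \<in> sets M" unfolding E_def by measurable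
  have iE: "integrable M (indicator E :: 'a \<Rightarrow> real)" by (simp add: emeasure_eq_measure)
  have "(\<integral>x. l * (\<Sum>g\<in>{..<N} \<times> {..<N}. indicator E (act g x)) \<partial>M)
     \<le> (\<integral>x. 4 * (\<Sum>g\<in>{..<2*N} \<times> {..<2*N}. f (act g x)) \<partial>M)"
  proof (intro integral_mono)
    show "l * (\<Sum>g\<in>{..<N} \<times> {..<N}. indicator E (act g x))
     \<le> 4 * (\<Sum>g\<in>{..<2*N} \<times> {..<2*N}. f (act g x))" if "x \<in> space M" for x
      using maximal_pointwise[of f l x N, OF nonneg l that] by (simp only: E_def)
  qed (intro integrable_mult_right Bochner_Integration.integrable_sum integrable_act iE f)+
  also have "(\<integral>x. l * (\<Sum>g\<in>{..<N} \<times> {..<N}. indicator E (act g x)) \<partial>M)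
      = l * (\<Sum>g\<in>{..<N} \<times> {..<N}. (\<integral>x. indicator E (act g x) \<partial>M))"
    by (simp add: integrable_act[OF iE])
  also have "\<dots> = l * (real N * real N * measure M E)"
    by (subst integral_act) auto
  also have "(\<integral>x. 4 * (\<Sum>g\<in>{..<2*N} \<times> {..<2*N}. f (act g x)) \<partial>M) = 16 * (real N * real N * (\<integral>x. f x \<partial>M))"
    using f by (simp add: integrable_act integral_act)
  finally have "(real N * real N) * (l * measure M E) \<le> (real N * real N) * (16 * (\<integral>x. f x \<partial>M))"
    by (simp add: algebra_simps)
  then show ?thesis using False unfolding E_def by (subst (asm) mult_le_cancel_left_pos) auto
qed

lemma maximal_ineq:
  fixes f :: "'a \<Rightarrow> real"
  assumes nonneg: "\<And>x. f x \<ge> 0" and l: "l > 0" and f: "integrable M f"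
  shows "l * measure M {x \<in> space M. \<exists>n\<ge>1. avg f n x > l} \<le> 16 * (\<integral>x. f x \<partial>M)"
proof -
  have [measurable]: "f \<in> borel_measurable M" using f by auto
  define E where "E N = {x \<in> space M. \<exists>n\<in>{1..N}. avg f n x > l}" for N
  have "(\<lambda>N. measure M (E N)) \<longlonglongrightarrow> measure M (\<Union>N. E N)"
  proof (rule finite_Lim_measure_incseq)
    show "range E \<subseteq> sets M" unfolding E_def by auto
    show "incseq E" unfolding E_def incseq_def by fastforce
  qed
  then have "(\<lambda>N. l * measure M (E N)) \<longlonglongrightarrow> l * measure M (\<Union>N. E N)"
    by (intro tendsto_intros)
  then have "l * measure M (\<Union>N. E N) \<le> 16 * (\<integral>x. f x \<partial>M)"
    by (rule LIMSEQ_le_const2) (use maximal_finite[OF nonneg l f] in \<open>auto simp: E_def\<close>)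
  also have "(\<Union>N. E N) = {x \<in> space M. \<exists>n\<ge>1. avg f n x > l}"
    unfolding E_def by (auto simp: Suc_le_eq) (metis atLeastAtMost_iff Suc_le_eq order_refl)
  finally show ?thesis .
qed

end

section \<open>Mean ergodic theorem by bounded coboundaries\<close>

text \<open>The Riesz-Fischer argument. The sum \<open>W\<close> of the absolute increments is
  integrable, hence finite almost everywhere, and it dominates all the errors
  \<open>u n - l\<close>.\<close>

lemma L1_limit_of_summable_increments:
  fixes u :: "nat \<Rightarrow> 'a \<Rightarrow> real"
  assumes u: "\<And>n. integrable M (u n)" and b: "summable b"
    and le: "\<And>n. (\<integral>x. \<bar>u (Suc n) x - u n x\<bar> \<partial>M) \<le> b n"
  shows "\<exists>l. integrable M l \<and> (\<lambda>n. \<integral>x. \<bar>u n x - l x\<bar> \<partial>M) \<longlonglongrightarrow> 0"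
proof -
  define d where "d n x = u (Suc n) x - u n x" for n x
  have [measurable]: "u n \<in> borel_measurable M" "d n \<in> borel_measurable M" for n
    using u unfolding d_def by auto
  have id: "integrable M (\<lambda>x. \<bar>d n x\<bar>)" for n using u unfolding d_def by auto
  have sb: "summable (\<lambda>n. \<integral>x. \<bar>d n x\<bar> \<partial>M)"
    by (rule summable_comparison_test'[OF b, of 0]) (use le in \<open>auto simp: d_def integral_nonneg_AE\<close>)
  have "(\<integral>\<^sup>+x. (\<Sum>n. ennreal \<bar>d n x\<bar>) \<partial>M) = (\<Sum>n. \<integral>\<^sup>+x. ennreal \<bar>d n x\<bar> \<partial>M)"
    by (intro nn_integral_suminf) auto
  also have "\<dots> = (\<Sum>n. ennreal (\<integral>x. \<bar>d n x\<bar> \<partial>M))"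
    using id by (simp add: nn_integral_eq_integral)
  also have "\<dots> < \<infinity>"
    using sb by (subst suminf_ennreal2) (auto simp: integral_nonneg_AE)
  finally have fin: "(\<integral>\<^sup>+x. (\<Sum>n. ennreal \<bar>d n x\<bar>) \<partial>M) < \<infinity>" .
  then have "AE x in M. (\<Sum>n. ennreal \<bar>d n x\<bar>) \<noteq> \<infinity>"
    by (intro nn_integral_PInf_AE) auto
  then have AEs: "AE x in M. summable (\<lambda>n. \<bar>d n x\<bar>)"
    by eventually_elim (auto intro!: summable_suminf_not_top)
  define W where "W x = (\<Sum>n. \<bar>d n x\<bar>)" for x
  define l where "l x = u 0 x + (\<Sum>n. d n x)" for x
  have [measurable]: "W \<in> borel_measurable M" "l \<in> borel_measurable M"
    unfolding W_def l_def by measurable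
  have iW: "integrable M W" unfolding W_def
    using id sb AEs by (intro integrable_suminf) auto
  have tele: "u n x = u 0 x + (\<Sum>k<n. d k x)" for n x
    unfolding d_def using sum_lessThan_telescope[of "\<lambda>k. u k x" n] by simp
  have bnd: "AE x in M. \<bar>u n x - l x\<bar> \<le> W x" for n
    using AEs
  proof eventually_elim
    case (elim x)
    note s = elim
    have sd: "summable (\<lambda>n. d n x)" using summable_rabs_cancel[OF s] .
    have "l x - u n x = (\<Sum>k. d (k + n) x)"
      using suminf_split_initial_segment[OF sd, of n] tele[of n x] by (simp add: l_def)
    also have "\<bar>\<dots>\<bar> \<le> (\<Sum>k. \<bar>d (k + n) x\<bar>)"
      using summable_ignore_initial_segment[OF s, of n] by (intro summable_rabs)
    also have "\<dots> \<le> W x"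
      using suminf_split_initial_segment[OF s, of n] by (simp add: W_def sum_nonneg)
    finally show ?case by (simp add: abs_minus_commute)
  qed
  have conv: "AE x in M. (\<lambda>n. \<bar>u n x - l x\<bar>) \<longlonglongrightarrow> 0"
    using AEs
  proof eventually_elim
    case (elim x)
    note s = elim
    have sd: "summable (\<lambda>n. d n x)" using summable_rabs_cancel[OF s] .
    have "(\<lambda>n. u 0 x + (\<Sum>k<n. d k x)) \<longlonglongrightarrow> l x"
      unfolding l_def by (intro tendsto_intros summable_LIMSEQ sd)
    then have "(\<lambda>n. u n x) \<longlonglongrightarrow> l x" by (simp only: tele[symmetric])
    then show ?case
      by (simp add: LIM_zero tendsto_rabs_zero)
  qed
  have "(\<lambda>n. \<integral>x. \<bar>u n x - l x\<bar> \<partial>M) \<longlonglongrightarrow> (\<integral>x. 0 \<partial>M)"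
    by (rule integral_dominated_convergence[where w = W]) (use iW conv bnd in auto)
  moreover have "integrable M l"
  proof -
    have "integrable M (\<lambda>x. u 0 x - l x)"
      by (rule Bochner_Integration.integrable_bound[OF iW]) (use bnd[of 0] in auto)
    then have "integrable M (\<lambda>x. u 0 x - (u 0 x - l x))"
      by (rule Bochner_Integration.integrable_diff[OF u])
    then show ?thesis by simp
  qed
  ultimately show ?thesis by auto
qed

text \<open>Stands in for Cauchy-Schwarz: with \<open>r\<close> of the order of the inverse
  \<open>L\<^sup>2\<close> norm of \<open>y\<close>, integration over a probability space bounds the
  \<open>L\<^sup>1\<close> norm by a multiple of the \<open>L\<^sup>2\<close> norm.\<close>

lemma abs_le_square_scaled:
  fixes y r :: real
  assumes "r > 0"
  shows "\<bar>y\<bar> \<le> 1 / (2 * r) + r / 2 * y\<^sup>2"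
proof -
  have "0 \<le> (\<bar>y\<bar> * r - 1)\<^sup>2 / (2 * r)" using assms by simp
  also have "\<dots> = 1 / (2 * r) + r / 2 * y\<^sup>2 - \<bar>y\<bar>"
    using assms by (simp add: power2_diff power_mult_distrib field_simps) (simp add: power2_eq_square)
  finally show ?thesis by simp
qed

context ergodic_pair
begin

text \<open>Ergodicity only speaks about strictly invariant sets: the almost invariant set is replaced by the
  set of points whose orbit is eventually in it.\<close>

lemma AE_invariant_set_trivial:
  assumes A [measurable]: "A \<in> sets M"
    and iT: "AE x in M. T x \<in> A \<longleftrightarrow> x \<in> A" and iS: "AE x in M. S x \<in> A \<longleftrightarrow> x \<in> A"
  shows "(AE x in M. x \<in> A) \<or> (AE x in M. x \<notin> A)"
proof -
  define A' where "A' = {x \<in> space M. \<exists>N. \<forall>i\<ge>N. \<forall>j\<ge>N. act (i, j) x \<in> A}"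
  have [measurable]: "A' \<in> sets M" unfolding A'_def by measurable
  have "AE x in M. act (i, j) x \<in> A \<longleftrightarrow> x \<in> A" for i j
  proof (induction i)
    case 0
    show ?case
    proof (induction j)
      case (Suc j)
      have "AE x in M. S (act (0, j) x) \<in> A \<longleftrightarrow> act (0, j) x \<in> A"
        using AE_act[OF iS] .
      then show ?case using Suc AE_space by eventually_elim (simp add: act_S)
    qed simp
  next
    case (Suc i)
    have "AE x in M. T (act (i, j) x) \<in> A \<longleftrightarrow> act (i, j) x \<in> A"
      using AE_act[OF iT] .
    then show ?case using Suc AE_space by eventually_elim (simp add: act_T)
  qed
  then have "AE x in M. \<forall>i j. act (i, j) x \<in> A \<longleftrightarrow> x \<in> A"
    by (simp add: AE_all_countable)
  then have eq: "AE x in M. x \<in> A' \<longleftrightarrow> x \<in> A"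
    using AE_space by eventually_elim (auto simp: A'_def)
  have shift: "(\<exists>N. \<forall>i\<ge>N. \<forall>j\<ge>N. P (i + a) (j + b)) \<longleftrightarrow> (\<exists>N. \<forall>i\<ge>N. \<forall>j\<ge>N. P i j)"
    for P :: "nat \<Rightarrow> nat \<Rightarrow> bool" and a b
  proof
    assume "\<exists>N. \<forall>i\<ge>N. \<forall>j\<ge>N. P (i + a) (j + b)"
    then obtain N where N: "\<And>i j. i \<ge> N \<Longrightarrow> j \<ge> N \<Longrightarrow> P (i + a) (j + b)" by blast
    have "P i j" if "i \<ge> N + a + b" "j \<ge> N + a + b" for i j
      using N[of "i - a" "j - b"] that by auto
    then show "\<exists>N. \<forall>i\<ge>N. \<forall>j\<ge>N. P i j" by blast
  next
    assume "\<exists>N. \<forall>i\<ge>N. \<forall>j\<ge>N. P i j"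
    then obtain N where "\<And>i j. i \<ge> N \<Longrightarrow> j \<ge> N \<Longrightarrow> P i j" by blast
    then have "\<forall>i\<ge>N. \<forall>j\<ge>N. P (i + a) (j + b)" by simp
    then show "\<exists>N. \<forall>i\<ge>N. \<forall>j\<ge>N. P (i + a) (j + b)" by blast
  qed
  have "T x \<in> A' \<longleftrightarrow> x \<in> A'" "S x \<in> A' \<longleftrightarrow> x \<in> A'" if "x \<in> space M" for x
    using shift[of "\<lambda>i j. act (i, j) x \<in> A" 1 0] shift[of "\<lambda>i j. act (i, j) x \<in> A" 0 1] that
    by (simp_all add: A'_def T_act S_act)
  then have "T -` A' \<inter> space M = A'" "S -` A' \<inter> space M = A'"
    using sets.sets_into_space[OF \<open>A' \<in> sets M\<close>] by auto
  then have "prob A' = 0 \<or> prob A' = 1"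
    using erg unfolding jointly_ergodic_def by auto
  then show ?thesis
  proof
    assume "prob A' = 0"
    then have "AE x in M. x \<notin> A'" by (simp add: prob_eq_0)
    then have "AE x in M. x \<notin> A" using eq by eventually_elim simp
    then show ?thesis by simp
  next
    assume "prob A' = 1"
    then have "AE x in M. x \<in> A'" by (simp add: prob_eq_1)
    then have "AE x in M. x \<in> A" using eq by eventually_elim simp
    then show ?thesis by simp
  qed
qed

text \<open>The level set is cut at the mean itself. On either alternative \<open>f - c\<close> has
  constant sign and integral 0, so it vanishes almost everywhere.\<close>

lemma AE_invariant_imp_const:
  fixes f :: "'a \<Rightarrow> real"
  assumes f: "integrable M f"
    and iT: "AE x in M. f (T x) = f x" and iS: "AE x in M. f (S x) = f x"
  shows "AE x in M. f x = (\<integral>x. f x \<partial>M)"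
proof -
  have [measurable]: "f \<in> borel_measurable M" using f by auto
  define c where "c = (\<integral>x. f x \<partial>M)"
  define A where "A = {x \<in> space M. f x > c}"
  have int0: "(\<integral>x. f x - c \<partial>M) = 0" "(\<integral>x. c - f x \<partial>M) = 0"
    using f by (simp_all add: c_def prob_space)
  have "(AE x in M. x \<in> A) \<or> (AE x in M. x \<notin> A)"
  proof (rule AE_invariant_set_trivial)
    show "AE x in M. T x \<in> A \<longleftrightarrow> x \<in> A" using iT AE_space by eventually_elim (auto simp: A_def)
    show "AE x in M. S x \<in> A \<longleftrightarrow> x \<in> A" using iS AE_space by eventually_elim (auto simp: A_def)
  qed (simp add: A_def)
  then show ?thesis
  proof
    assume a: "AE x in M. x \<in> A"
    have "AE x in M. f x - c = 0"
      using a f int0 by (subst integral_nonneg_eq_0_iff_AE[symmetric]) (auto simp: A_def)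
    then show ?thesis by eventually_elim (simp add: c_def)
  next
    assume a: "AE x in M. x \<notin> A"
    have "AE x in M. c - f x = 0"
      using a f int0 AE_space by (subst integral_nonneg_eq_0_iff_AE[symmetric]) (auto simp: A_def)
    then show ?thesis by eventually_elim (simp add: c_def)
  qed
qed

text \<open>Bounded at every point, not only almost everywhere: the class is then stable under
  composition with \<open>T\<close> and \<open>S\<close>, and averages of coboundaries can be
  estimated on every orbit.\<close>

definition bounded_rv :: "('a \<Rightarrow> real) \<Rightarrow> bool" where
  "bounded_rv u \<longleftrightarrow> u \<in> borel_measurable M \<and> (\<exists>B. \<forall>x. \<bar>u x\<bar> \<le> B)"

definition cobound :: "('a \<Rightarrow> real) \<Rightarrow> ('a \<Rightarrow> real) \<Rightarrow> 'a \<Rightarrow> real" where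
  "cobound u v x = (u x - u (T x)) + (v x - v (S x))"

lemma bounded_rv_measurable: "bounded_rv u \<Longrightarrow> u \<in> borel_measurable M"
  by (simp add: bounded_rv_def)

lemma bounded_rvI:
  assumes "u \<in> borel_measurable M" "\<And>x. \<bar>u x\<bar> \<le> B"
  shows "bounded_rv u"
  using assms unfolding bounded_rv_def by auto

lemma bounded_rv_integrable:
  assumes "bounded_rv u"
  shows "integrable M u"
proof -
  obtain B where "u \<in> borel_measurable M" "\<And>x. \<bar>u x\<bar> \<le> B" using assms unfolding bounded_rv_def by auto
  then show ?thesis by (intro integrable_const_bound[where B = B]) auto
qed

lemma bounded_rv_add:
  assumes "bounded_rv u" "bounded_rv v"
  shows "bounded_rv (\<lambda>x. u x + v x)"
proof -
  obtain B where [measurable]: "u \<in> borel_measurable M" and B: "\<And>x. \<bar>u x\<bar> \<le> B"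
    using assms(1) unfolding bounded_rv_def by auto
  obtain C where [measurable]: "v \<in> borel_measurable M" and C: "\<And>x. \<bar>v x\<bar> \<le> C"
    using assms(2) unfolding bounded_rv_def by auto
  show ?thesis
  proof (rule bounded_rvI)
    show "\<bar>u x + v x\<bar> \<le> B + C" for x using B[of x] C[of x] by linarith
  qed measurable
qed

lemma bounded_rv_mult:
  assumes "bounded_rv u" "bounded_rv v"
  shows "bounded_rv (\<lambda>x. u x * v x)"
proof -
  obtain B where [measurable]: "u \<in> borel_measurable M" and B: "\<And>x. \<bar>u x\<bar> \<le> B"
    using assms(1) unfolding bounded_rv_def by auto
  obtain C where [measurable]: "v \<in> borel_measurable M" and C: "\<And>x. \<bar>v x\<bar> \<le> C"
    using assms(2) unfolding bounded_rv_def by auto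
  show ?thesis
  proof (rule bounded_rvI)
    have "0 \<le> B" using B[of undefined] by linarith
    then show "\<bar>u x * v x\<bar> \<le> B * C" for x unfolding abs_mult by (intro mult_mono B C) auto
  qed measurable
qed

lemma bounded_rv_cmult: "bounded_rv u \<Longrightarrow> bounded_rv (\<lambda>x. c * u x)"
  using bounded_rv_mult[of "\<lambda>x. c" u] bounded_rvI[of "\<lambda>x. c" "\<bar>c\<bar>"] by simp

lemma bounded_rv_diff: "bounded_rv u \<Longrightarrow> bounded_rv v \<Longrightarrow> bounded_rv (\<lambda>x. u x - v x)"
  using bounded_rv_add[of u "\<lambda>x. - 1 * v x"] bounded_rv_cmult[of v "-1"] by simp

lemma bounded_rv_T: "bounded_rv u \<Longrightarrow> bounded_rv (\<lambda>x. u (T x))"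
  and bounded_rv_S: "bounded_rv u \<Longrightarrow> bounded_rv (\<lambda>x. u (S x))"
  by (auto simp: bounded_rv_def)

lemma bounded_rv_zero: "bounded_rv (\<lambda>x. 0)"
  by (auto simp: bounded_rv_def)

lemma bounded_rv_cobound: "bounded_rv u \<Longrightarrow> bounded_rv v \<Longrightarrow> bounded_rv (cobound u v)"
  unfolding cobound_def
  by (intro bounded_rv_add bounded_rv_diff bounded_rv_T bounded_rv_S)

lemma integral_T: "f \<in> borel_measurable M \<Longrightarrow> (\<integral>x. f (T x) \<partial>M) = (\<integral>x. (f x :: real) \<partial>M)"
  and integral_S: "f \<in> borel_measurable M \<Longrightarrow> (\<integral>x. f (S x) \<partial>M) = (\<integral>x. f x \<partial>M)"
  using integral_act[of f "(1, 0)"] integral_act[of f "(0, 1)"] by (auto simp: act_def)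

lemma integrable_T: "integrable M f \<Longrightarrow> integrable M (\<lambda>x. f (T x) :: real)"
  and integrable_S: "integrable M f \<Longrightarrow> integrable M (\<lambda>x. f (S x))"
  using integrable_act[of f "(1, 0)"] integrable_act[of f "(0, 1)"] by (auto simp: act_def)

lemma integral_cobound: "bounded_rv u \<Longrightarrow> bounded_rv v \<Longrightarrow> (\<integral>x. cobound u v x \<partial>M) = 0"
  unfolding cobound_def
  by (simp add: bounded_rv_integrable bounded_rv_T bounded_rv_S integral_T integral_S bounded_rv_measurable)

text \<open>Minimise the \<open>L\<^sup>2\<close> norm over all \<open>f\<close> minus a bounded coboundary. By the parallelogram law a minimising
  sequence converges, and since the class is stable under \<open>T\<close> and \<open>S\<close> the limit is invariant, hence constant.\<close>

lemma L1_approx_cobound_bounded: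
  assumes f: "bounded_rv f" and e: "e > 0"
  shows "\<exists>u v. bounded_rv u \<and> bounded_rv v \<and>
    (\<integral>x. \<bar>f x - (\<integral>x. f x \<partial>M) - cobound u v x\<bar> \<partial>M) < e"
proof -
  define C where "C = {c. \<exists>u v. bounded_rv u \<and> bounded_rv v \<and> c = (\<lambda>x. f x - cobound u v x)}"
  define N where "N c = (\<integral>x. (c x)\<^sup>2 \<partial>M)" for c :: "'a \<Rightarrow> real"
  have Cb: "bounded_rv c" if "c \<in> C" for c
    using that f by (auto simp: C_def intro!: bounded_rv_diff bounded_rv_cobound)
  have fC: "f \<in> C" unfolding C_def
    by (auto intro!: exI[of _ "\<lambda>x. 0"] simp: bounded_rv_zero cobound_def)
  have Cmid: "(\<lambda>x. (c x + c' x) / 2) \<in> C" if cc: "c \<in> C" "c' \<in> C" for c c'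
  proof -
    obtain u v u' v' where b: "bounded_rv u" "bounded_rv v" "bounded_rv u'" "bounded_rv v'"
      "c = (\<lambda>x. f x - cobound u v x)" "c' = (\<lambda>x. f x - cobound u' v' x)"
      using cc unfolding C_def by (elim CollectE exE conjE)
    then have "(\<lambda>x. (c x + c' x) / 2) =
        (\<lambda>x. f x - cobound (\<lambda>x. (1/2) * (u x + u' x)) (\<lambda>x. (1/2) * (v x + v' x)) x)"
      by (auto simp: cobound_def field_simps)
    then show ?thesis unfolding C_def
      by (intro CollectI exI[of _ "\<lambda>x. (1/2) * (u x + u' x)"] exI[of _ "\<lambda>x. (1/2) * (v x + v' x)"]
          conjI bounded_rv_cmult bounded_rv_add b)
  qed
  have CT: "(\<lambda>x. c (T x)) \<in> C" if cc: "c \<in> C" for c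
  proof -
    obtain u v where b: "bounded_rv u" "bounded_rv v" "c = (\<lambda>x. f x - cobound u v x)"
      using cc unfolding C_def by (elim CollectE exE conjE)
    \<comment> \<open>\<open>c \<circ> T\<close> is \<open>c\<close> minus the coboundary of
      \<open>c\<close>, so the transfer function \<open>u\<close> turns into
      \<open>u + c\<close>.\<close>
    then have "(\<lambda>x. c (T x)) = (\<lambda>x. f x - cobound (\<lambda>x. u x + c x) v x)"
      by (auto simp: cobound_def)
    then show ?thesis unfolding C_def
      by (intro CollectI exI[of _ "\<lambda>x. u x + c x"] exI[of _ v] conjI bounded_rv_add b Cb[OF cc])
  qed
  have CS: "(\<lambda>x. c (S x)) \<in> C" if cc: "c \<in> C" for c
  proof -
    obtain u v where b: "bounded_rv u" "bounded_rv v" "c = (\<lambda>x. f x - cobound u v x)"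
      using cc unfolding C_def by (elim CollectE exE conjE)
    then have "(\<lambda>x. c (S x)) = (\<lambda>x. f x - cobound u (\<lambda>x. v x + c x) x)"
      by (auto simp: cobound_def)
    then show ?thesis unfolding C_def
      by (intro CollectI exI[of _ u] exI[of _ "\<lambda>x. v x + c x"] conjI bounded_rv_add b Cb[OF cc])
  qed
  define d where "d = Inf (N ` C)"
  have bdd: "bdd_below (N ` C)" by (rule bdd_belowI[of _ 0]) (auto simp: N_def)
  have dle: "d \<le> N c" if "c \<in> C" for c unfolding d_def using that bdd by (intro cInf_lower) auto
  have "\<exists>c\<in>C. N c < d + (1/4) ^ n" for n
    using cInf_lessD[of "N ` C" "d + (1/4) ^ n"] fC unfolding d_def by auto
  then obtain c where c: "\<And>n. c n \<in> C" "\<And>n. N (c n) < d + (1/4) ^ n" by metis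
  have i2: "integrable M (\<lambda>x. (a x)\<^sup>2)" if "bounded_rv a" for a
    unfolding power2_eq_square using that by (intro bounded_rv_integrable bounded_rv_mult)
  have close: "(\<integral>x. \<bar>a x - b x\<bar> \<partial>M) \<le> 5/2 * (1/2) ^ n"
    if ab: "a \<in> C" "b \<in> C" "N a < d + (1/4) ^ n" "N b < d + (1/4) ^ n" for a b n
  proof -
    note ba = Cb[OF ab(1)] and bb = Cb[OF ab(2)]
    note bd = bounded_rv_diff[OF ba bb] and bs = Cb[OF Cmid[OF ab(1,2)]]
    have "(\<integral>x. (a x - b x)\<^sup>2 \<partial>M) = (\<integral>x. 2 * (a x)\<^sup>2 + 2 * (b x)\<^sup>2 - 4 * ((a x + b x) / 2)\<^sup>2 \<partial>M)"
      by (intro Bochner_Integration.integral_cong) (auto simp: power2_eq_square field_simps)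
    also have "\<dots> = 2 * N a + 2 * N b - 4 * N (\<lambda>x. (a x + b x) / 2)"
      unfolding N_def using i2[OF ba] i2[OF bb] i2[OF bs] by simp
    also have "\<dots> \<le> 4 * (1/4) ^ n" using dle[OF Cmid[OF ab(1,2)]] ab(3,4) by linarith
    finally have L2: "(\<integral>x. (a x - b x)\<^sup>2 \<partial>M) \<le> 4 * (1/4) ^ n" .
    \<comment> \<open>\<open>2 / r\<close> bounds the \<open>L\<^sup>2\<close> distance, and the
      scaled inequality then gives \<open>1 / (2 * r) + 2 / r\<close>, that is
      \<open>5 / (2 * r)\<close>.\<close>
    define r :: real where "r = 2 ^ n"
    have r: "r > 0" "(1/4) ^ n = 1 / (r * r)" "(1/2) ^ n = 1 / r"
      by (auto simp: r_def power_divide simp flip: power_mult_distrib)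
    have i1: "integrable M (\<lambda>x. \<bar>a x - b x\<bar>)" using bounded_rv_integrable[OF bd] by simp
    have "(\<integral>x. \<bar>a x - b x\<bar> \<partial>M) \<le> (\<integral>x. 1 / (2 * r) + r / 2 * (a x - b x)\<^sup>2 \<partial>M)"
      using i2[OF bd] i1 abs_le_square_scaled[OF r(1)] by (intro integral_mono) auto
    also have "\<dots> = 1 / (2 * r) + r / 2 * (\<integral>x. (a x - b x)\<^sup>2 \<partial>M)"
      using i2[OF bd] by (simp add: prob_space)
    also have "\<dots> \<le> 1 / (2 * r) + r / 2 * (4 * (1/4) ^ n)"
      using L2 r(1) by (intro add_left_mono mult_left_mono) auto
    also have "\<dots> = 5/2 * (1/2) ^ n"
      using r(1) unfolding r(2,3) by (simp add: field_simps)
    finally show ?thesis .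
  qed
  have ic: "integrable M (c n)" for n using Cb[OF c(1)] by (rule bounded_rv_integrable)
  have cS: "N (c (Suc n)) < d + (1/4) ^ n" for n
    using c(2)[of "Suc n"] by (rule order.strict_trans2) simp
  obtain l where l: "integrable M l" "(\<lambda>n. \<integral>x. \<bar>c n x - l x\<bar> \<partial>M) \<longlonglongrightarrow> 0"
    using L1_limit_of_summable_increments[of M c "\<lambda>n. 5/2 * (1/2) ^ n"] ic
      close[OF c(1) c(1) cS c(2)] by (auto simp: summable_mult)
  have inv: "AE x in M. l (R x) = l x"
    if R: "\<And>f :: 'a \<Rightarrow> real. f \<in> borel_measurable M \<Longrightarrow> (\<integral>x. f (R x) \<partial>M) = (\<integral>x. f x \<partial>M)"
          "\<And>f :: 'a \<Rightarrow> real. integrable M f \<Longrightarrow> integrable M (\<lambda>x. f (R x))"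
          "\<And>c. c \<in> C \<Longrightarrow> (\<lambda>x. c (R x)) \<in> C" for R :: "'a \<Rightarrow> 'a"
  proof -
    have [measurable]: "l \<in> borel_measurable M" "c n \<in> borel_measurable M" for n
      using l(1) ic by auto
    have "(\<integral>x. \<bar>l (R x) - l x\<bar> \<partial>M) \<le> 2 * (\<integral>x. \<bar>c n x - l x\<bar> \<partial>M) + 5/2 * (1/2) ^ n" for n
    proof -
      \<comment> \<open>\<open>R\<close> preserves the norm, so \<open>c n \<circ> R\<close> is as
        close to the infimum as \<open>c n\<close>, and \<open>close\<close> applies to the
        pair.\<close>
      have NR: "N (\<lambda>x. c n (R x)) = N (c n)"
        unfolding N_def using R(1)[of "\<lambda>x. (c n x)\<^sup>2"] by simp
      have "(\<integral>x. \<bar>l (R x) - l x\<bar> \<partial>M) \<le>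
        (\<integral>x. \<bar>c n (R x) - l (R x)\<bar> + \<bar>c n (R x) - c n x\<bar> + \<bar>c n x - l x\<bar> \<partial>M)"
        using l(1) ic R(2) by (intro integral_mono) auto
      also have "\<dots> = (\<integral>x. \<bar>c n (R x) - l (R x)\<bar> \<partial>M) + (\<integral>x. \<bar>c n (R x) - c n x\<bar> \<partial>M)
          + (\<integral>x. \<bar>c n x - l x\<bar> \<partial>M)"
        using l(1) ic R(2) by simp
      also have "(\<integral>x. \<bar>c n (R x) - l (R x)\<bar> \<partial>M) = (\<integral>x. \<bar>c n x - l x\<bar> \<partial>M)"
        using R(1)[of "\<lambda>x. \<bar>c n x - l x\<bar>"] by simp
      also have "(\<integral>x. \<bar>c n (R x) - c n x\<bar> \<partial>M) \<le> 5/2 * (1/2) ^ n"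
        using close[OF R(3)[OF c(1)] c(1) _ c(2)] c(2) NR by simp
      finally show ?thesis by simp
    qed
    moreover have "(\<lambda>n. 2 * (\<integral>x. \<bar>c n x - l x\<bar> \<partial>M) + 5/2 * (1/2) ^ n) \<longlonglongrightarrow> 2 * 0 + 5/2 * 0"
      by (intro tendsto_intros l(2) LIMSEQ_realpow_zero) auto
    ultimately have "(\<integral>x. \<bar>l (R x) - l x\<bar> \<partial>M) \<le> 2 * 0 + 5/2 * 0"
      by (intro LIMSEQ_le_const) auto
    moreover have "(\<integral>x. \<bar>l (R x) - l x\<bar> \<partial>M) \<ge> 0" by simp
    ultimately have "(\<integral>x. \<bar>l (R x) - l x\<bar> \<partial>M) = 0" by linarith
    then have "AE x in M. \<bar>l (R x) - l x\<bar> = 0"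
      using l(1) R(2) by (subst (asm) integral_nonneg_eq_0_iff_AE) auto
    then show ?thesis by eventually_elim simp
  qed
  have lc: "AE x in M. l x = (\<integral>x. l x \<partial>M)"
    by (intro AE_invariant_imp_const l(1) inv integral_T integral_S integrable_T integrable_S CT CS)
  \<comment> \<open>Coboundaries have mean 0, so the constant limit \<open>l\<close> can only be the
    mean of \<open>f\<close>.\<close>
  have ci: "(\<integral>x. c n x \<partial>M) = (\<integral>x. f x \<partial>M)" for n
  proof -
    obtain u v where b: "bounded_rv u" "bounded_rv v" "c n = (\<lambda>x. f x - cobound u v x)"
      using c(1)[of n] unfolding C_def by (elim CollectE exE conjE)
    then show ?thesis
      using integral_cobound[OF b(1,2)] bounded_rv_integrable[OF f]
        bounded_rv_integrable[OF bounded_rv_cobound[OF b(1,2)]] by simp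
  qed
  have "\<bar>(\<integral>x. f x \<partial>M) - (\<integral>x. l x \<partial>M)\<bar> \<le> (\<integral>x. \<bar>c n x - l x\<bar> \<partial>M)" for n
  proof -
    have "(\<integral>x. f x \<partial>M) - (\<integral>x. l x \<partial>M) = (\<integral>x. c n x - l x \<partial>M)"
      using ic l(1) ci[of n] by simp
    then show ?thesis using integral_abs_bound[of M "\<lambda>x. c n x - l x"] by simp
  qed
  then have "\<bar>(\<integral>x. f x \<partial>M) - (\<integral>x. l x \<partial>M)\<bar> \<le> 0"
    using l(2) by (intro LIMSEQ_le_const[OF l(2)]) auto
  then have fl: "AE x in M. l x = (\<integral>x. f x \<partial>M)" using lc by simp
  obtain n where n: "(\<integral>x. \<bar>c n x - l x\<bar> \<partial>M) < e"
    using order_tendstoD(2)[OF l(2) e] by (auto simp: eventually_sequentially)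
  obtain u v where b: "bounded_rv u" "bounded_rv v" "c n = (\<lambda>x. f x - cobound u v x)"
    using c(1)[of n] unfolding C_def by (elim CollectE exE conjE)
  have [measurable]: "l \<in> borel_measurable M" "c n \<in> borel_measurable M" for n
      using l(1) ic by auto
  have "(\<integral>x. \<bar>f x - (\<integral>x. f x \<partial>M) - cobound u v x\<bar> \<partial>M) = (\<integral>x. \<bar>c n x - (\<integral>x. f x \<partial>M)\<bar> \<partial>M)"
  proof -
    have "f x - (\<integral>x. f x \<partial>M) - cobound u v x = c n x - (\<integral>x. f x \<partial>M)" for x by (simp add: b(3))
    then show ?thesis by (simp only:)
  qed
  also have "\<dots> = (\<integral>x. \<bar>c n x - l x\<bar> \<partial>M)"
  proof (rule integral_cong_AE)
    show "AE x in M. \<bar>c n x - (\<integral>x. f x \<partial>M)\<bar> = \<bar>c n x - l x\<bar>"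
      using fl by eventually_elim simp
  qed measurable
  finally have "(\<integral>x. \<bar>f x - (\<integral>x. f x \<partial>M) - cobound u v x\<bar> \<partial>M) < e" using n by simp
  then show ?thesis using b(1,2) by (intro exI[of _ u] exI[of _ v] conjI)
qed

text \<open>Clipping \<open>f\<close> to the interval from \<open>- k\<close> to \<open>k\<close>
  reduces to bounded functions. The thirds of \<open>e\<close> pay for the clipping, for the bounded
  case and for the change of the mean.\<close>

lemma L1_approx_cobound:
  assumes f: "integrable M f" and e: "e > 0"
  shows "\<exists>u v. bounded_rv u \<and> bounded_rv v \<and>
    (\<integral>x. \<bar>f x - (\<integral>x. f x \<partial>M) - cobound u v x\<bar> \<partial>M) < e"
proof -
  have [measurable]: "f \<in> borel_measurable M" using f by auto
  define b where "b k x = max (- real k) (min (real k) (f x))" for k x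
  have [measurable]: "b k \<in> borel_measurable M" for k unfolding b_def by measurable
  have bb: "bounded_rv (b k)" for k by (rule bounded_rvI[where B = "real k"]) (auto simp: b_def)
  have "(\<lambda>k. \<integral>x. \<bar>f x - b k x\<bar> \<partial>M) \<longlonglongrightarrow> (\<integral>x. 0 \<partial>M)"
  proof (rule integral_dominated_convergence[where w = "\<lambda>x. \<bar>f x\<bar>"])
    have "(\<lambda>k. \<bar>f x - b k x\<bar>) \<longlonglongrightarrow> 0" for x
    proof (rule tendsto_eventually)
      obtain k0 :: nat where "\<bar>f x\<bar> \<le> real k0" using real_arch_simple by blast
      then show "\<forall>\<^sub>F k in sequentially. \<bar>f x - b k x\<bar> = 0"
        unfolding eventually_sequentially b_def by (intro exI[of _ k0]) auto
    qed
    then show "AE x in M. (\<lambda>k. \<bar>f x - b k x\<bar>) \<longlonglongrightarrow> 0" by simp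
    show "AE x in M. norm \<bar>f x - b k x\<bar> \<le> \<bar>f x\<bar>" for k by (auto simp: b_def)
  qed (use f in auto)
  then have lim0: "(\<lambda>k. \<integral>x. \<bar>f x - b k x\<bar> \<partial>M) \<longlonglongrightarrow> 0" by simp
  have "0 < e / 3" using e by simp
  from order_tendstoD(2)[OF lim0 this] obtain k where k: "(\<integral>x. \<bar>f x - b k x\<bar> \<partial>M) < e / 3"
    by (auto simp: eventually_sequentially)
  have ib: "integrable M (b k)" by (rule bounded_rv_integrable[OF bb])
  obtain u v where uv: "bounded_rv u" "bounded_rv v"
    "(\<integral>x. \<bar>b k x - (\<integral>x. b k x \<partial>M) - cobound u v x\<bar> \<partial>M) < e / 3"
    using L1_approx_cobound_bounded[OF bb \<open>0 < e / 3\<close>, of k] by (elim exE conjE)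
  have ic: "integrable M (cobound u v)" by (rule bounded_rv_integrable[OF bounded_rv_cobound[OF uv(1,2)]])
  have d: "\<bar>(\<integral>x. f x \<partial>M) - (\<integral>x. b k x \<partial>M)\<bar> \<le> (\<integral>x. \<bar>f x - b k x\<bar> \<partial>M)"
    using integral_abs_bound[of M "\<lambda>x. f x - b k x"] f ib by simp
  have "(\<integral>x. \<bar>f x - (\<integral>x. f x \<partial>M) - cobound u v x\<bar> \<partial>M) \<le>
    (\<integral>x. \<bar>f x - b k x\<bar> + \<bar>b k x - (\<integral>x. b k x \<partial>M) - cobound u v x\<bar>
      + \<bar>(\<integral>x. f x \<partial>M) - (\<integral>x. b k x \<partial>M)\<bar> \<partial>M)"
    using f ib ic by (intro integral_mono) auto
  also have "\<dots> = (\<integral>x. \<bar>f x - b k x\<bar> \<partial>M) + (\<integral>x. \<bar>b k x - (\<integral>x. b k x \<partial>M) - cobound u v x\<bar> \<partial>M)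
      + \<bar>(\<integral>x. f x \<partial>M) - (\<integral>x. b k x \<partial>M)\<bar>"
    using f ib ic by (simp add: prob_space)
  also have "\<dots> < e" using d k uv(3) by linarith
  finally show ?thesis using uv(1,2) by (intro exI[of _ u] exI[of _ v] conjI)
qed

section \<open>Pointwise ergodic theorem\<close>

lemma avg_diff: "avg (\<lambda>x. f x - g x) n x = avg f n x - avg g n x"
  by (simp add: avg_def sum_subtractf diff_divide_distrib)

lemma avg_const: "n \<ge> 1 \<Longrightarrow> avg (\<lambda>x. c) n x = c"
  by (simp add: avg_def power2_eq_square)

lemma abs_avg_le: "\<bar>avg f n x\<bar> \<le> avg (\<lambda>x. \<bar>f x\<bar>) n x"
  unfolding avg_def by (simp add: divide_right_mono)

text \<open>The double sum telescopes in one direction for \<open>u\<close> and in the other for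
  \<open>v\<close>. What remains are \<open>n\<close> boundary differences of size at most
  \<open>2 * B\<close> for each, against the normalisation \<open>n\<^sup>2\<close>.\<close>

lemma avg_cobound_le:
  assumes u: "\<And>x. \<bar>u x\<bar> \<le> B" and v: "\<And>x. \<bar>v x\<bar> \<le> B" and x: "x \<in> space M" and n: "n \<ge> 1"
  shows "\<bar>avg (cobound u v) n x\<bar> \<le> 4 * B / real n"
proof -
  have act: "act (i, j) (T x) = act (Suc i, j) x" "act (i, j) (S x) = act (i, Suc j) x"
     "T (act (i, j) x) = act (Suc i, j) x" "S (act (i, j) x) = act (i, Suc j) x" for i j
    using T_act[OF x, of "(i, j)"] S_act[OF x, of "(i, j)"] act_T[OF x, of "(i, j)"] act_S[OF x, of "(i, j)"]
    by auto
  have "(\<Sum>g\<in>{..<n} \<times> {..<n}. cobound u v (act g x))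
    = (\<Sum>i<n. \<Sum>j<n. u (act (i, j) x) - u (act (Suc i, j) x))
      + (\<Sum>i<n. \<Sum>j<n. v (act (i, j) x) - v (act (i, Suc j) x))"
    by (simp add: sum.cartesian_product' cobound_def act sum.distrib)
  also have "(\<Sum>i<n. \<Sum>j<n. u (act (i, j) x) - u (act (Suc i, j) x))
      = (\<Sum>j<n. u (act (0, j) x) - u (act (n, j) x))"
    by (subst sum.swap) (intro sum.cong refl sum_lessThan_telescope'[of "\<lambda>i. u (act (i, _) x)", simplified])
  also have "(\<Sum>i<n. \<Sum>j<n. v (act (i, j) x) - v (act (i, Suc j) x))
      = (\<Sum>i<n. v (act (i, 0) x) - v (act (i, n) x))"
    by (intro sum.cong refl sum_lessThan_telescope'[of "\<lambda>j. v (act (_, j) x)", simplified])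
  finally have eq: "(\<Sum>g\<in>{..<n} \<times> {..<n}. cobound u v (act g x))
    = (\<Sum>j<n. u (act (0, j) x) - u (act (n, j) x)) + (\<Sum>i<n. v (act (i, 0) x) - v (act (i, n) x))" .
  have a: "\<bar>w a - w b\<bar> \<le> 2 * B" if "\<And>x. \<bar>w x\<bar> \<le> B" for a b and w :: "'a \<Rightarrow> real"
    using that[of a] that[of b] by linarith
  have "\<bar>\<Sum>j<n. u (act (0, j) x) - u (act (n, j) x)\<bar> \<le> (\<Sum>j<n. 2 * B)"
    by (rule sum_abs[THEN order_trans]) (intro sum_mono a u)
  moreover have "\<bar>\<Sum>i<n. v (act (i, 0) x) - v (act (i, n) x)\<bar> \<le> (\<Sum>j<n. 2 * B)"
    by (rule sum_abs[THEN order_trans]) (intro sum_mono a v)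
  ultimately have "\<bar>\<Sum>g\<in>{..<n} \<times> {..<n}. cobound u v (act g x)\<bar> \<le> 4 * B * real n"
    unfolding eq by (simp add: algebra_simps)
  then have "\<bar>avg (cobound u v) n x\<bar> \<le> 4 * B * real n / (real n)\<^sup>2"
    by (simp add: avg_def divide_right_mono)
  also have "\<dots> = 4 * B / real n" using n by (simp add: power2_eq_square)
  finally show ?thesis .
qed

lemma avg_cobound_tendsto:
  assumes u: "bounded_rv u" and v: "bounded_rv v" and x: "x \<in> space M"
  shows "(\<lambda>n. avg (cobound u v) n x) \<longlonglongrightarrow> 0"
proof -
  obtain B where B: "\<And>x. \<bar>u x\<bar> \<le> B" using u unfolding bounded_rv_def by auto
  obtain C where C: "\<And>x. \<bar>v x\<bar> \<le> C" using v unfolding bounded_rv_def by auto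
  have B': "\<bar>u x\<bar> \<le> max B C" and C': "\<bar>v x\<bar> \<le> max B C" for x
    using B[of x] C[of x] by auto
  have "(\<lambda>n. 4 * max B C / real n) \<longlonglongrightarrow> 0"
    by (rule tendsto_divide_0[OF tendsto_const]) (rule filterlim_at_top_imp_at_infinity[OF filterlim_real_sequentially])
  moreover have "\<forall>\<^sub>F n in sequentially. norm (avg (cobound u v) n x) \<le> 4 * max B C / real n"
    using eventually_ge_at_top[of 1]
    by eventually_elim (use avg_cobound_le[OF B' C' x] in simp)
  ultimately show ?thesis by (rule Lim_null_comparison[rotated])
qed

text \<open>Banach's principle: the averages of a constant plus a bounded coboundary converge
  everywhere, and the maximal inequality shows that a remainder of small \<open>L\<^sup>1\<close>
  norm can spoil convergence on a small set only. The factor 32 is 16 from that inequality, doubled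
  because half of \<open>d\<close> is reserved for the coboundary.\<close>

theorem ergodic_average:
  assumes f: "integrable M f"
  shows "AE x in M. (\<lambda>n. avg f n x) \<longlonglongrightarrow> (\<integral>x. f x \<partial>M)"
proof -
  have [measurable]: "f \<in> borel_measurable M" using f by auto
  define c where "c = (\<integral>x. f x \<partial>M)"
  define Bad where "Bad d = {x \<in> space M. \<not> (\<exists>N. \<forall>n\<ge>N. \<bar>avg f n x - c\<bar> \<le> d)}" for d
  have [measurable]: "Bad d \<in> sets M" for d unfolding Bad_def by measurable
  have bad: "measure M (Bad d) \<le> 32 * e / d" if d: "d > 0" and e: "e > 0" for d e
  proof -
    obtain u v where uv: "bounded_rv u" "bounded_rv v"
      "(\<integral>x. \<bar>f x - c - cobound u v x\<bar> \<partial>M) < e"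
      using L1_approx_cobound[OF f e] unfolding c_def by (elim exE conjE)
    define r where "r x = f x - c - cobound u v x" for x
    have ir: "integrable M r" unfolding r_def
      using f bounded_rv_integrable[OF bounded_rv_cobound[OF uv(1,2)]] by auto
    have ir': "integrable M (\<lambda>x. \<bar>r x\<bar>)" using ir by simp
    have [measurable]: "r \<in> borel_measurable M" using ir by auto
    define E where "E = {x \<in> space M. \<exists>n\<ge>1. avg (\<lambda>x. \<bar>r x\<bar>) n x > d / 2}"
    have [measurable]: "E \<in> sets M" unfolding E_def by measurable
    have "Bad d \<subseteq> E"
    proof
      fix x assume x: "x \<in> Bad d"
      then have xs: "x \<in> space M" by (simp add: Bad_def)
      have "0 < d / 2" using d by simp
      from tendstoD[OF avg_cobound_tendsto[OF uv(1,2) xs] this]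
      obtain N where N: "\<And>n. n \<ge> N \<Longrightarrow> \<bar>avg (cobound u v) n x\<bar> < d / 2"
        by (auto simp: eventually_sequentially)
      from x have "\<not> (\<forall>n\<ge>max N 1. \<bar>avg f n x - c\<bar> \<le> d)" unfolding Bad_def by blast
      then obtain n where n: "n \<ge> max N 1" "\<bar>avg f n x - c\<bar> > d" by (auto simp: not_le)
      then have n1: "n \<ge> 1" by simp
      have "avg r n x = avg f n x - c - avg (cobound u v) n x"
        unfolding r_def avg_diff avg_const[OF n1] ..
      moreover have "\<bar>avg (cobound u v) n x\<bar> < d / 2" using N[of n] n(1) by simp
      ultimately have "\<bar>avg r n x\<bar> > d / 2" using n(2) by linarith
      then have "avg (\<lambda>x. \<bar>r x\<bar>) n x > d / 2" using abs_avg_le[of r n x] by linarith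
      then show "x \<in> E" using n1 xs by (auto simp: E_def)
    qed
    then have "d / 2 * measure M (Bad d) \<le> d / 2 * measure M E"
      using d by (intro mult_left_mono finite_measure_mono) auto
    also have "\<dots> \<le> 16 * (\<integral>x. \<bar>r x\<bar> \<partial>M)"
      unfolding E_def by (rule maximal_ineq[OF _ _ ir']) (use d in auto)
    also have "\<dots> \<le> 16 * e" using uv(3) by (simp add: r_def)
    finally show ?thesis using d by (simp add: field_simps)
  qed
  have "measure M (Bad d) = 0" if d: "d > 0" for d
  proof -
    have "measure M (Bad d) \<le> 0 + e" if "e > 0" for e
      using bad[OF d, of "e * d / 32"] d that by simp
    then have "measure M (Bad d) \<le> 0" by (rule field_le_epsilon)
    then show ?thesis by (simp add: measure_le_0_iff)
  qed
  then have "AE x in M. x \<notin> Bad (1 / real (Suc k))" for k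
    by (subst prob_eq_0[symmetric]) auto
  then have "AE x in M. \<forall>k. x \<notin> Bad (1 / real (Suc k))"
    by (simp add: AE_all_countable)
  then show ?thesis using AE_space
  proof eventually_elim
    case (elim x)
    note h = elim(1) and x = elim(2)
    have "(\<lambda>n. avg f n x) \<longlonglongrightarrow> c"
    proof (rule LIMSEQ_I)
      fix r :: real assume "r > 0"
      then obtain k where k: "1 / real (Suc k) < r" using nat_approx_posE by blast
      obtain N where "\<forall>n\<ge>N. \<bar>avg f n x - c\<bar> \<le> 1 / real (Suc k)"
        using h x unfolding Bad_def by blast
      then show "\<exists>N. \<forall>n\<ge>N. norm (avg f n x - c) < r"
        using k by (intro exI[of _ N]) force
    qed
    then show ?case by (simp add: c_def)
  qed
qed

end

section \<open>Finite-dimensional densities and the chain rule\<close>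

abbreviation leb :: "'i set \<Rightarrow> ('i \<Rightarrow> real) measure" where
  "leb K \<equiv> \<Pi>\<^sub>M i\<in>K. lborel"

abbreviation bor :: "'i set \<Rightarrow> ('i \<Rightarrow> real) measure" where
  "bor K \<equiv> \<Pi>\<^sub>M i\<in>K. borel"

lemma sets_leb [measurable_cong, simp]: "sets (leb K) = sets (bor K)"
  by (rule sets_PiM_cong) auto

lemma space_leb [simp]: "space (leb K) = space (bor K)"
  by (simp add: space_PiM)

interpretation lborel_prod: product_sigma_finite "\<lambda>_. lborel :: real measure"
  by standard

text \<open>By Fubini, the cylinder over a null set has measure 0 times the measure of the remaining
  coordinates. That factor may be infinite, but the product is still 0.\<close>

lemma AE_leb_restrict:
  assumes JK: "J \<subseteq> K" "finite K" and P: "AE z in leb J. P z"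
  shows "AE x in leb K. P (restrict x J)"
proof -
  obtain N where N: "{z \<in> space (leb J). \<not> P z} \<subseteq> N" "N \<in> sets (leb J)" "emeasure (leb J) N = 0"
    using P by (auto elim: AE_E)
  have r [measurable]: "(\<lambda>x. restrict x J) \<in> leb K \<rightarrow>\<^sub>M leb J"
    by (rule measurable_restrict_subset[OF JK(1)])
  have [measurable]: "N \<in> sets (leb J)" by (rule N(2))
  have K: "K = J \<union> (K - J)" and fin: "finite J" "finite (K - J)" and dis: "J \<inter> (K - J) = {}"
    using JK finite_subset by auto
  have "(\<integral>\<^sup>+x. indicator N (restrict x J) \<partial>leb K)
      = (\<integral>\<^sup>+x. \<integral>\<^sup>+y. indicator N (restrict (merge J (K - J) (x, y)) J) \<partial>leb (K - J) \<partial>leb J)"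
    by (subst (1) K, subst lborel_prod.product_nn_integral_fold[OF dis fin])
       (use K in \<open>auto simp: Un_absorb1 JK\<close>)
  also have "\<dots> = (\<integral>\<^sup>+x. \<integral>\<^sup>+y. indicator N x \<partial>leb (K - J) \<partial>leb J)"
    by (intro nn_integral_cong) (simp add: space_PiM PiE_restrict)
  also have "\<dots> = (\<integral>\<^sup>+x. indicator N x * emeasure (leb (K - J)) (space (leb (K - J))) \<partial>leb J)"
    by simp
  also have "\<dots> = 0"
    using N(3) nn_integral_indicator[OF N(2)] by (subst nn_integral_multc) auto
  finally have "(\<integral>\<^sup>+x. indicator N (restrict x J) \<partial>leb K) = 0" .
  then have "AE x in leb K. indicator N (restrict x J) = (0 :: ennreal)"
    by (subst (asm) nn_integral_0_iff_AE) auto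
  then show ?thesis using AE_space
  proof eventually_elim
    case (elim x)
    note x = elim
    have "restrict x J \<in> space (leb J)" using measurable_space[OF r x(2)] .
    then show ?case using x(1) N(1) by (auto simp: indicator_def split: if_splits)
  qed
qed

text \<open>The left side is 0 when \<open>a\<close> is 0 or \<open>top\<close>. This possible loss
  is the reason why later bounds read at most 1 rather than equal to 1.\<close>

lemma ennreal_times_divide_le: "a * (w / a) \<le> (w :: ennreal)"
proof (cases "a = 0 \<or> a = top")
  case True
  then show ?thesis by (auto simp: divide_ennreal_def)
next
  case False
  then have "a * (w / a) = w" by (simp add: ennreal_times_divide mult.commute[of a] mult_divide_eq_ennreal)
  then show ?thesis by simp
qed

text \<open>The removed element precedes none of the remaining ones, so no remaining past contains
  it: its coordinate can be integrated out first, or its term split off a telescoping sum.\<close>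

lemma finite_maximal_induct [consumes 3, case_names empty insert]:
  assumes ord: "asymp before" "transp before" and "finite C" and empty: "P {}"
    and insert: "\<And>m C. finite C \<Longrightarrow> m \<notin> C \<Longrightarrow> (\<And>x. x \<in> C \<Longrightarrow> \<not> before m x) \<Longrightarrow> P C \<Longrightarrow> P (insert m C)"
  shows "P C"
  using assms(3)
proof (induction "card C" arbitrary: C)
  case 0
  then show ?case using empty by simp
next
  case (Suc k)
  then have "C \<noteq> {}" by auto
  moreover have "asymp_on C before" "transp_on C before"
    using ord by (auto intro: asymp_on_subset transp_on_subset)
  ultimately obtain m where m: "m \<in> C" "\<And>x. x \<in> C \<Longrightarrow> x \<noteq> m \<Longrightarrow> \<not> before m x"
    using Finite_Set.bex_max_element[OF Suc(3)] by metis
  have "P (insert m (C - {m}))"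
    using m Suc by (intro insert) auto
  then show ?case using m(1) by (simp add: insert_absorb)
qed

locale density_field = prob_space M for M :: "'a measure" +
  fixes X :: "'i \<Rightarrow> 'a \<Rightarrow> real"
  assumes X_measurable [measurable]: "X i \<in> borel_measurable M"
    and abs_cont: "finite K \<Longrightarrow> absolutely_continuous (leb K) (distr M (bor K) (\<lambda>x. \<lambda>i\<in>K. X i x))"
begin

definition restr :: "'i set \<Rightarrow> 'a \<Rightarrow> 'i \<Rightarrow> real" where
  "restr K x = (\<lambda>i\<in>K. X i x)"

definition law :: "'i set \<Rightarrow> ('i \<Rightarrow> real) measure" where
  "law K = distr M (bor K) (restr K)"

definition dens :: "'i set \<Rightarrow> ('i \<Rightarrow> real) \<Rightarrow> ennreal" where
  "dens K = RN_deriv (leb K) (law K)"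

lemma restr_measurable [measurable]: "restr K \<in> M \<rightarrow>\<^sub>M (bor K)"
  unfolding restr_def by measurable

lemma restrict_restr: "J \<subseteq> K \<Longrightarrow> restrict (restr K x) J = restr J x"
  by (auto simp: restr_def fun_eq_iff restrict_def)

lemma sets_law [simp, measurable_cong]: "sets (law K) = sets (bor K)"
  by (simp add: law_def)

lemma dens_measurable [measurable]: "dens K \<in> borel_measurable (bor K)"
proof -
  have "dens K \<in> borel_measurable (leb K)" unfolding dens_def by measurable
  then show ?thesis by (simp cong: measurable_cong_sets)
qed

lemma prob_law: "prob_space (law K)"
  unfolding law_def by (rule prob_space_distr) measurable

lemma law_ac: "finite K \<Longrightarrow> absolutely_continuous (leb K) (law K)"
  using abs_cont[of K] by (simp add: law_def restr_def[abs_def])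

lemma sigma_finite_leb: "finite K \<Longrightarrow> sigma_finite_measure (leb K)"
  by (rule lborel_prod.sigma_finite)

lemma density_dens: "finite K \<Longrightarrow> density (leb K) (dens K) = law K"
  unfolding dens_def
  by (rule sigma_finite_measure.density_RN_deriv[OF sigma_finite_leb law_ac]) auto

lemma nn_integral_restr:
  assumes "finite K" and [measurable]: "w \<in> borel_measurable (bor K)"
  shows "(\<integral>\<^sup>+y. w (restr K y) \<partial>M) = (\<integral>\<^sup>+x. dens K x * w x \<partial>leb K)"
proof -
  have "(\<integral>\<^sup>+y. w (restr K y) \<partial>M) = (\<integral>\<^sup>+x. w x \<partial>law K)"
    unfolding law_def by (rule nn_integral_distr[symmetric]) auto
  also have "\<dots> = (\<integral>\<^sup>+x. w x \<partial>density (leb K) (dens K))"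
    by (simp add: density_dens assms(1))
  also have "\<dots> = (\<integral>\<^sup>+x. dens K x * w x \<partial>leb K)"
    by (rule nn_integral_density) auto
  finally show ?thesis .
qed

text \<open>The basic change of measure: dividing by the true density turns an expectation along the
  field into a Lebesgue integral. With a product of kernels for \<open>w\<close>, the integrand on
  the left is a likelihood ratio.\<close>

lemma nn_integral_weight_le:
  assumes "finite C" and [measurable]: "w \<in> borel_measurable (bor C)"
  shows "(\<integral>\<^sup>+y. w (restr C y) / dens C (restr C y) \<partial>M) \<le> (\<integral>\<^sup>+x. w x \<partial>leb C)"
proof -
  have "(\<integral>\<^sup>+y. w (restr C y) / dens C (restr C y) \<partial>M) = (\<integral>\<^sup>+x. dens C x * (w x / dens C x) \<partial>leb C)"
    using nn_integral_restr[of C "\<lambda>x. w x / dens C x"] assms by simp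
  also have "\<dots> \<le> (\<integral>\<^sup>+x. w x \<partial>leb C)"
    by (intro nn_integral_mono ennreal_times_divide_le)
  finally show ?thesis .
qed

lemma AE_law_imp_AE:
  assumes "finite K" "AE x in leb K. P x"
  shows "AE y in M. P (restr K y)"
proof -
  have "AE x in law K. P x"
    by (rule absolutely_continuous_AE[OF _ law_ac[OF assms(1)] assms(2)]) simp
  then show ?thesis unfolding law_def by (rule AE_distrD[rotated]) measurable
qed

lemma AE_dens_pos_finite:
  assumes "finite K"
  shows "AE y in M. 0 < dens K (restr K y) \<and> dens K (restr K y) < \<infinity>"
proof -
  interpret L: prob_space "law K" by (rule prob_law)
  have "AE x in leb K. dens K x \<noteq> \<infinity>"
    unfolding dens_def
    by (rule sigma_finite_measure.RN_deriv_finite[OF sigma_finite_leb[OF assms] _ law_ac[OF assms]])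
       (auto intro: L.sigma_finite_measure_axioms)
  then have fin: "AE y in M. dens K (restr K y) \<noteq> \<infinity>" by (rule AE_law_imp_AE[OF assms])
  have "AE x in density (leb K) (dens K). 0 < dens K x"
    by (subst AE_density) auto
  then have "AE x in law K. 0 < dens K x" unfolding density_dens[OF assms] .
  then have "AE y in M. 0 < dens K (restr K y)"
    unfolding law_def by (rule AE_distrD[rotated]) measurable
  with fin show ?thesis by eventually_elim (simp add: less_top)
qed

text \<open>Integrating out one coordinate produces a density of the law on \<open>J\<close>, and
  Radon-Nikodym derivatives are unique almost everywhere. As \<open>dens\<close> picks a derivative
  for each set separately, no more than an almost sure identity can be expected.\<close>

lemma dens_marginal:
  assumes J: "finite J" "m \<notin> J"
  shows "AE z in leb J. (\<integral>\<^sup>+y. dens (insert m J) (z(m := y)) \<partial>lborel) = dens J z"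
proof -
  have up [measurable]: "(\<lambda>(f, y). f(m := y)) \<in> (bor J) \<Otimes>\<^sub>M borel \<rightarrow>\<^sub>M (bor (insert m J))"
    by (rule measurable_add_dim)
  define f where "f z = (\<integral>\<^sup>+y. dens (insert m J) (z(m := y)) \<partial>lborel)" for z
  have f [measurable]: "f \<in> borel_measurable (bor J)"
    unfolding f_def by measurable
  have "density (leb J) f = law J"
  proof (rule measure_eqI)
    fix A assume "A \<in> sets (density (leb J) f)"
    then have A [measurable]: "A \<in> sets (bor J)" by simp
    have [measurable]: "(\<lambda>x. restrict x J) \<in> (bor (insert m J)) \<rightarrow>\<^sub>M (bor J)"
      by (rule measurable_restrict_subset) auto
    have "emeasure (density (leb J) f) A = (\<integral>\<^sup>+z. f z * indicator A z \<partial>leb J)"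
      by (rule emeasure_density) auto
    also have "\<dots> = (\<integral>\<^sup>+z. \<integral>\<^sup>+y. dens (insert m J) (z(m := y)) * indicator A (restrict (z(m := y)) J) \<partial>lborel \<partial>leb J)"
    proof (rule nn_integral_cong)
      fix z assume z: "z \<in> space (leb J)"
      then have "restrict (z(m := y)) J = z" for y
        using J(2) by (auto simp: space_PiM PiE_iff extensional_def fun_eq_iff restrict_def)
      moreover have [measurable]: "(\<lambda>y. z(m := y)) \<in> borel \<rightarrow>\<^sub>M (bor (insert m J))"
        using measurable_component_update[of z J "\<lambda>_. borel" m] z J(2) by simp
      ultimately show "f z * indicator A z = (\<integral>\<^sup>+y. dens (insert m J) (z(m := y)) * indicator A (restrict (z(m := y)) J) \<partial>lborel)"
        unfolding f_def by (simp add: nn_integral_multc)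
    qed
    also have "\<dots> = (\<integral>\<^sup>+x. dens (insert m J) x * indicator A (restrict x J) \<partial>leb (insert m J))"
      by (rule lborel_prod.product_nn_integral_insert[symmetric]) (use J in auto)
    also have "\<dots> = (\<integral>\<^sup>+w. indicator A (restrict (restr (insert m J) w) J) \<partial>M)"
      by (rule nn_integral_restr[symmetric]) (use J in auto)
    also have "\<dots> = (\<integral>\<^sup>+w. indicator A (restr J w) \<partial>M)"
      by (simp add: restrict_restr subset_insertI)
    also have "\<dots> = emeasure (law J) A"
      using nn_integral_distr[of "restr J" M "bor J" "indicator A"] by (simp add: law_def)
    finally show "emeasure (density (leb J) f) A = emeasure (law J) A" .
  qed simp
  then have "AE z in leb J. f z = RN_deriv (leb J) (law J) z"
    by (intro sigma_finite_measure.RN_deriv_unique[OF sigma_finite_leb[OF J(1)]]) auto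
  then show ?thesis by (simp add: f_def dens_def)
qed

text \<open>Coordinates outside \<open>G\<close> get the standard normal density, so that every kernel integrates to at most \<open>1\<close>
  in its own coordinate.\<close>

definition cond_kernel :: "'i set \<Rightarrow> ('i \<Rightarrow> 'i set) \<Rightarrow> 'i \<Rightarrow> ('i \<Rightarrow> real) \<Rightarrow> ennreal" where
  "cond_kernel G J g x = (if g \<in> G
     then dens (insert g (J g)) (restrict x (insert g (J g))) / dens (J g) (restrict x (J g))
     else ennreal (std_normal_density (x g)))"

lemma cond_kernel_measurable:
  assumes "g \<in> C" "g \<in> G \<Longrightarrow> J g \<subseteq> C"
  shows "cond_kernel G J g \<in> borel_measurable (bor C)"
proof (cases "g \<in> G")
  case True
  have [measurable]: "(\<lambda>x. restrict x (J g)) \<in> (bor C) \<rightarrow>\<^sub>M (bor (J g))"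
    "(\<lambda>x. restrict x (insert g (J g))) \<in> (bor C) \<rightarrow>\<^sub>M (bor (insert g (J g)))"
    using assms True by (auto intro!: measurable_restrict_subset)
  show ?thesis using True by (simp add: cond_kernel_def[abs_def])
next
  case False
  have [measurable]: "(\<lambda>x. x g) \<in> (bor C) \<rightarrow>\<^sub>M (borel :: real measure)"
    using assms by (auto intro: measurable_component_singleton)
  show ?thesis using False by (simp add: cond_kernel_def[abs_def])
qed

lemma nn_integral_std_normal_density: "(\<integral>\<^sup>+y. ennreal (std_normal_density y) \<partial>lborel) = 1"
proof -
  interpret N: prob_space "density lborel std_normal_density" by (rule prob_space_normal_density) simp
  show ?thesis using N.emeasure_space_1 by (simp add: emeasure_density)
qed

text \<open>The denominator does not involve the coordinate \<open>m\<close>, and the numerator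
  integrates to it by \<open>dens_marginal\<close>. Where the denominator is 0 or infinite, the
  integrated quotient is 0, so the bound survives there.\<close>

lemma nn_integral_cond_kernel_le:
  assumes fin: "finite C'" "m \<notin> C'" and J: "m \<in> G \<Longrightarrow> J m \<subseteq> C'"
  shows "AE x in leb C'. (\<integral>\<^sup>+y. cond_kernel G J m (x(m := y)) \<partial>lborel) \<le> 1"
proof (cases "m \<in> G")
  case False
  then show ?thesis by (simp add: cond_kernel_def nn_integral_std_normal_density)
next
  case True
  have J': "finite (J m)" "m \<notin> J m" using J[OF True] fin finite_subset by auto
  have "AE x in leb C'. (\<integral>\<^sup>+y. dens (insert m (J m)) ((restrict x (J m))(m := y)) \<partial>lborel) = dens (J m) (restrict x (J m))"
    by (rule AE_leb_restrict[OF J[OF True] fin(1) dens_marginal[OF J']])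
  then show ?thesis using AE_space
  proof eventually_elim
    case (elim x)
    note eq = elim(1) and x = elim(2)
    have r: "restrict (x(m := y)) (insert m (J m)) = (restrict x (J m))(m := y)"
      "restrict (x(m := y)) (J m) = restrict x (J m)" for y
      using J'(2) by (auto simp: fun_eq_iff restrict_def)
    have "restrict x (J m) \<in> space (bor (J m))" by (simp add: space_PiM)
    then have [measurable]: "(\<lambda>y. (restrict x (J m))(m := y)) \<in> borel \<rightarrow>\<^sub>M (bor (insert m (J m)))"
      by (rule measurable_component_update[OF _ J'(2)])
    have "(\<integral>\<^sup>+y. cond_kernel G J m (x(m := y)) \<partial>lborel) =
        (\<integral>\<^sup>+y. dens (insert m (J m)) ((restrict x (J m))(m := y)) / dens (J m) (restrict x (J m)) \<partial>lborel)"
      using True by (simp add: cond_kernel_def r)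
    also have "\<dots> = dens (J m) (restrict x (J m)) / dens (J m) (restrict x (J m))"
      by (subst nn_integral_divide) (simp_all add: eq)
    also have "\<dots> \<le> 1"
      using ennreal_times_divide_le[of "dens (J m) (restrict x (J m))" 1]
      by (simp add: divide_ennreal_def)
    finally show ?case .
  qed
qed

text \<open>The last site of \<open>C\<close> is integrated out first: no other kernel sees its
  coordinate, since every \<open>J g\<close> lies in the past of \<open>g\<close>, and its own
  kernel contributes at most 1.\<close>

lemma nn_integral_prod_cond_kernel_le:
  assumes ord: "asymp before" "transp before"
    and "finite C" "\<And>g. g \<in> C \<Longrightarrow> g \<in> G \<Longrightarrow> J g \<subseteq> {h\<in>C. before h g}"
  shows "(\<integral>\<^sup>+x. (\<Prod>g\<in>C. cond_kernel G J g x) \<partial>leb C) \<le> 1"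
  using ord assms(3,4)
proof (induction C rule: finite_maximal_induct)
  case empty
  then show ?case by (auto simp: lborel_prod.nn_integral_empty simp del: nn_integral_const)
next
  case (insert m C')
  define C where "C = insert m C'"
  have C': "C = insert m C'" "m \<notin> C'" "finite C'" using insert(1,2) by (simp_all add: C_def)
  have m: "m \<in> C" "\<And>x. x \<in> C' \<Longrightarrow> \<not> before m x" using insert(3) by (auto simp: C_def)
  note prems = insert.prems[folded C_def]
  have irr: "\<not> before g g" for g using asympD[OF ord(1)] by blast
  have J: "J g \<subseteq> {h\<in>C'. before h g}" if "g \<in> C'" "g \<in> G" for g
    using prems[of g] that m(2)[of g] C'(1,2) by auto
  have Jm: "J m \<subseteq> C'" if "m \<in> G"
    using prems[OF m(1) that] irr[of m] C'(1) by auto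
  have [measurable]: "cond_kernel G J g \<in> borel_measurable (bor C)" if "g \<in> C" for g
    using that prems by (intro cond_kernel_measurable) auto
  have [measurable]: "cond_kernel G J g \<in> borel_measurable (bor C')" if "g \<in> C'" for g
    using that J by (intro cond_kernel_measurable) auto
  have upd: "cond_kernel G J g (x(m := y)) = cond_kernel G J g x" if "g \<in> C'" for g x y
  proof -
    have "g \<noteq> m" using that C'(2) by auto
    moreover have "m \<notin> J g" if "g \<in> G" using J[OF \<open>g \<in> C'\<close> that] C'(2) by auto
    ultimately show ?thesis by (auto simp: cond_kernel_def restrict_fupd)
  qed
  have "(\<integral>\<^sup>+x. (\<Prod>g\<in>C. cond_kernel G J g x) \<partial>leb C)
      = (\<integral>\<^sup>+x. \<integral>\<^sup>+y. (\<Prod>g\<in>C. cond_kernel G J g (x(m := y))) \<partial>lborel \<partial>leb C')"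
    unfolding C'(1)
    by (rule lborel_prod.product_nn_integral_insert) (use C' in \<open>auto simp flip: C'(1)\<close>)
  also have "\<dots> = (\<integral>\<^sup>+x. (\<Prod>g\<in>C'. cond_kernel G J g x) * (\<integral>\<^sup>+y. cond_kernel G J m (x(m := y)) \<partial>lborel) \<partial>leb C')"
  proof (rule nn_integral_cong)
    fix x assume x: "x \<in> space (leb C')"
    have [measurable]: "(\<lambda>y. x(m := y)) \<in> borel \<rightarrow>\<^sub>M (bor C)"
      using measurable_component_update[of x C' "\<lambda>_. borel" m] x C' by simp
    have "(\<Prod>g\<in>C. cond_kernel G J g (x(m := y))) = (\<Prod>g\<in>C'. cond_kernel G J g x) * cond_kernel G J m (x(m := y))" for y
      unfolding C'(1) using C'(2,3) upd by (simp add: mult.commute)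
    then show "(\<integral>\<^sup>+y. (\<Prod>g\<in>C. cond_kernel G J g (x(m := y))) \<partial>lborel)
      = (\<Prod>g\<in>C'. cond_kernel G J g x) * (\<integral>\<^sup>+y. cond_kernel G J m (x(m := y)) \<partial>lborel)"
      using m(1) by (simp add: nn_integral_cmult)
  qed
  also have "\<dots> \<le> (\<integral>\<^sup>+x. (\<Prod>g\<in>C'. cond_kernel G J g x) * 1 \<partial>leb C')"
  proof (rule nn_integral_mono_AE)
    have "AE x in leb C'. (\<integral>\<^sup>+y. cond_kernel G J m (x(m := y)) \<partial>lborel) \<le> 1"
      using C'(3,2) Jm by (rule nn_integral_cond_kernel_le)
    then show "AE x in leb C'. (\<Prod>g\<in>C'. cond_kernel G J g x) * (\<integral>\<^sup>+y. cond_kernel G J m (x(m := y)) \<partial>lborel)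
        \<le> (\<Prod>g\<in>C'. cond_kernel G J g x) * 1"
      by eventually_elim (rule mult_left_mono, auto)
  qed
  also have "\<dots> \<le> 1"
    using insert.IH J by simp
  finally show ?case by (simp only: C_def)
qed

text \<open>Relative log-likelihood, the reference being standard normal; \<open>cll\<close> below is its conditional version.\<close>

definition rll :: "'i set \<Rightarrow> 'a \<Rightarrow> real" where
  "rll K x = ln (enn2real (dens K (restr K x))) - (\<Sum>i\<in>K. ln (std_normal_density (X i x)))"

lemma rll_measurable [measurable]: "rll K \<in> borel_measurable M"
  unfolding rll_def by measurable

text \<open>The exponent is the log likelihood ratio between a competing density on \<open>C\<close>
  and the true one. The competitor uses the kernels on \<open>G\<close> and independent normal
  coordinates on \<open>C - G\<close>; the normal terms inside \<open>rll\<close> cancel on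
  \<open>G\<close> and supply exactly the factors on \<open>C - G\<close>. The comparisons of
  likelihoods on pasts, boxes and squares differ only in the choice of \<open>C\<close>,
  \<open>G\<close>, \<open>J\<close> and the order.\<close>

lemma chain_bound:
  assumes ord: "asymp before" "transp before"
    and C: "finite C" "G \<subseteq> C" "\<And>g. g \<in> G \<Longrightarrow> J g \<subseteq> {h\<in>C. before h g}"
  shows "(\<integral>\<^sup>+y. ennreal (exp ((\<Sum>g\<in>G. rll (insert g (J g)) y - rll (J g) y) - rll C y)) \<partial>M) \<le> 1"
proof -
  have irr: "\<not> before g g" for g using asympD[OF ord(1)] by blast
  have JC: "J g \<subseteq> C" "finite (J g)" "g \<notin> J g" "g \<in> C" if "g \<in> G" for g
    using C(3)[OF that] irr C(1,2) that finite_subset[of "J g" C] by auto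
  have finG: "finite G" by (rule finite_subset[OF C(2,1)])
  define P where "P K y \<longleftrightarrow> 0 < dens K (restr K y) \<and> dens K (restr K y) < \<infinity>" for K y
  have P: "AE y in M. P K y" if "finite K" for K
    unfolding P_def by (rule AE_dens_pos_finite[OF that])
  have "AE y in M. \<forall>g\<in>G. P (insert g (J g)) y \<and> P (J g) y"
    using finG JC(2) by (intro AE_finite_allI AE_conjI P) auto
  with P[OF C(1)] have eq: "AE y in M. ennreal (exp ((\<Sum>g\<in>G. rll (insert g (J g)) y - rll (J g) y) - rll C y))
     = (\<Prod>g\<in>C. cond_kernel G J g (restr C y)) / dens C (restr C y)"
  proof eventually_elim
    case (elim y)
    note PC = elim(1) and PG = elim(2)
    define a where "a K = enn2real (dens K (restr K y))" for K
    have a: "dens K (restr K y) = ennreal (a K)" "a K > 0" if "P K y" for K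
      using that by (auto simp: P_def a_def enn2real_positive_iff less_top)
    define p where "p g = std_normal_density (X g y)" for g
    have p: "p g > 0" for g unfolding p_def by (rule normal_density_pos) simp
    have k: "cond_kernel G J g (restr C y) = ennreal (if g \<in> G then a (insert g (J g)) / a (J g) else p g)"
      if "g \<in> C" for g
    proof (cases "g \<in> G")
      case True
      then show ?thesis
        using JC[OF True] PG a[of "insert g (J g)"] a[of "J g"]
        by (simp add: cond_kernel_def restrict_restr divide_ennreal)
    next
      case False
      then show ?thesis using that by (simp add: cond_kernel_def p_def restr_def)
    qed
    have pos: "0 < (if g \<in> G then a (insert g (J g)) / a (J g) else p g)" for g
      using PG a(2) p by auto
    have "(\<Prod>g\<in>C. cond_kernel G J g (restr C y)) / dens C (restr C y)
      = ennreal ((\<Prod>g\<in>C. if g \<in> G then a (insert g (J g)) / a (J g) else p g) / a C)"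
      using k pos a[OF PC] by (simp add: prod_ennreal less_imp_le divide_ennreal prod_nonneg)
    also have "(\<Prod>g\<in>C. if g \<in> G then a (insert g (J g)) / a (J g) else p g) / a C
      = exp ((\<Sum>g\<in>C. ln (if g \<in> G then a (insert g (J g)) / a (J g) else p g)) - ln (a C))"
      using pos a(2)[OF PC] C(1) by (simp add: exp_diff exp_sum)
    also have "(\<Sum>g\<in>C. ln (if g \<in> G then a (insert g (J g)) / a (J g) else p g)) - ln (a C)
      = (\<Sum>g\<in>G. rll (insert g (J g)) y - rll (J g) y) - rll C y"
    proof -
      have "rll (insert g (J g)) y - rll (J g) y = ln (a (insert g (J g)) / a (J g)) - ln (p g)" if "g \<in> G" for g
        using JC[OF that] PG that a(2)[of "insert g (J g)"] a(2)[of "J g"]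
        by (simp add: rll_def a_def[symmetric] p_def[symmetric] ln_div)
      then have "(\<Sum>g\<in>G. rll (insert g (J g)) y - rll (J g) y)
         = (\<Sum>g\<in>G. ln (if g \<in> G then a (insert g (J g)) / a (J g) else p g)) - (\<Sum>g\<in>G. ln (p g))"
        by (simp add: sum_subtractf)
      moreover have "rll C y = ln (a C) - (\<Sum>g\<in>G. ln (p g)) - (\<Sum>g\<in>C - G. ln (p g))"
        using C(1,2) by (simp add: rll_def a_def p_def sum.subset_diff)
      moreover have "(\<Sum>g\<in>C. ln (if g \<in> G then a (insert g (J g)) / a (J g) else p g))
        = (\<Sum>g\<in>G. ln (if g \<in> G then a (insert g (J g)) / a (J g) else p g)) + (\<Sum>g\<in>C - G. ln (p g))"
        using C(1,2) by (subst sum.subset_diff[of G C]) (auto intro!: sum.cong)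
      ultimately show ?thesis by linarith
    qed
    finally show ?case ..
  qed
  have [measurable]: "cond_kernel G J g \<in> borel_measurable (bor C)" if "g \<in> C" for g
    using that JC by (intro cond_kernel_measurable) auto
  have "(\<integral>\<^sup>+y. ennreal (exp ((\<Sum>g\<in>G. rll (insert g (J g)) y - rll (J g) y) - rll C y)) \<partial>M)
     = (\<integral>\<^sup>+y. (\<Prod>g\<in>C. cond_kernel G J g (restr C y)) / dens C (restr C y) \<partial>M)"
    by (rule nn_integral_cong_AE[OF eq])
  also have "\<dots> \<le> (\<integral>\<^sup>+x. (\<Prod>g\<in>C. cond_kernel G J g x) \<partial>leb C)"
    by (rule nn_integral_weight_le) (use C in auto)
  also have "\<dots> \<le> 1"
    by (rule nn_integral_prod_cond_kernel_le[OF ord C(1)]) (use C in auto)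
  finally show ?thesis .
qed

lemma rll_empty: "rll {} y = 0"
proof -
  have "1 = emeasure (law {}) (space (law {}))"
    using prob_space.emeasure_space_1[OF prob_law] by simp
  also have "\<dots> = (\<integral>\<^sup>+x. dens {} x \<partial>leb {})"
    unfolding density_dens[symmetric, OF finite.emptyI]
    by (subst emeasure_density) (auto intro!: nn_integral_cong)
  also have "\<dots> = dens {} (\<lambda>_. undefined)"
    by (rule lborel_prod.nn_integral_empty) simp
  finally show ?thesis by (simp add: rll_def restr_def restrict_def)
qed

end

section \<open>Chain rule and conditional gains\<close>

text \<open>The last site contributes the step from \<open>C'\<close> to \<open>C\<close>, and the
  pasts of the other sites do not change when it is removed. For \<open>rll\<close> this is the
  chain rule.\<close>

lemma telescope_over_order:
  fixes \<Phi> :: "'i set \<Rightarrow> real"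
  assumes ord: "asymp before" "transp before" and C: "finite C" "totalp_on C before"
  shows "(\<Sum>g\<in>C. \<Phi> (insert g {h\<in>C. before h g}) - \<Phi> {h\<in>C. before h g}) = \<Phi> C - \<Phi> {}"
  using ord C
proof (induction C rule: finite_maximal_induct)
  case empty
  then show ?case by simp
next
  case (insert m C')
  define C where "C = insert m C'"
  have C': "C = insert m C'" "m \<notin> C'" "finite C'" using insert(1,2) by (simp_all add: C_def)
  have m: "m \<in> C" "\<And>x. x \<in> C' \<Longrightarrow> \<not> before m x" using insert(3) by (auto simp: C_def)
  have tot: "totalp_on C before" using insert.prems by (simp add: C_def)
  have irr: "\<not> before g g" for g using asympD[OF ord(1)] by blast
  have pm: "{h\<in>C. before h m} = C'"
    using m tot irr[of m] C' unfolding totalp_on_def by auto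
  have pg: "{h\<in>C. before h g} = {h\<in>C'. before h g}" if "g \<in> C'" for g
    using that m(2)[of g] unfolding C'(1) using C'(2) by auto
  have "totalp_on C' before" using tot by (rule totalp_on_subset) (auto simp: C_def)
  from insert.IH[OF this]
  have "(\<Sum>g\<in>C'. \<Phi> (insert g {h\<in>C. before h g}) - \<Phi> {h\<in>C. before h g}) = \<Phi> C' - \<Phi> {}"
    using pg by simp
  moreover have "(\<Sum>g\<in>C. \<Phi> (insert g {h\<in>C. before h g}) - \<Phi> {h\<in>C. before h g})
    = (\<Phi> (insert m C') - \<Phi> C') + (\<Sum>g\<in>C'. \<Phi> (insert g {h\<in>C. before h g}) - \<Phi> {h\<in>C. before h g})"
    using C'(2,3) pm by (subst (1) C'(1)) simp
  ultimately show ?case by (simp add: C_def)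
qed

text \<open>A Pinsker type estimate for the logarithm \<open>w\<close> of a subprobability ratio: a
  mean near 0 forces \<open>w\<close> to be small in \<open>L\<^sup>1\<close>. The exponential
  moment controls only large positive values; the negative ones are recovered from the mean. The
  parameter \<open>r\<close> comes from \<open>abs_le_square_scaled\<close>.\<close>

lemma (in prob_space) L1_bound_of_exp:
  fixes w :: "'a \<Rightarrow> real"
  assumes w: "integrable M w" and le: "(\<integral>\<^sup>+x. ennreal (exp (w x)) \<partial>M) \<le> 1"
  shows "(\<integral>x. w x \<partial>M) \<le> 0"
    and "r > 0 \<Longrightarrow> (\<integral>x. \<bar>w x\<bar> \<partial>M) \<le> 2 / r - 2 * r * (\<integral>x. w x \<partial>M) - (\<integral>x. w x \<partial>M)"
proof -
  have [measurable]: "w \<in> borel_measurable M" using w by auto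
  have ie: "integrable M (\<lambda>x. exp (w x))"
    using le by (intro integrableI_nonneg) (auto simp: order_le_less_trans)
  have "ennreal (\<integral>x. exp (w x) \<partial>M) \<le> 1"
    using le nn_integral_eq_integral[OF ie] by simp
  then have e1: "(\<integral>x. exp (w x) \<partial>M) \<le> 1" by simp
  have "(\<integral>x. w x \<partial>M) \<le> (\<integral>x. exp (w x) - 1 \<partial>M)"
    using w ie by (intro integral_mono) (auto simp: algebra_simps exp_ge_add_one_self)
  also have "\<dots> = (\<integral>x. exp (w x) \<partial>M) - 1" using ie by (simp add: prob_space)
  finally show neg: "(\<integral>x. w x \<partial>M) \<le> 0" using e1 by linarith
  assume r: "r > 0"
  \<comment> \<open>With \<open>s = exp (w / 2)\<close>, \<open>E s\<^sup>2 \<le> 1\<close> and \<open>1 - s \<le> - w / 2\<close> give \<open>E (s - 1)\<^sup>2 \<le> - E w\<close>.\<close>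
  define s where "s x = exp (w x / 2)" for x
  have [measurable]: "s \<in> borel_measurable M" unfolding s_def by measurable
  have s2: "(s x)\<^sup>2 = exp (w x)" for x by (simp add: s_def power2_eq_square flip: exp_add)
  have is2: "integrable M (\<lambda>x. (s x)\<^sup>2)" using ie by (simp add: s2)
  have sb: "\<bar>s x\<bar> \<le> 1 + (s x)\<^sup>2" for x
    using zero_le_power2[of "\<bar>s x\<bar> - 1"] zero_le_power2[of "s x"] unfolding power2_diff by simp
  have is1: "integrable M s"
    by (rule Bochner_Integration.integrable_bound[where f = "\<lambda>x. 1 + (s x)\<^sup>2"]) (use is2 sb in auto)
  have id: "integrable M (\<lambda>x. (s x - 1)\<^sup>2)"
    using is1 is2 by (simp add: power2_diff)
  have s_ge: "1 - s x \<le> - (w x / 2)" for x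
    using exp_ge_add_one_self[of "w x / 2"] unfolding s_def by linarith
  have "(\<integral>x. 1 - s x \<partial>M) \<le> (\<integral>x. - w x / 2 \<partial>M)"
    using w is1 by (intro integral_mono) (auto simp: s_ge)
  then have "1 - (\<integral>x. s x \<partial>M) \<le> - (\<integral>x. w x \<partial>M) / 2"
    using is1 w by (simp add: prob_space)
  moreover have "(\<integral>x. (s x - 1)\<^sup>2 \<partial>M) = (\<integral>x. (s x)\<^sup>2 \<partial>M) + 1 - 2 * (\<integral>x. s x \<partial>M)"
    using is1 is2 by (simp add: power2_diff prob_space)
  ultimately have d2: "(\<integral>x. (s x - 1)\<^sup>2 \<partial>M) \<le> - (\<integral>x. w x \<partial>M)"
    using e1 by (simp add: s2)
  have "(\<integral>x. \<bar>s x - 1\<bar> \<partial>M) \<le> (\<integral>x. 1 / (2 * r) + r / 2 * (s x - 1)\<^sup>2 \<partial>M)"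
    using is1 id abs_le_square_scaled[OF r] by (intro integral_mono) auto
  also have "\<dots> = 1 / (2 * r) + r / 2 * (\<integral>x. (s x - 1)\<^sup>2 \<partial>M)"
    using id by (simp add: prob_space)
  also have "\<dots> \<le> 1 / (2 * r) + r / 2 * (- (\<integral>x. w x \<partial>M))"
    using d2 r by (intro add_left_mono mult_left_mono) auto
  finally have s1: "(\<integral>x. \<bar>s x - 1\<bar> \<partial>M) \<le> 1 / (2 * r) + r / 2 * (- (\<integral>x. w x \<partial>M))" .
  \<comment> \<open>\<open>\<bar>w x\<bar>\<close> is twice the positive part minus
    \<open>w x\<close>, and the positive part is at most
    \<open>2 * \<bar>s x - 1\<bar>\<close>.\<close>
  have "\<bar>w x\<bar> \<le> 4 * \<bar>s x - 1\<bar> - w x" for x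
  proof -
    have "w x / 2 \<le> \<bar>s x - 1\<bar>" using s_ge[of x] by linarith
    then show ?thesis by (cases "w x \<ge> 0") (simp_all add: field_simps)
  qed
  then have "(\<integral>x. \<bar>w x\<bar> \<partial>M) \<le> (\<integral>x. 4 * \<bar>s x - 1\<bar> - w x \<partial>M)"
    using is1 w by (intro integral_mono) auto
  also have "\<dots> = 4 * (\<integral>x. \<bar>s x - 1\<bar> \<partial>M) - (\<integral>x. w x \<partial>M)"
    using is1 w by simp
  also have "\<dots> \<le> 4 * (1 / (2 * r) + r / 2 * (- (\<integral>x. w x \<partial>M))) - (\<integral>x. w x \<partial>M)"
    using s1 by simp
  also have "\<dots> = 2 / r - 2 * r * (\<integral>x. w x \<partial>M) - (\<integral>x. w x \<partial>M)"
    using r by (simp add: field_simps)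
  finally show "(\<integral>x. \<bar>w x\<bar> \<partial>M) \<le> 2 / r - 2 * r * (\<integral>x. w x \<partial>M) - (\<integral>x. w x \<partial>M)" .
qed

context density_field
begin

definition cll :: "'i \<Rightarrow> 'i set \<Rightarrow> 'a \<Rightarrow> real" where
  "cll g J x = rll (insert g J) x - rll J x"

lemma cll_measurable [measurable]: "cll g J \<in> borel_measurable M"
  unfolding cll_def by measurable

text \<open>The index type has no order in this locale. An enumeration of \<open>B\<close> with
  \<open>k\<close> put last supplies one for \<open>chain_bound\<close>.\<close>

lemma exists_rank:
  assumes "finite B" "k \<notin> B"
  shows "\<exists>rank :: 'i \<Rightarrow> nat. inj_on rank (insert k B) \<and> (\<forall>g\<in>B. rank g < rank k)"
proof -
  obtain f where f: "bij_betw f B {0..<card B}" using ex_bij_betw_finite_nat[OF assms(1)] by auto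
  define rank where "rank g = (if g = k then card B else f g)" for g
  have lt: "f g < card B" if "g \<in> B" for g using f that by (auto simp: bij_betw_def)
  have "inj_on rank (insert k B)"
  proof (rule inj_onI)
    fix g h assume gh: "g \<in> insert k B" "h \<in> insert k B" "rank g = rank h"
    show "g = h"
    proof (cases "g = k \<or> h = k")
      case True
      then show ?thesis using gh lt[of g] lt[of h] by (auto simp: rank_def split: if_splits)
    next
      case False
      then show ?thesis using gh f by (auto simp: rank_def bij_betw_def dest: inj_onD)
    qed
  qed
  moreover have "\<forall>g\<in>B. rank g < rank k" using lt assms(2) by (auto simp: rank_def)
  ultimately show ?thesis by blast
qed

text \<open>In both bounds the sites of \<open>B\<close> see their full past, so that their terms
  add up to \<open>rll B\<close>. In the first the last site \<open>k\<close> sees only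
  \<open>A\<close>; in the second it is left out of \<open>G\<close> and gets a normal
  factor.\<close>

lemma cll_bounds:
  assumes B: "finite B" "k \<notin> B" and A: "A \<subseteq> B"
  shows "(\<integral>\<^sup>+x. ennreal (exp (cll k A x - cll k B x)) \<partial>M) \<le> 1"
    and "(\<integral>\<^sup>+x. ennreal (exp (- cll k B x)) \<partial>M) \<le> 1"
proof -
  obtain rank :: "'i \<Rightarrow> nat" where rank: "inj_on rank (insert k B)" "\<And>g. g \<in> B \<Longrightarrow> rank g < rank k"
    using exists_rank[OF B] by blast
  define before where "before g h \<longleftrightarrow> rank g < rank h" for g h
  have ord: "asymp before" "transp before"
    by (auto simp: before_def asymp_on_def transp_on_def)
  have tot: "totalp_on B before"
    using rank(1) unfolding totalp_on_def before_def inj_on_def by (metis insertCI linorder_neqE_nat)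
  define J where "J g = (if g = k then A else {h\<in>B. before h g})" for g
  have sB: "(\<Sum>g\<in>B. rll (insert g (J g)) x - rll (J g) x) = rll B x" for x
  proof -
    have "(\<Sum>g\<in>B. rll (insert g (J g)) x - rll (J g) x)
      = (\<Sum>g\<in>B. rll (insert g {h\<in>B. before h g}) x - rll {h\<in>B. before h g} x)"
      using B(2) by (intro sum.cong) (auto simp: J_def)
    also have "\<dots> = rll B x"
      using telescope_over_order[OF ord B(1) tot, of "\<lambda>K. rll K x"] by (simp add: rll_empty)
    finally show ?thesis .
  qed
  have J: "J g \<subseteq> {h\<in>insert k B. before h g}" if "g \<in> insert k B" for g
    using A rank(2) by (auto simp: J_def before_def)
  have "(\<integral>\<^sup>+x. ennreal (exp ((\<Sum>g\<in>insert k B. rll (insert g (J g)) x - rll (J g) x) - rll (insert k B) x)) \<partial>M) \<le> 1"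
    using B J by (intro chain_bound[OF ord]) auto
  also have "(\<lambda>x. (\<Sum>g\<in>insert k B. rll (insert g (J g)) x - rll (J g) x) - rll (insert k B) x)
      = (\<lambda>x. cll k A x - cll k B x)"
    using B sB by (simp add: cll_def fun_eq_iff) (simp add: J_def)
  finally show "(\<integral>\<^sup>+x. ennreal (exp (cll k A x - cll k B x)) \<partial>M) \<le> 1" .
  have "(\<integral>\<^sup>+x. ennreal (exp ((\<Sum>g\<in>B. rll (insert g (J g)) x - rll (J g) x) - rll (insert k B) x)) \<partial>M) \<le> 1"
    using B J by (intro chain_bound[OF ord]) auto
  then show "(\<integral>\<^sup>+x. ennreal (exp (- cll k B x)) \<partial>M) \<le> 1"
    by (simp add: sB cll_def)
qed

definition gain_bound :: "'i \<Rightarrow> 'i set \<Rightarrow> real \<Rightarrow> bool" where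
  "gain_bound k V a \<longleftrightarrow> (\<forall>A. finite A \<longrightarrow> A \<subseteq> V \<longrightarrow>
     integrable M (cll k A) \<and> (\<integral>x. cll k A x \<partial>M) \<le> a)"

lemma gain_boundD:
  assumes "gain_bound k V a" "finite A" "A \<subseteq> V"
  shows "integrable M (cll k A)" "(\<integral>x. cll k A x \<partial>M) \<le> a"
  using assms by (simp_all add: gain_bound_def)

text \<open>The \<open>L\<^sup>1\<close> limit along the finite subsets of \<open>V\<close> replaces the information gain given all of \<open>V\<close>, so that no
  conditional density on an infinite product is needed.\<close>

definition past_limit :: "'i \<Rightarrow> 'i set \<Rightarrow> ('a \<Rightarrow> real) \<Rightarrow> bool" where
  "past_limit k V L \<longleftrightarrow> integrable M L \<and>
    (\<forall>\<eta>>0. \<exists>A. finite A \<and> A \<subseteq> V \<and>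
      (\<forall>B. finite B \<longrightarrow> A \<subseteq> B \<longrightarrow> B \<subseteq> V \<longrightarrow> (\<integral>x. \<bar>cll k B x - L x\<bar> \<partial>M) \<le> \<eta>))"

lemma past_limitE:
  assumes "past_limit k V L" "\<eta> > 0"
  obtains A where "finite A" "A \<subseteq> V"
    "\<And>B. finite B \<Longrightarrow> A \<subseteq> B \<Longrightarrow> B \<subseteq> V \<Longrightarrow> (\<integral>x. \<bar>cll k B x - L x\<bar> \<partial>M) \<le> \<eta>"
  using assms unfolding past_limit_def by meson

lemma past_limit_integrable: "past_limit k V L \<Longrightarrow> integrable M L"
  by (simp add: past_limit_def)

text \<open>Takes the place of martingale convergence along the directed family of finite subsets of
  \<open>V\<close>. The mean gains are bounded by \<open>a\<close>, so a set whose mean is within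
  \<open>(1/4) ^ n\<close> of their supremum leaves its supersets little to add, and
  \<open>L1_bound_of_exp\<close> makes them close in \<open>L\<^sup>1\<close>. The chosen sets need
  not be nested and are compared through their unions.\<close>

lemma ex_past_limit:
  assumes k: "k \<notin> V" and gb: "gain_bound k V a"
  shows "\<exists>L. past_limit k V L \<and> (\<integral>y. L y \<partial>M) \<le> a"
proof -
  note bnd = gain_boundD[OF gb]
  define D where "D A = (\<integral>y. cll k A y \<partial>M)" for A
  define F where "F = {A. finite A \<and> A \<subseteq> V}"
  define d where "d = Sup (D ` F)"
  have ne: "D ` F \<noteq> {}" and bdd: "bdd_above (D ` F)"
    using bnd(2) by (auto simp: F_def D_def intro!: bdd_aboveI[of _ a])
  have Dle: "D A \<le> d" if "A \<in> F" for A
    unfolding d_def using that bdd by (intro cSup_upper) auto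
  have i: "integrable M (cll k A)" if "A \<in> F" for A using that bnd(1) by (auto simp: F_def)
  have close: "(\<integral>y. \<bar>cll k A y - cll k B y\<bar> \<partial>M) \<le> 5 * (1/2) ^ n"
    if AB: "A \<in> F" "B \<in> F" "A \<subseteq> B" and near: "D A > d - (1/4) ^ n" for A B n
  proof -
    define w where "w y = cll k A y - cll k B y" for y
    have iw: "integrable M w" unfolding w_def by (intro Bochner_Integration.integrable_diff i AB)
    have le1: "(\<integral>\<^sup>+y. ennreal (exp (w y)) \<partial>M) \<le> 1"
      unfolding w_def using AB k by (intro cll_bounds(1)) (auto simp: F_def)
    \<comment> \<open>The mean of \<open>w\<close> is at least \<open>- 1 / r\<^sup>2\<close>, and
      \<open>2 / r + (2 * r + 1) / r\<^sup>2\<close> is at most \<open>5 / r\<close> because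
      \<open>r \<ge> 1\<close>.\<close>
    define r :: real where "r = 2 ^ n"
    have r: "r > 0" "(1/4) ^ n = 1 / (r * r)" "(1/2) ^ n = 1 / r"
      by (auto simp: r_def power_divide simp flip: power_mult_distrib)
    have "(\<integral>y. w y \<partial>M) = D A - D B" unfolding w_def D_def using i[OF AB(1)] i[OF AB(2)] by simp
    then have ge: "- (\<integral>y. w y \<partial>M) \<le> 1 / (r * r)" using Dle[OF AB(2)] near r(2) by linarith
    have "(\<integral>y. \<bar>w y\<bar> \<partial>M) \<le> 2 / r - 2 * r * (\<integral>x. w x \<partial>M) - (\<integral>x. w x \<partial>M)"
      by (rule L1_bound_of_exp(2)[OF iw le1 r(1)])
    also have "\<dots> = 2 / r + (2 * r + 1) * (- (\<integral>x. w x \<partial>M))" by (simp add: algebra_simps)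
    also have "\<dots> \<le> 2 / r + (2 * r + 1) * (1 / (r * r))"
      using ge r(1) by (intro add_left_mono mult_left_mono) auto
    also have "\<dots> \<le> 5 * (1/2) ^ n"
    proof -
      have "r \<ge> 1" by (simp add: r_def)
      then show ?thesis unfolding r(3) using r(1) by (simp add: field_simps)
    qed
    finally show ?thesis by (simp add: w_def)
  qed
  have "\<exists>A\<in>F. D A > d - (1/4) ^ n" for n
    using less_cSupD[OF ne, of "d - (1/4) ^ n"] unfolding d_def by auto
  then obtain A where A: "\<And>n. A n \<in> F" "\<And>n. D (A n) > d - (1/4) ^ n" by metis
  have U: "A n \<union> A m \<in> F" for n m using A(1)[of n] A(1)[of m] by (auto simp: F_def)
  have inc: "(\<integral>y. \<bar>cll k (A (Suc n)) y - cll k (A n) y\<bar> \<partial>M) \<le> 10 * (1/2) ^ n" for n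
  proof -
    let ?U = "A n \<union> A (Suc n)"
    have "(\<integral>y. \<bar>cll k (A (Suc n)) y - cll k (A n) y\<bar> \<partial>M) \<le>
      (\<integral>y. \<bar>cll k (A (Suc n)) y - cll k ?U y\<bar> + \<bar>cll k (A n) y - cll k ?U y\<bar> \<partial>M)"
      using i[OF A(1)] i[OF U] by (intro integral_mono) auto
    also have "\<dots> = (\<integral>y. \<bar>cll k (A (Suc n)) y - cll k ?U y\<bar> \<partial>M) + (\<integral>y. \<bar>cll k (A n) y - cll k ?U y\<bar> \<partial>M)"
      using i[OF A(1)] i[OF U] by simp
    also have "\<dots> \<le> 5 * (1/2) ^ Suc n + 5 * (1/2) ^ n"
      by (intro add_mono close A U) auto
    also have "\<dots> \<le> 10 * (1/2) ^ n" by simp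
    finally show ?thesis .
  qed
  obtain L where L: "integrable M L" "(\<lambda>n. \<integral>y. \<bar>cll k (A n) y - L y\<bar> \<partial>M) \<longlonglongrightarrow> 0"
    using L1_limit_of_summable_increments[of M "\<lambda>n. cll k (A n)" "\<lambda>n. 10 * (1/2) ^ n"] i[OF A(1)] inc
    by (auto simp: summable_mult)
  have near: "(\<integral>y. \<bar>cll k B y - L y\<bar> \<partial>M) \<le> 5 * (1/2) ^ n + (\<integral>y. \<bar>cll k (A n) y - L y\<bar> \<partial>M)"
    if B: "B \<in> F" "A n \<subseteq> B" for B n
  proof -
    have "(\<integral>y. \<bar>cll k B y - L y\<bar> \<partial>M) \<le>
      (\<integral>y. \<bar>cll k (A n) y - cll k B y\<bar> + \<bar>cll k (A n) y - L y\<bar> \<partial>M)"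
      using i[OF A(1)] i[OF B(1)] L(1) by (intro integral_mono) auto
    also have "\<dots> = (\<integral>y. \<bar>cll k (A n) y - cll k B y\<bar> \<partial>M) + (\<integral>y. \<bar>cll k (A n) y - L y\<bar> \<partial>M)"
      using i[OF A(1)] i[OF B(1)] L(1) by simp
    also have "\<dots> \<le> 5 * (1/2) ^ n + (\<integral>y. \<bar>cll k (A n) y - L y\<bar> \<partial>M)"
      by (intro add_right_mono close A B)
    finally show ?thesis .
  qed
  have lim: "(\<lambda>n. 5 * (1/2) ^ n + (\<integral>y. \<bar>cll k (A n) y - L y\<bar> \<partial>M)) \<longlonglongrightarrow> 5 * 0 + 0"
    by (intro tendsto_intros L(2) LIMSEQ_realpow_zero) auto
  have approx: "\<exists>A. finite A \<and> A \<subseteq> V \<and>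
      (\<forall>B. finite B \<longrightarrow> A \<subseteq> B \<longrightarrow> B \<subseteq> V \<longrightarrow> (\<integral>y. \<bar>cll k B y - L y\<bar> \<partial>M) \<le> \<eta>)" if e: "\<eta> > 0" for \<eta>
  proof -
    obtain n where n: "5 * (1/2) ^ n + (\<integral>y. \<bar>cll k (A n) y - L y\<bar> \<partial>M) < \<eta>"
      using order_tendstoD(2)[OF lim, of \<eta>] e by (auto simp: eventually_sequentially)
    have "(\<integral>y. \<bar>cll k B y - L y\<bar> \<partial>M) \<le> \<eta>" if "finite B" "A n \<subseteq> B" "B \<subseteq> V" for B
      using near[of B n] that n by (simp add: F_def)
    then show ?thesis using A(1)[of n] unfolding F_def by blast
  qed
  have "(\<integral>y. L y \<partial>M) \<le> a + (\<integral>y. \<bar>cll k (A n) y - L y\<bar> \<partial>M)" for n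
  proof -
    have "(\<integral>y. L y \<partial>M) \<le> (\<integral>y. cll k (A n) y + \<bar>cll k (A n) y - L y\<bar> \<partial>M)"
      using i[OF A(1)] L(1) by (intro integral_mono) auto
    also have "\<dots> = (\<integral>y. cll k (A n) y \<partial>M) + (\<integral>y. \<bar>cll k (A n) y - L y\<bar> \<partial>M)"
      using i[OF A(1)] L(1) by simp
    also have "\<dots> \<le> a + (\<integral>y. \<bar>cll k (A n) y - L y\<bar> \<partial>M)"
      using bnd(2) A(1)[of n] by (simp add: F_def)
    finally show ?thesis .
  qed
  then have "(\<integral>y. L y \<partial>M) \<le> a + 0"
    by (intro LIMSEQ_le_const[OF tendsto_add[OF tendsto_const L(2)]]) auto
  then have "(\<integral>y. L y \<partial>M) \<le> a" by simp
  then show ?thesis using L(1) approx unfolding past_limit_def by (intro exI[of _ L] conjI allI impI)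
qed

end

section \<open>Stationary fields\<close>

text \<open>Borel-Cantelli in series form: with the weights \<open>1 / (n + 1)\<^sup>2\<close> the
  sum of the exponentials has finite mean, so the weighted terms tend to 0. The bound is the
  logarithm of the inverse weight.\<close>

lemma (in prob_space) AE_eventually_le_of_exp:
  fixes w :: "nat \<Rightarrow> 'a \<Rightarrow> real"
  assumes [measurable]: "\<And>n. w n \<in> borel_measurable M"
    and le: "\<And>n. (\<integral>\<^sup>+x. ennreal (exp (w n x)) \<partial>M) \<le> 1"
  shows "AE x in M. \<forall>\<^sub>F n in sequentially. w n x \<le> 2 * ln (real (Suc n))"
proof -
  have s: "summable (\<lambda>n. 1 / (real (Suc n))\<^sup>2)"
    using inverse_power_summable[of 2, where 'a = real] by (subst summable_Suc_iff) (simp add: field_simps)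
  define t where "t n x = exp (w n x) / (real (Suc n))\<^sup>2" for n x
  have [measurable]: "t n \<in> borel_measurable M" for n unfolding t_def by measurable
  have "(\<integral>\<^sup>+x. (\<Sum>n. ennreal (t n x)) \<partial>M) = (\<Sum>n. \<integral>\<^sup>+x. ennreal (t n x) \<partial>M)"
    by (rule nn_integral_suminf) measurable
  also have "\<dots> \<le> (\<Sum>n. ennreal (1 / (real (Suc n))\<^sup>2))"
  proof (rule suminf_le)
    fix n
    have "(\<integral>\<^sup>+x. ennreal (t n x) \<partial>M) = (\<integral>\<^sup>+x. ennreal (1 / (real (Suc n))\<^sup>2) * ennreal (exp (w n x)) \<partial>M)"
      by (intro nn_integral_cong) (simp add: t_def flip: ennreal_mult)
    also have "\<dots> = ennreal (1 / (real (Suc n))\<^sup>2) * (\<integral>\<^sup>+x. ennreal (exp (w n x)) \<partial>M)"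
      by (rule nn_integral_cmult) measurable
    also have "\<dots> \<le> ennreal (1 / (real (Suc n))\<^sup>2) * 1"
      using le by (intro mult_left_mono) auto
    finally show "(\<integral>\<^sup>+x. ennreal (t n x) \<partial>M) \<le> ennreal (1 / (real (Suc n))\<^sup>2)" by simp
  qed auto
  also have "\<dots> < \<infinity>"
    using s by (subst suminf_ennreal2) auto
  finally have "AE x in M. (\<Sum>n. ennreal (t n x)) \<noteq> \<infinity>"
    by (intro nn_integral_PInf_AE) auto
  then show ?thesis
  proof eventually_elim
    case (elim x)
    then have "summable (\<lambda>n. t n x)"
      by (intro summable_suminf_not_top) (auto simp: t_def)
    then have "(\<lambda>n. t n x) \<longlonglongrightarrow> 0" by (rule summable_LIMSEQ_zero)
    then have "\<forall>\<^sub>F n in sequentially. t n x < 1" by (rule order_tendstoD) simp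
    then show ?case
    proof eventually_elim
      case (elim n)
      then have "exp (w n x) < (real (Suc n))\<^sup>2" by (simp add: t_def)
      then have "w n x < ln ((real (Suc n))\<^sup>2)"
        by (metis exp_less_cancel_iff exp_ln of_nat_0_less_iff zero_less_Suc zero_less_power)
      then show ?case by (simp add: ln_realpow)
    qed
  qed
qed

definition int_pair :: "nat \<times> nat \<Rightarrow> int \<times> int" where
  "int_pair g = (int (fst g), int (snd g))"

lemma distr_leb_shift:
  fixes K :: "(int \<times> int) set"
  assumes K: "finite K"
  shows "distr (leb ((\<lambda>h. h + s) ` K)) (leb K) (\<lambda>x. \<lambda>h\<in>K. x (h + s)) = leb K"
proof (rule lborel_prod.PiM_eqI)
  let ?K' = "(\<lambda>h. h + s) ` K"
  have m: "(\<lambda>x. \<lambda>h\<in>K. x (h + s)) \<in> leb ?K' \<rightarrow>\<^sub>M leb K"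
    by (intro measurable_restrict measurable_component_singleton) auto
  fix A :: "int \<times> int \<Rightarrow> real set" assume A: "\<And>i. i \<in> K \<Longrightarrow> A i \<in> sets lborel"
  have "Pi\<^sub>E K A \<in> sets (leb K)" using A K by (intro sets_PiM_I_finite) auto
  then have "emeasure (distr (leb ?K') (leb K) (\<lambda>x. \<lambda>h\<in>K. x (h + s))) (Pi\<^sub>E K A)
      = emeasure (leb ?K') ((\<lambda>x. \<lambda>h\<in>K. x (h + s)) -` Pi\<^sub>E K A \<inter> space (leb ?K'))"
    by (rule emeasure_distr[OF m])
  also have "(\<lambda>x. \<lambda>h\<in>K. x (h + s)) -` Pi\<^sub>E K A \<inter> space (leb ?K') = Pi\<^sub>E ?K' (\<lambda>h. A (h - s))"
    by (auto simp: space_PiM PiE_iff extensional_def)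
  also have "emeasure (leb ?K') (Pi\<^sub>E ?K' (\<lambda>h. A (h - s))) = (\<Prod>h\<in>?K'. emeasure lborel (A (h - s)))"
    using A K by (intro lborel_prod.emeasure_PiM) auto
  also have "\<dots> = (\<Prod>h\<in>K. emeasure lborel (A h))"
    by (subst prod.reindex) (auto simp: inj_on_def)
  finally show "emeasure (distr (leb ?K') (leb K) (\<lambda>x. \<lambda>h\<in>K. x (h + s))) (Pi\<^sub>E K A) = (\<Prod>i\<in>K. emeasure lborel (A i))" .
qed (use K in auto)

text \<open>The past is the lexicographically positive half-plane, because it has to contain the punctured quadrant.\<close>

definition halfplane :: "(int \<times> int) set" where
  "halfplane = {g. 0 < snd g \<or> snd g = 0 \<and> 0 < fst g}"

text \<open>With this orientation the past of the origin is \<open>halfplane\<close> itself; the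
  second coordinate is compared first.\<close>

definition before :: "int \<times> int \<Rightarrow> int \<times> int \<Rightarrow> bool" where
  "before h g \<longleftrightarrow> h - g \<in> halfplane"

lemma before_iff: "before h g \<longleftrightarrow> snd g < snd h \<or> snd g = snd h \<and> fst g < fst h"
  by (auto simp: before_def halfplane_def)

lemma before_order: "asymp before" "transp before" "totalp_on C before"
  by (auto simp: before_iff asymp_on_def transp_on_def totalp_on_def prod_eq_iff)

lemma finite_square [simp]: "finite (square n)"
  by (simp add: square_def)

lemma int_pair_square: "bij_betw int_pair ({..<n} \<times> {..<n}) (square n)"
  unfolding bij_betw_def
proof
  show "inj_on int_pair ({..<n} \<times> {..<n})" by (auto simp: inj_on_def int_pair_def)
  have "g \<in> int_pair ` ({..<n} \<times> {..<n})" if "g \<in> square n" for g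
    using that by (intro image_eqI[of _ _ "(nat (fst g), nat (snd g))"]) (auto simp: int_pair_def square_def)
  then show "int_pair ` ({..<n} \<times> {..<n}) = square n" by (auto simp: int_pair_def square_def)
qed

lemma sum_square: "(\<Sum>g\<in>square n. f g) = (\<Sum>g\<in>{..<n} \<times> {..<n}. f (int_pair g))"
  using sum.reindex_bij_betw[OF int_pair_square, of f n] by simp

locale stationary_field = ergodic_pair M T S + density_field M X
  for M :: "'a measure" and T S and X :: "int \<times> int \<Rightarrow> 'a \<Rightarrow> real" +
  assumes X_T: "x \<in> space M \<Longrightarrow> X g (T x) = X (g + (1, 0)) x"
    and X_S: "x \<in> space M \<Longrightarrow> X g (S x) = X (g + (0, 1)) x"
begin

abbreviation mean_rll :: "nat \<Rightarrow> 'a \<Rightarrow> real" where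
  "mean_rll n x \<equiv> rll (square n) x / (real n) ^ 2"

lemma X_funpow_T: "x \<in> space M \<Longrightarrow> X g ((T ^^ i) x) = X (g + (int i, 0)) x"
  by (induction i arbitrary: g) (auto simp: X_T add.assoc simp flip: zero_prod_def)

lemma X_funpow_S: "x \<in> space M \<Longrightarrow> X g ((S ^^ i) x) = X (g + (0, int i)) x"
  by (induction i arbitrary: g) (auto simp: X_S add.assoc simp flip: zero_prod_def)

lemma X_act: "x \<in> space M \<Longrightarrow> X h (act g x) = X (h + int_pair g) x"
  by (simp add: act_def X_funpow_T X_funpow_S int_pair_def add.assoc)

text \<open>Both \<open>M\<close> and Lebesgue measure are invariant under the shift. The identity
  is only almost sure because \<open>dens\<close> is chosen separately for \<open>K\<close> and for
  its translate.\<close>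

lemma rll_act:
  assumes K: "finite K"
  shows "AE z in M. rll K (act g z) = rll ((\<lambda>h. h + int_pair g) ` K) z"
proof -
  define s where "s = int_pair g"
  define K' where "K' = (\<lambda>h. h + s) ` K"
  have K': "finite K'" using K by (simp add: K'_def)
  define \<phi> where "\<phi> x = (\<lambda>h\<in>K. x (h + s))" for x :: "int \<times> int \<Rightarrow> real"
  define \<psi> where "\<psi> y = (\<lambda>h\<in>K'. y (h - s))" for y :: "int \<times> int \<Rightarrow> real"
  have [measurable]: "\<phi> \<in> (bor K') \<rightarrow>\<^sub>M (bor K)"
    unfolding \<phi>_def by (intro measurable_restrict measurable_component_singleton) (auto simp: K'_def)
  have [measurable]: "\<psi> \<in> (bor K) \<rightarrow>\<^sub>M (bor K')"
    unfolding \<psi>_def by (intro measurable_restrict measurable_component_singleton) (auto simp: K'_def)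
  have \<phi>_restr: "restr K (act g z) = \<phi> (restr K' z)" if "z \<in> space M" for z
    using that by (auto simp: restr_def \<phi>_def K'_def X_act s_def fun_eq_iff)
  have \<psi>_restr: "\<psi> (restr K (act g z)) = restr K' z" if "z \<in> space M" for z
    using that by (auto simp: restr_def \<psi>_def K'_def X_act s_def fun_eq_iff)
  have \<psi>\<phi>: "\<psi> (\<phi> x) = x" if "x \<in> space (leb K')" for x
    using that by (auto simp: \<phi>_def \<psi>_def K'_def space_PiM PiE_iff extensional_def fun_eq_iff)
  have dist: "distr (leb K') (leb K) \<phi> = leb K"
    using distr_leb_shift[OF K, of s] by (simp add: K'_def \<phi>_def[abs_def])
  have "density (leb K') (\<lambda>x. dens K (\<phi> x)) = law K'"
  proof (rule measure_eqI)
    fix A assume "A \<in> sets (density (leb K') (\<lambda>x. dens K (\<phi> x)))"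
    then have [measurable]: "A \<in> sets (bor K')" by simp
    have "emeasure (density (leb K') (\<lambda>x. dens K (\<phi> x))) A = (\<integral>\<^sup>+x. dens K (\<phi> x) * indicator A x \<partial>leb K')"
      by (rule emeasure_density) measurable
    also have "\<dots> = (\<integral>\<^sup>+x. dens K (\<phi> x) * indicator A (\<psi> (\<phi> x)) \<partial>leb K')"
      by (intro nn_integral_cong) (simp add: \<psi>\<phi>)
    also have "\<dots> = (\<integral>\<^sup>+y. dens K y * indicator A (\<psi> y) \<partial>distr (leb K') (leb K) \<phi>)"
      by (rule nn_integral_distr[symmetric]) measurable
    also have "\<dots> = (\<integral>\<^sup>+y. dens K y * indicator A (\<psi> y) \<partial>leb K)"
      by (simp only: dist)
    also have "\<dots> = (\<integral>\<^sup>+z. indicator A (\<psi> (restr K z)) \<partial>M)"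
      by (rule nn_integral_restr[OF K, symmetric]) measurable
    also have "\<dots> = (\<integral>\<^sup>+z. indicator A (\<psi> (restr K (act g z))) \<partial>M)"
      by (rule nn_integral_act[symmetric]) measurable
    also have "\<dots> = (\<integral>\<^sup>+z. indicator A (restr K' z) \<partial>M)"
      by (intro nn_integral_cong) (simp add: \<psi>_restr)
    also have "\<dots> = emeasure (law K') A"
      using nn_integral_distr[of "restr K'" M "bor K'" "indicator A"] by (simp add: law_def)
    finally show "emeasure (density (leb K') (\<lambda>x. dens K (\<phi> x))) A = emeasure (law K') A" .
  qed simp
  then have "AE x in leb K'. dens K (\<phi> x) = RN_deriv (leb K') (law K') x"
    by (intro sigma_finite_measure.RN_deriv_unique[OF sigma_finite_leb[OF K']]) auto
  then have "AE z in M. dens K (\<phi> (restr K' z)) = dens K' (restr K' z)"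
    unfolding dens_def[symmetric] by (rule AE_law_imp_AE[OF K'])
  then show ?thesis using AE_space
  proof eventually_elim
    case (elim z)
    note eq = elim(1) and z = elim(2)
    have "(\<Sum>h\<in>K'. ln (std_normal_density (X h z))) = (\<Sum>h\<in>K. ln (std_normal_density (X h (act g z))))"
      unfolding K'_def using z by (subst sum.reindex) (auto simp: inj_on_def X_act s_def)
    then show ?case
      unfolding rll_def K'_def[unfolded s_def, symmetric] using eq z by (simp add: \<phi>_restr)
  qed
qed

lemma cll_act:
  assumes "finite J"
  shows "AE x in M. cll k J (act g x) = cll (k + int_pair g) ((\<lambda>h. h + int_pair g) ` J) x"
  using rll_act[OF assms, of g] rll_act[of "insert k J" g] assms
  unfolding cll_def by (auto elim!: eventually_elim2)

lemma cll_at: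
  assumes "finite J"
  shows "AE x in M. cll (int_pair g) J x = cll (0, 0) ((\<lambda>h. h - int_pair g) ` J) (act g x)"
proof -
  have "(\<lambda>h. h + int_pair g) ` (\<lambda>h. h - int_pair g) ` J = J" by (simp add: image_image)
  then show ?thesis
    using cll_act[of "(\<lambda>h. h - int_pair g) ` J" "(0, 0)" g] assms by (auto simp: zero_prod_def[symmetric] elim: eventually_mono)
qed

lemma rll_square_telescope:
  "rll (square n) x = (\<Sum>g\<in>square n. cll g {h\<in>square n. before h g} x)"
  using telescope_over_order[OF before_order(1,2) _ before_order(3), of "square n" "\<lambda>K. rll K x"]
  by (simp add: cll_def rll_empty)

lemma shifted_past:
  assumes "finite C"
  shows "finite ((\<lambda>h. h - g) ` {h\<in>C. before h g})" "(\<lambda>h. h - g) ` {h\<in>C. before h g} \<subseteq> halfplane"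
  using assms by (auto simp: before_def)

end

section \<open>Almost sure bounds on squares\<close>

lemma log_over_square_tendsto: "(\<lambda>n. 2 * ln (real (Suc n)) / (real n)\<^sup>2) \<longlonglongrightarrow> 0"
  by real_asymp

context stationary_field
begin

text \<open>\<open>f\<close> is a minorant of the gain, so that truncations can be used when the
  gain itself is not integrable. The sites whose translate of \<open>A\<close> might leave the
  square are not in \<open>G\<close>: they receive normal factors in \<open>chain_bound\<close> and
  form a negligible border.\<close>

lemma rll_lower_bound:
  assumes A: "finite A" "A \<subseteq> halfplane"
    and f: "integrable M f" and le: "\<And>y. f y \<le> cll (0, 0) A y" and c: "c < (\<integral>y. f y \<partial>M)"
  shows "AE y in M. \<forall>\<^sub>F n in sequentially. c < mean_rll n y"
proof -
  have [measurable]: "f \<in> borel_measurable M" using f by auto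
  have "finite ((\<lambda>h. nat \<bar>fst h\<bar>) ` A \<union> (\<lambda>h. nat \<bar>snd h\<bar>) ` A)" using A by simp
  then obtain p :: nat where p: "\<forall>x\<in>(\<lambda>h. nat \<bar>fst h\<bar>) ` A \<union> (\<lambda>h. nat \<bar>snd h\<bar>) ` A. x \<le> p"
    unfolding finite_nat_set_iff_bounded_le by (rule exE)
  have pA: "\<bar>fst h\<bar> \<le> int p" "\<bar>snd h\<bar> \<le> int p" if "h \<in> A" for h
  proof -
    have "nat \<bar>fst h\<bar> \<le> p" "nat \<bar>snd h\<bar> \<le> p" using p that by simp_all
    then show "\<bar>fst h\<bar> \<le> int p" "\<bar>snd h\<bar> \<le> int p" by simp_all
  qed
  \<comment> \<open>\<open>p\<close> bounds all coordinates occurring in \<open>A\<close>, so a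
    margin of width \<open>p\<close> on every side suffices. The window has its corner at
    \<open>(p, p)\<close>, and for this reason the ergodic theorem is applied at
    \<open>act (p, p) y\<close>.\<close>
  define I where "I n = (\<lambda>g. g + (p, p)) ` ({..<n - 2 * p} \<times> {..<n - 2 * p})" for n
  define sh where "sh g = (\<lambda>h. h + int_pair g) ` A" for g
  have injI: "inj_on (\<lambda>g. g + (p, p)) B" for B :: "(nat \<times> nat) set" by (auto simp: inj_on_def)
  have injv: "inj_on int_pair B" for B by (auto simp: inj_on_def int_pair_def)
  have I_sq: "int_pair ` I n \<subseteq> square n" for n by (auto simp: I_def int_pair_def square_def)
  have J: "sh g \<subseteq> {h\<in>square n. before h (int_pair g)}" if "g \<in> I n" for g n
  proof
    fix h' assume "h' \<in> sh g"
    then obtain h where h: "h \<in> A" "h' = h + int_pair g" by (auto simp: sh_def)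
    have "before h' (int_pair g)" using A(2) h by (auto simp: before_def)
    moreover have "h' \<in> square n" using pA[OF h(1)] that h(2)
      by (cases h) (auto simp: I_def square_def int_pair_def)
    ultimately show "h' \<in> {h\<in>square n. before h (int_pair g)}" by simp
  qed
  have finI: "finite (I n)" for n by (simp add: I_def)
  define U where "U n y = (\<Sum>g\<in>I n. cll (0, 0) A (act g y))" for n y
  have [measurable]: "U n \<in> borel_measurable M" for n unfolding U_def by measurable
  have U: "(\<integral>\<^sup>+y. ennreal (exp (U n y - rll (square n) y)) \<partial>M) \<le> 1" for n
  proof -
    \<comment> \<open>\<open>chain_bound\<close> is indexed by integer pairs here; \<open>J'\<close>
      carries the sets \<open>sh g\<close> over to the image of \<open>int_pair\<close>.\<close>
    define J' where "J' v = sh (nat (fst v), nat (snd v))" for v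
    have J': "J' (int_pair g) = sh g" for g by (simp add: J'_def int_pair_def)
    have "(\<integral>\<^sup>+y. ennreal (exp ((\<Sum>v\<in>int_pair ` I n. rll (insert v (J' v)) y - rll (J' v) y) - rll (square n) y)) \<partial>M) \<le> 1"
    proof (intro chain_bound[OF before_order(1,2)])
      show "J' v \<subseteq> {h\<in>square n. before h v}" if "v \<in> int_pair ` I n" for v
      proof -
        obtain g where "g \<in> I n" "v = int_pair g" using \<open>v \<in> int_pair ` I n\<close> by (rule imageE)
        then show ?thesis using J[of g n] J'[of g] by simp
      qed
    qed (use I_sq in auto)
    also have "(\<lambda>y. \<Sum>v\<in>int_pair ` I n. rll (insert v (J' v)) y - rll (J' v) y)
        = (\<lambda>y. \<Sum>g\<in>I n. cll (int_pair g) (sh g) y)"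
      by (subst sum.reindex[OF injv]) (simp add: J' cll_def)
    finally have le1: "(\<integral>\<^sup>+y. ennreal (exp ((\<Sum>g\<in>I n. cll (int_pair g) (sh g) y) - rll (square n) y)) \<partial>M) \<le> 1" .
    have "AE y in M. \<forall>g\<in>I n. cll (0, 0) A (act g y) = cll (int_pair g) (sh g) y"
      using finI cll_act[OF A(1), of "(0, 0)"]
      by (intro AE_finite_allI) (auto simp: sh_def zero_prod_def[symmetric])
    then have "AE y in M. ennreal (exp (U n y - rll (square n) y)) = ennreal (exp ((\<Sum>g\<in>I n. cll (int_pair g) (sh g) y) - rll (square n) y))"
      by eventually_elim (simp add: U_def)
    from nn_integral_cong_AE[OF this] show ?thesis using le1 by simp
  qed
  have bc: "AE y in M. \<forall>\<^sub>F n in sequentially. U n y - rll (square n) y \<le> 2 * ln (real (Suc n))"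
    using U by (intro AE_eventually_le_of_exp) auto
  have avgA: "AE y in M. (\<lambda>n. avg f n (act (p, p) y)) \<longlonglongrightarrow> (\<integral>y. f y \<partial>M)"
    using AE_act[OF ergodic_average[OF f]] .
  show ?thesis using bc avgA AE_space
  proof eventually_elim
    case (elim y)
    note bc = elim(1) and av = elim(2) and y = elim(3)
    have Uge: "U n y \<ge> (real (n - 2 * p))\<^sup>2 * avg f (n - 2 * p) (act (p, p) y)" for n
    proof -
      have "(real (n - 2 * p))\<^sup>2 * avg f (n - 2 * p) (act (p, p) y)
        = (\<Sum>g\<in>{..<n - 2 * p} \<times> {..<n - 2 * p}. f (act g (act (p, p) y)))"
        by (auto simp: avg_def)
      also have "\<dots> \<le> (\<Sum>g\<in>{..<n - 2 * p} \<times> {..<n - 2 * p}. cll (0, 0) A (act g (act (p, p) y)))"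
        by (intro sum_mono le)
      also have "\<dots> = U n y"
        unfolding U_def I_def using y by (subst sum.reindex[OF injI]) (simp add: act_act)
      finally show ?thesis .
    qed
    have "filterlim (\<lambda>n. n - 2 * p) sequentially sequentially"
      by (rule filterlim_minus_const_nat_at_top)
    from filterlim_compose[OF av this]
    have av': "(\<lambda>n. avg f (n - 2 * p) (act (p, p) y)) \<longlonglongrightarrow> (\<integral>y. f y \<partial>M)" .
    have "(\<lambda>n. (real n - 2 * real p)\<^sup>2 / (real n)\<^sup>2) \<longlonglongrightarrow> 1" by real_asymp
    moreover have "\<forall>\<^sub>F n in sequentially. (real n - 2 * real p)\<^sup>2 / (real n)\<^sup>2 = (real (n - 2 * p))\<^sup>2 / (real n)\<^sup>2"
      using eventually_ge_at_top[of "2 * p"] by eventually_elim (simp add: of_nat_diff)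
    ultimately have ratio: "(\<lambda>n. (real (n - 2 * p))\<^sup>2 / (real n)\<^sup>2) \<longlonglongrightarrow> 1"
      by (rule Lim_transform_eventually)
    have "(\<lambda>n. (real (n - 2 * p))\<^sup>2 / (real n)\<^sup>2 * avg f (n - 2 * p) (act (p, p) y)
        - 2 * ln (real (Suc n)) / (real n)\<^sup>2) \<longlonglongrightarrow> 1 * (\<integral>y. f y \<partial>M) - 0"
      by (intro tendsto_intros ratio av' log_over_square_tendsto)
    then have "\<forall>\<^sub>F n in sequentially. c < (real (n - 2 * p))\<^sup>2 / (real n)\<^sup>2 * avg f (n - 2 * p) (act (p, p) y)
        - 2 * ln (real (Suc n)) / (real n)\<^sup>2"
      by (rule order_tendstoD) (use c in simp)
    then show ?case
      using bc
    proof eventually_elim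
      case (elim n)
      note c = elim(1) and b = elim(2)
      have "(real (n - 2 * p))\<^sup>2 / (real n)\<^sup>2 * avg f (n - 2 * p) (act (p, p) y)
        - 2 * ln (real (Suc n)) / (real n)\<^sup>2
        = ((real (n - 2 * p))\<^sup>2 * avg f (n - 2 * p) (act (p, p) y) - 2 * ln (real (Suc n))) / (real n)\<^sup>2"
        by (simp add: diff_divide_distrib)
      also have "\<dots> \<le> mean_rll n y"
        using Uge[of n] b by (intro divide_right_mono) auto
      finally show ?case using c by linarith
    qed
  qed
qed

definition box :: "nat \<Rightarrow> (int \<times> int) set" where
  "box k = {- int k..int k} \<times> {- int k..int k}"

lemma finite_box [simp]: "finite (box k)"
  by (simp add: box_def)

text \<open>For a large box \<open>C\<close>, the conditional densities given the past inside the square and, outside the square, given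
  the past inside \<open>C\<close> multiply up to a subprobability density on \<open>C\<close>. The box then grows, and Fatou applies.\<close>

lemma rll_upper_exp:
  assumes pl: "past_limit (0, 0) halfplane L" and gb: "gain_bound (0, 0) halfplane a"
  shows "(\<integral>\<^sup>+y. ennreal (exp (rll (square n) y - (\<Sum>g\<in>{..<n} \<times> {..<n}. L (act g y)))) \<partial>M) \<le> 1"
proof -
  note L = past_limit_integrable[OF pl] and int = gain_boundD(1)[OF gb]
  have [measurable]: "L \<in> borel_measurable M" using L by auto
  let ?Q = "{..<n} \<times> {..<n} :: (nat \<times> nat) set"
  define c where "c k g y = cll (int_pair g) {h\<in>box k. before h (int_pair g)} y" for k g y
  have [measurable]: "c k g \<in> borel_measurable M" for k g unfolding c_def by measurable
  \<comment> \<open>The past of the site inside the box, moved to the origin. These sets exhaust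
    \<open>halfplane\<close> as the box grows, so that \<open>past_limit\<close> applies.\<close>
  define B where "B k g = (\<lambda>h. h - int_pair g) ` {h\<in>box k. before h (int_pair g)}" for k g
  have B: "finite (B k g)" "B k g \<subseteq> halfplane" for k g
    unfolding B_def by (intro shifted_past finite_box)+
  have cB: "AE y in M. c k g y = cll (0, 0) (B k g) (act g y)" for k g
    unfolding c_def B_def by (intro cll_at) simp
  have ic: "integrable M (c k g)" for k g
    using integrable_cong_AE[OF _ _ cB[of k g]] integrable_act[OF int[OF B], of k g g] by simp
  have dc: "(\<integral>y. \<bar>c k g y - L (act g y)\<bar> \<partial>M) = (\<integral>y. \<bar>cll (0, 0) (B k g) y - L y\<bar> \<partial>M)" for k g
  proof -
    have "(\<integral>y. \<bar>c k g y - L (act g y)\<bar> \<partial>M) = (\<integral>y. \<bar>cll (0, 0) (B k g) (act g y) - L (act g y)\<bar> \<partial>M)"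
      using cB[of k g] by (intro integral_cong_AE) (auto elim!: eventually_mono)
    also have "\<dots> = (\<integral>y. \<bar>cll (0, 0) (B k g) y - L y\<bar> \<partial>M)"
      by (rule integral_act) measurable
    finally show ?thesis .
  qed
  have cL: "(\<lambda>k. \<integral>y. \<bar>c k g y - L (act g y)\<bar> \<partial>M) \<longlonglongrightarrow> 0" for g
  proof (rule LIMSEQ_I)
    fix r :: real assume "r > 0"
    then have "r / 2 > 0" by simp
    then obtain A where A: "finite A" "A \<subseteq> halfplane"
      "\<And>B. finite B \<Longrightarrow> A \<subseteq> B \<Longrightarrow> B \<subseteq> halfplane \<Longrightarrow> (\<integral>y. \<bar>cll (0, 0) B y - L y\<bar> \<partial>M) \<le> r / 2"
      using past_limitE[OF pl] by blast
    have "finite ((\<lambda>h. nat \<bar>fst (h + int_pair g)\<bar>) ` A \<union> (\<lambda>h. nat \<bar>snd (h + int_pair g)\<bar>) ` A)" using A by simp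
    then obtain k0 where k0: "\<forall>x\<in>(\<lambda>h. nat \<bar>fst (h + int_pair g)\<bar>) ` A \<union> (\<lambda>h. nat \<bar>snd (h + int_pair g)\<bar>) ` A. x \<le> k0"
      unfolding finite_nat_set_iff_bounded_le by (rule exE)
    have "A \<subseteq> B k g" if k: "k \<ge> k0" for k
    proof
      fix h assume h: "h \<in> A"
      have "nat \<bar>fst (h + int_pair g)\<bar> \<le> k" "nat \<bar>snd (h + int_pair g)\<bar> \<le> k"
        using k0 h order_trans[OF _ k] by simp_all
      then have "h + int_pair g \<in> box k" by (cases "h + int_pair g") (auto simp: box_def)
      moreover have "before (h + int_pair g) (int_pair g)" using h A(2) by (auto simp: before_def)
      ultimately show "h \<in> B k g" unfolding B_def by (intro image_eqI[of _ _ "h + int_pair g"]) auto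
    qed
    then have "(\<integral>y. \<bar>c k g y - L (act g y)\<bar> \<partial>M) \<le> r / 2" if "k \<ge> k0" for k
      unfolding dc using A(3)[of "B k g"] B that by simp
    then show "\<exists>no. \<forall>k\<ge>no. norm ((\<integral>y. \<bar>c k g y - L (act g y)\<bar> \<partial>M) - 0) < r"
      using \<open>r > 0\<close> by (intro exI[of _ k0]) force
  qed
  define u where "u k y = (\<Sum>g\<in>?Q. c k g y - L (act g y))" for k y
  have iu: "integrable M (u k)" for k
    unfolding u_def using ic L by (intro Bochner_Integration.integrable_sum Bochner_Integration.integrable_diff integrable_act) auto
  then have [measurable]: "u k \<in> borel_measurable M" for k by auto
  have "(\<lambda>k. \<integral>y. norm (u k y) \<partial>M) \<longlonglongrightarrow> 0"
  proof (rule tendsto_sandwich[where f = "\<lambda>_. 0" and h = "\<lambda>k. \<Sum>g\<in>?Q. \<integral>y. \<bar>c k g y - L (act g y)\<bar> \<partial>M"])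
    show "\<forall>\<^sub>F k in sequentially. (\<integral>y. norm (u k y) \<partial>M) \<le> (\<Sum>g\<in>?Q. \<integral>y. \<bar>c k g y - L (act g y)\<bar> \<partial>M)"
    proof (rule always_eventually, rule allI)
      fix k
      have "(\<integral>y. norm (u k y) \<partial>M) \<le> (\<integral>y. (\<Sum>g\<in>?Q. \<bar>c k g y - L (act g y)\<bar>) \<partial>M)"
      proof (rule integral_mono)
        show "integrable M (\<lambda>y. \<Sum>g\<in>?Q. \<bar>c k g y - L (act g y)\<bar>)"
          using ic L by (intro Bochner_Integration.integrable_sum integrable_abs Bochner_Integration.integrable_diff integrable_act) auto
        show "norm (u k y) \<le> (\<Sum>g\<in>?Q. \<bar>c k g y - L (act g y)\<bar>)" for y
          unfolding u_def real_norm_def by (rule sum_abs)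
      qed (use iu in auto)
      also have "\<dots> = (\<Sum>g\<in>?Q. \<integral>y. \<bar>c k g y - L (act g y)\<bar> \<partial>M)"
        using ic L by (intro Bochner_Integration.integral_sum integrable_abs Bochner_Integration.integrable_diff integrable_act) auto
      finally show "(\<integral>y. norm (u k y) \<partial>M) \<le> (\<Sum>g\<in>?Q. \<integral>y. \<bar>c k g y - L (act g y)\<bar> \<partial>M)" .
    qed
    show "(\<lambda>k. \<Sum>g\<in>?Q. \<integral>y. \<bar>c k g y - L (act g y)\<bar> \<partial>M) \<longlonglongrightarrow> 0"
      by (rule tendsto_null_sum) (rule cL)
  qed (auto intro: always_eventually)
  \<comment> \<open>\<open>L\<^sup>1\<close> convergence yields almost sure convergence along a
    subsequence only. That is enough for Fatou's lemma, as the bound 1 holds for all large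
    boxes.\<close>
  from tendsto_L1_AE_subseq[OF iu this] obtain r :: "nat \<Rightarrow> nat"
    where r: "strict_mono r" "AE y in M. (\<lambda>k. u (r k) y) \<longlonglongrightarrow> 0" by auto
  define v where "v k y = rll (square n) y - (\<Sum>g\<in>?Q. c k g y)" for k y
  have [measurable]: "v k \<in> borel_measurable M" for k unfolding v_def by measurable
  have v1: "(\<integral>\<^sup>+y. ennreal (exp (v k y)) \<partial>M) \<le> 1" if k: "k \<ge> n" for k
  proof -
    have sub: "square n \<subseteq> box k" using k by (auto simp: square_def box_def)
    define J where "J g = (if g \<in> square n then {h\<in>square n. before h g} else {h\<in>box k. before h g})" for g
    have J: "J g \<subseteq> {h\<in>box k. before h g}" for g using sub by (auto simp: J_def)
    have "(\<integral>\<^sup>+y. ennreal (exp ((\<Sum>g\<in>box k. rll (insert g (J g)) y - rll (J g) y) - rll (box k) y)) \<partial>M) \<le> 1"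
      using J by (intro chain_bound[OF before_order(1,2)]) auto
    \<comment> \<open>By the chain rule on the box, the terms outside the square cancel against
      those of \<open>rll (box k)\<close>. What remains compares, at the sites of the square, the
      past inside the square with the past inside the box.\<close>
    moreover have "(\<Sum>g\<in>box k. rll (insert g (J g)) y - rll (J g) y) - rll (box k) y = v k y" for y
    proof -
      have "(\<Sum>g\<in>box k. rll (insert g (J g)) y - rll (J g) y)
        = (\<Sum>g\<in>box k - square n. cll g (J g) y) + (\<Sum>g\<in>square n. cll g (J g) y)"
        unfolding cll_def[symmetric] by (rule sum.subset_diff[OF sub]) simp
      also have "(\<Sum>g\<in>square n. cll g (J g) y) = rll (square n) y"
        unfolding rll_square_telescope by (intro sum.cong) (auto simp: J_def)
      also have "(\<Sum>g\<in>box k - square n. cll g (J g) y) = (\<Sum>g\<in>box k - square n. cll g {h\<in>box k. before h g} y)"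
        by (intro sum.cong) (auto simp: J_def)
      also have "\<dots> = (\<Sum>g\<in>box k. cll g {h\<in>box k. before h g} y) - (\<Sum>g\<in>square n. cll g {h\<in>box k. before h g} y)"
        using sum.subset_diff[OF sub, of "\<lambda>g. cll g {h\<in>box k. before h g} y"] by simp
      also have "(\<Sum>g\<in>box k. cll g {h\<in>box k. before h g} y) = rll (box k) y"
        using telescope_over_order[OF before_order(1,2) _ before_order(3), of "box k" "\<lambda>K. rll K y"]
        by (simp add: cll_def rll_empty)
      finally show ?thesis by (simp add: v_def c_def sum_square)
    qed
    ultimately show ?thesis by simp
  qed
  have "(\<integral>\<^sup>+y. ennreal (exp (rll (square n) y - (\<Sum>g\<in>?Q. L (act g y)))) \<partial>M)
      = (\<integral>\<^sup>+y. liminf (\<lambda>k. ennreal (exp (v (r k) y))) \<partial>M)"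
  proof (rule nn_integral_cong_AE)
    show "AE y in M. ennreal (exp (rll (square n) y - (\<Sum>g\<in>?Q. L (act g y)))) = liminf (\<lambda>k. ennreal (exp (v (r k) y)))"
      using r(2)
    proof eventually_elim
      case (elim y)
      note lim = elim
      have "v k y = rll (square n) y - (\<Sum>g\<in>?Q. L (act g y)) - u k y" for k
        by (simp add: v_def u_def sum_subtractf)
      moreover have "(\<lambda>k. ennreal (exp (rll (square n) y - (\<Sum>g\<in>?Q. L (act g y)) - u (r k) y)))
          \<longlonglongrightarrow> ennreal (exp (rll (square n) y - (\<Sum>g\<in>?Q. L (act g y)) - 0))"
        by (intro tendsto_ennrealI tendsto_intros lim)
      ultimately have "(\<lambda>k. ennreal (exp (v (r k) y))) \<longlonglongrightarrow> ennreal (exp (rll (square n) y - (\<Sum>g\<in>?Q. L (act g y))))"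
        by simp
      from lim_imp_Liminf[OF _ this]
      show ?case
        by simp
    qed
  qed
  also have "\<dots> \<le> liminf (\<lambda>k. \<integral>\<^sup>+y. ennreal (exp (v (r k) y)) \<partial>M)"
    by (rule nn_integral_liminf) measurable
  also have "\<dots> \<le> 1"
  proof -
    have "\<forall>\<^sub>F k in sequentially. (\<integral>\<^sup>+y. ennreal (exp (v (r k) y)) \<partial>M) \<le> 1"
      using eventually_ge_at_top[of n]
    proof eventually_elim
      case (elim k)
      then have "n \<le> r k" using seq_suble[OF r(1), of k] by linarith
      then show ?case by (rule v1)
    qed
    then have "liminf (\<lambda>k. \<integral>\<^sup>+y. ennreal (exp (v (r k) y)) \<partial>M) \<le> liminf (\<lambda>k::nat. 1 :: ennreal)"
      by (rule Liminf_mono)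
    then show ?thesis by (simp add: Liminf_const)
  qed
  finally show ?thesis .
qed

lemma rll_upper_bound:
  assumes pl: "past_limit (0, 0) halfplane L" and gb: "gain_bound (0, 0) halfplane a"
    and c: "(\<integral>x. L x \<partial>M) < c"
  shows "AE x in M. \<forall>\<^sub>F n in sequentially. mean_rll n x < c"
proof -
  note L = past_limit_integrable[OF pl]
  have [measurable]: "L \<in> borel_measurable M" using L by auto
  have "AE x in M. \<forall>\<^sub>F n in sequentially. rll (square n) x - (\<Sum>g\<in>{..<n} \<times> {..<n}. L (act g x)) \<le> 2 * ln (real (Suc n))"
    using rll_upper_exp[OF pl gb] by (intro AE_eventually_le_of_exp) auto
  then show ?thesis using ergodic_average[OF L]
  proof eventually_elim
    case (elim x)
    note bc = elim(1) and av = elim(2)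
    have "(\<lambda>n. avg L n x + 2 * ln (real (Suc n)) / (real n)\<^sup>2) \<longlonglongrightarrow> (\<integral>x. L x \<partial>M) + 0"
      by (intro tendsto_add av log_over_square_tendsto)
    then have "\<forall>\<^sub>F n in sequentially. avg L n x + 2 * ln (real (Suc n)) / (real n)\<^sup>2 < c"
      by (rule order_tendstoD) (use c in simp)
    then show ?case
      using bc
    proof eventually_elim
      case (elim n)
      note c = elim(1) and b = elim(2)
      have "mean_rll n x \<le> ((\<Sum>g\<in>{..<n} \<times> {..<n}. L (act g x)) + 2 * ln (real (Suc n))) / (real n)\<^sup>2"
        using b by (intro divide_right_mono) auto
      also have "\<dots> = avg L n x + 2 * ln (real (Suc n)) / (real n)\<^sup>2"
        by (simp add: avg_def add_divide_distrib)
      finally show ?case using c by linarith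
    qed
  qed
qed

end

section \<open>Convergence in mean and the divergent case\<close>

text \<open>A Scheffe type argument: \<open>\<bar>Y - a\<bar>\<close> is \<open>Y - a\<close> plus
  twice the positive part of \<open>a - Y\<close>. The first term has nonpositive mean. The second
  is at most twice the sum of the bounded \<open>g\<close>, handled by dominated convergence, and
  the negative part of \<open>Y\<close>, controlled by \<open>b\<close>.\<close>

lemma (in prob_space) L1_tendsto_of_AE_tendsto:
  fixes Y :: "nat \<Rightarrow> 'a \<Rightarrow> real"
  assumes Y: "\<And>n. integrable M (Y n)" and conv: "AE x in M. (\<lambda>n. Y n x) \<longlonglongrightarrow> a"
    and le: "\<And>n. (\<integral>x. Y n x \<partial>M) \<le> a"
    and neg: "\<And>n. (\<integral>\<^sup>+x. ennreal (- Y n x) \<partial>M) \<le> ennreal (b n)" "\<And>n. b n \<ge> 0" "b \<longlonglongrightarrow> 0"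
  shows "(\<lambda>n. \<integral>x. \<bar>Y n x - a\<bar> \<partial>M) \<longlonglongrightarrow> 0"
proof -
  have [measurable]: "Y n \<in> borel_measurable M" for n using Y by auto
  define g where "g n x = max 0 (a - max (Y n x) 0)" for n x
  have [measurable]: "g n \<in> borel_measurable M" for n unfolding g_def by measurable
  have gb: "\<bar>g n x\<bar> \<le> \<bar>a\<bar>" for n x by (auto simp: g_def)
  have ig: "integrable M (g n)" for n
    by (rule integrable_const_bound[where B = "\<bar>a\<bar>"]) (use gb in auto)
  have ineg: "integrable M (\<lambda>x. max 0 (- Y n x))" for n using Y by auto
  have "(\<lambda>n. \<integral>x. g n x \<partial>M) \<longlonglongrightarrow> (\<integral>x. 0 \<partial>M)"
  proof (rule integral_dominated_convergence[where w = "\<lambda>_. \<bar>a\<bar>"])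
    show "AE x in M. (\<lambda>n. g n x) \<longlonglongrightarrow> 0"
      using conv
    proof eventually_elim
      case (elim x)
      then have "(\<lambda>n. g n x) \<longlonglongrightarrow> max 0 (a - max a 0)"
        unfolding g_def by (intro tendsto_intros)
      then show ?case by simp
    qed
  qed (use gb in auto)
  then have g0: "(\<lambda>n. \<integral>x. g n x \<partial>M) \<longlonglongrightarrow> 0" by simp
  have bound: "(\<integral>x. \<bar>Y n x - a\<bar> \<partial>M) \<le> 2 * (\<integral>x. g n x \<partial>M) + 2 * b n" for n
  proof -
    have "(\<integral>\<^sup>+x. ennreal (max 0 (- Y n x)) \<partial>M) = (\<integral>\<^sup>+x. ennreal (- Y n x) \<partial>M)"
      by (intro nn_integral_cong) (auto simp: max_def ennreal_neg)
    then have "ennreal (\<integral>x. max 0 (- Y n x) \<partial>M) \<le> ennreal (b n)"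
      using neg(1)[of n] nn_integral_eq_integral[OF ineg[of n]] by simp
    then have nb: "(\<integral>x. max 0 (- Y n x) \<partial>M) \<le> b n"
      using neg(2)[of n] by simp
    have "\<bar>Y n x - a\<bar> \<le> (Y n x - a) + 2 * g n x + 2 * max 0 (- Y n x)" for x
      by (auto simp: g_def max_def abs_if)
    then have "(\<integral>x. \<bar>Y n x - a\<bar> \<partial>M) \<le> (\<integral>x. (Y n x - a) + 2 * g n x + 2 * max 0 (- Y n x) \<partial>M)"
      using Y ig ineg by (intro integral_mono) auto
    also have "\<dots> = ((\<integral>x. Y n x \<partial>M) - a) + 2 * (\<integral>x. g n x \<partial>M) + 2 * (\<integral>x. max 0 (- Y n x) \<partial>M)"
      using Y[of n] ig[of n] ineg[of n] by (simp add: prob_space)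
    also have "\<dots> \<le> 2 * (\<integral>x. g n x \<partial>M) + 2 * b n" using le[of n] nb by linarith
    finally show ?thesis .
  qed
  have "(\<lambda>n. 2 * (\<integral>x. g n x \<partial>M) + 2 * b n) \<longlonglongrightarrow> 2 * 0 + 2 * 0"
    by (intro tendsto_intros g0 neg(3))
  then have lim: "(\<lambda>n. 2 * (\<integral>x. g n x \<partial>M) + 2 * b n) \<longlonglongrightarrow> 0" by simp
  show ?thesis
    by (rule tendsto_sandwich[OF _ _ tendsto_const lim]) (auto intro: always_eventually bound)
qed

lemma nn_integral_neg_le_exp:
  assumes "\<And>x. - g x \<le> exp (- f x)"
  shows "(\<integral>\<^sup>+x. ennreal (- g x) \<partial>M) \<le> (\<integral>\<^sup>+x. ennreal (exp (- f x)) \<partial>M)"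
  using assms by (intro nn_integral_mono ennreal_leI) auto

lemma (in prob_space) integrable_of_nn_integral_pos_neg:
  fixes f :: "'a \<Rightarrow> real"
  assumes [measurable]: "f \<in> borel_measurable M"
    and pos: "(\<integral>\<^sup>+x. ennreal (f x) \<partial>M) \<le> ennreal c" and neg: "(\<integral>\<^sup>+x. ennreal (- f x) \<partial>M) \<le> 1"
  shows "integrable M f"
proof -
  have "(\<integral>\<^sup>+x. ennreal \<bar>f x\<bar> \<partial>M) = (\<integral>\<^sup>+x. ennreal (f x) + ennreal (- f x) \<partial>M)"
    by (intro nn_integral_cong) (auto simp: abs_if ennreal_neg)
  also have "\<dots> = (\<integral>\<^sup>+x. ennreal (f x) \<partial>M) + (\<integral>\<^sup>+x. ennreal (- f x) \<partial>M)"
    by (rule nn_integral_add) auto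
  also have "\<dots> \<le> ennreal c + 1" using pos neg by (intro add_mono) auto
  also have "\<dots> < \<infinity>" by simp
  finally show ?thesis by (simp add: integrable_iff_bounded)
qed

context stationary_field
begin

lemma zero_notin_halfplane: "(0, 0) \<notin> halfplane"
  by (simp add: halfplane_def)

lemma cll_neg: "finite A \<Longrightarrow> A \<subseteq> halfplane \<Longrightarrow> (\<integral>\<^sup>+x. ennreal (exp (- cll (0, 0) A x)) \<partial>M) \<le> 1"
  using zero_notin_halfplane by (intro cll_bounds(2)[of A "(0, 0)" A]) auto

lemma integral_cll_nonneg:
  assumes "finite A" "A \<subseteq> halfplane" "integrable M (cll (0, 0) A)"
  shows "0 \<le> (\<integral>x. cll (0, 0) A x \<partial>M)"
  using L1_bound_of_exp(1)[of "\<lambda>x. - cll (0, 0) A x"] cll_neg[OF assms(1,2)] assms(3) by simp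

lemma rll_square_neg: "(\<integral>\<^sup>+x. ennreal (- (mean_rll n x)) \<partial>M) \<le> ennreal (1 / (real n)\<^sup>2)"
proof -
  \<comment> \<open>With \<open>G = {}\<close> the competing density on the square is the normal
    product itself.\<close>
  have e: "(\<integral>\<^sup>+x. ennreal (exp (- rll (square n) x)) \<partial>M) \<le> 1"
    using chain_bound[OF before_order(1,2), of "square n" "{}" "\<lambda>_. {}"] by simp
  have "(\<integral>\<^sup>+x. ennreal (- (mean_rll n x)) \<partial>M)
    \<le> (\<integral>\<^sup>+x. ennreal (1 / (real n)\<^sup>2) * ennreal (exp (- rll (square n) x)) \<partial>M)"
  proof (rule nn_integral_mono)
    fix x
    have "- rll (square n) x \<le> exp (- rll (square n) x)"
      using exp_ge_add_one_self[of "- rll (square n) x"] by linarith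
    then have "(- rll (square n) x) / (real n)\<^sup>2 \<le> exp (- rll (square n) x) / (real n)\<^sup>2"
      by (intro divide_right_mono) auto
    then show "ennreal (- (mean_rll n x)) \<le> ennreal (1 / (real n)\<^sup>2) * ennreal (exp (- rll (square n) x))"
      by (subst ennreal_mult[symmetric]) (auto intro: ennreal_leI)
  qed
  also have "\<dots> = ennreal (1 / (real n)\<^sup>2) * (\<integral>\<^sup>+x. ennreal (exp (- rll (square n) x)) \<partial>M)"
    by (rule nn_integral_cmult) measurable
  also have "\<dots> \<le> ennreal (1 / (real n)\<^sup>2) * 1"
    by (intro mult_left_mono e) auto
  finally show ?thesis by simp
qed

lemma rll_square_integral:
  assumes gb: "gain_bound (0, 0) halfplane a"
  shows "integrable M (rll (square n))" "(\<integral>x. rll (square n) x \<partial>M) \<le> (real n)\<^sup>2 * a"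
proof -
  note int = gain_boundD(1)[OF gb] and le = gain_boundD(2)[OF gb]
  define c where "c g x = cll (int_pair g) {h\<in>square n. before h (int_pair g)} x" for g x
  define B where "B g = (\<lambda>h. h - int_pair g) ` {h\<in>square n. before h (int_pair g)}" for g
  have B: "finite (B g)" "B g \<subseteq> halfplane" for g
    unfolding B_def by (intro shifted_past finite_square)+
  have cB: "AE x in M. c g x = cll (0, 0) (B g) (act g x)" for g
    unfolding c_def B_def by (intro cll_at) simp
  have [measurable]: "c g \<in> borel_measurable M" for g unfolding c_def by measurable
  have ic: "integrable M (c g)" for g
    using integrable_cong_AE[OF _ _ cB[of g]] integrable_act[OF int[OF B], of g g] by simp
  have intc: "(\<integral>x. c g x \<partial>M) \<le> a" for g
  proof -
    have "(\<integral>x. c g x \<partial>M) = (\<integral>x. cll (0, 0) (B g) (act g x) \<partial>M)"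
      using cB[of g] by (intro integral_cong_AE) auto
    also have "\<dots> = (\<integral>x. cll (0, 0) (B g) x \<partial>M)" by (rule integral_act) measurable
    also have "\<dots> \<le> a" by (rule le[OF B])
    finally show ?thesis .
  qed
  have eq: "rll (square n) = (\<lambda>x. \<Sum>g\<in>{..<n} \<times> {..<n}. c g x)"
    by (simp add: fun_eq_iff rll_square_telescope sum_square c_def)
  show "integrable M (rll (square n))"
    unfolding eq using ic by (intro Bochner_Integration.integrable_sum) auto
  have "(\<integral>x. rll (square n) x \<partial>M) = (\<Sum>g\<in>{..<n} \<times> {..<n}. \<integral>x. c g x \<partial>M)"
    unfolding eq using ic by (intro Bochner_Integration.integral_sum) auto
  also have "\<dots> \<le> (\<Sum>g\<in>{..<n} \<times> {..<n}. a)" by (intro sum_mono intc)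
  also have "\<dots> = (real n)\<^sup>2 * a" by (simp add: power2_eq_square)
  finally show "(\<integral>x. rll (square n) x \<partial>M) \<le> (real n)\<^sup>2 * a" .
qed

text \<open>Formulated with the positive part, because integrability is not yet known; by
  \<open>cll_neg\<close> the negative part has mean at most 1 in any case.\<close>

definition bounded_gain :: bool where
  "bounded_gain \<longleftrightarrow> (\<exists>c::real. \<forall>A. finite A \<longrightarrow> A \<subseteq> halfplane \<longrightarrow> (\<integral>\<^sup>+x. ennreal (cll (0, 0) A x) \<partial>M) \<le> ennreal c)"

lemma bounded_gain_integrable:
  assumes "bounded_gain"
  obtains c where "gain_bound (0, 0) halfplane c"
proof -
  obtain c :: real where c: "\<forall>A. finite A \<longrightarrow> A \<subseteq> halfplane \<longrightarrow> (\<integral>\<^sup>+x. ennreal (cll (0, 0) A x) \<partial>M) \<le> ennreal c"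
    using assms unfolding bounded_gain_def by (rule exE)
  have le: "(\<integral>\<^sup>+x. ennreal (cll (0, 0) A x) \<partial>M) \<le> ennreal (max 0 c)" if "finite A" "A \<subseteq> halfplane" for A
    using c[rule_format, OF that] by (rule order_trans) (auto intro: ennreal_leI)
  have "gain_bound (0, 0) halfplane (max 0 c)"
    unfolding gain_bound_def
  proof (intro allI impI conjI)
    fix A assume A: "finite A" "A \<subseteq> halfplane"
    have "- cll (0, 0) A x \<le> exp (- cll (0, 0) A x)" for x
      using exp_ge_add_one_self[of "- cll (0, 0) A x"] by linarith
    from order_trans[OF nn_integral_neg_le_exp[OF this] cll_neg[OF A]]
    show i: "integrable M (cll (0, 0) A)"
      by (rule integrable_of_nn_integral_pos_neg[OF cll_measurable le[OF A]])
    have "enn2real (\<integral>\<^sup>+x. ennreal (cll (0, 0) A x) \<partial>M) \<le> max 0 c"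
      using enn2real_mono[OF le[OF A] ennreal_less_top] enn2real_ennreal[of "max 0 c"] by linarith
    then show "(\<integral>x. cll (0, 0) A x \<partial>M) \<le> max 0 c"
      unfolding real_lebesgue_integral_def[OF i]
      using enn2real_nonneg[of "\<integral>\<^sup>+x. ennreal (- cll (0, 0) A x) \<partial>M"] by linarith
  qed
  then show thesis by (rule that)
qed

lemma bounded_gain_convergence:
  assumes "bounded_gain"
  obtains a where "AE x in M. (\<lambda>n. mean_rll n x) \<longlonglongrightarrow> a"
    "\<And>n. integrable M (rll (square n))"
    "(\<lambda>n. \<integral>x. \<bar>mean_rll n x - a\<bar> \<partial>M) \<longlonglongrightarrow> 0"
proof -
  obtain c where c: "gain_bound (0, 0) halfplane c" using bounded_gain_integrable[OF assms] .
  note int = gain_boundD(1)[OF c] and le = gain_boundD(2)[OF c]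
  define D where "D = (\<lambda>A. \<integral>x. cll (0, 0) A x \<partial>M) ` {A. finite A \<and> A \<subseteq> halfplane}"
  define a where "a = Sup D"
  have ne: "D \<noteq> {}" and bdd: "bdd_above D"
    using le by (auto simp: D_def intro!: bdd_aboveI[of _ c])
  have lea: "(\<integral>x. cll (0, 0) A x \<partial>M) \<le> a" if "finite A" "A \<subseteq> halfplane" for A
    unfolding a_def using that bdd by (intro cSup_upper) (auto simp: D_def)
  \<comment> \<open>Serves the index 0, where \<open>mean_rll\<close> is 0.\<close>
  have a0: "0 \<le> a"
    using integral_cll_nonneg[of "{}"] int[of "{}"] lea[of "{}"] by simp
  have gb: "gain_bound (0, 0) halfplane a"
    using int lea by (simp add: gain_bound_def)
  obtain L where L: "past_limit (0, 0) halfplane L" "(\<integral>x. L x \<partial>M) \<le> a"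
    using ex_past_limit[OF zero_notin_halfplane gb] by blast
  have up: "AE x in M. \<forall>\<^sub>F n in sequentially. mean_rll n x < a + 1 / real (Suc k)" for k
    using L(2) by (intro rll_upper_bound[OF L(1) gb]) (auto intro: le_less_trans)
  have lo: "AE x in M. \<forall>\<^sub>F n in sequentially. a - 1 / real (Suc k) < mean_rll n x" for k
  proof -
    have "a - 1 / real (Suc k) < Sup D" unfolding a_def by simp
    then obtain A where A: "finite A" "A \<subseteq> halfplane" "a - 1 / real (Suc k) < (\<integral>x. cll (0, 0) A x \<partial>M)"
      using less_cSupD[OF ne] unfolding D_def by blast
    show ?thesis by (rule rll_lower_bound[OF A(1,2) int[OF A(1,2)] order_refl A(3)])
  qed
  have conv: "AE x in M. (\<lambda>n. mean_rll n x) \<longlonglongrightarrow> a"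
  proof -
    have "AE x in M. \<forall>k. (\<forall>\<^sub>F n in sequentially. mean_rll n x < a + 1 / real (Suc k)) \<and>
       (\<forall>\<^sub>F n in sequentially. a - 1 / real (Suc k) < mean_rll n x)"
      using up lo by (simp add: AE_all_countable AE_conj_iff)
    then show ?thesis
    proof eventually_elim
      case (elim x)
      note h = elim
      show ?case
      proof (rule tendstoI)
        fix e :: real assume "e > 0"
        then obtain k where k: "1 / real (Suc k) < e" using nat_approx_posE by blast
        have "\<forall>\<^sub>F n in sequentially. mean_rll n x < a + 1 / real (Suc k)"
          "\<forall>\<^sub>F n in sequentially. a - 1 / real (Suc k) < mean_rll n x"
          using h by simp_all
        then show "\<forall>\<^sub>F n in sequentially. dist (mean_rll n x) a < e"
        proof eventually_elim
          case (elim n)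
          then show ?case
            using k unfolding dist_real_def by linarith
        qed
      qed
    qed
  qed
  note ri = rll_square_integral[OF gb]
  have "(\<lambda>n. \<integral>x. \<bar>mean_rll n x - a\<bar> \<partial>M) \<longlonglongrightarrow> 0"
  proof (rule L1_tendsto_of_AE_tendsto[where b = "\<lambda>n. 1 / (real n)\<^sup>2"])
    show "integrable M (\<lambda>x. mean_rll n x)" for n using ri(1)[of n] by simp
    show "(\<integral>x. mean_rll n x \<partial>M) \<le> a" for n
    proof (cases "n = 0")
      case True
      then show ?thesis using a0 by simp
    next
      case False
      then show ?thesis using ri(2)[of n] by (simp add: field_simps)
    qed
    show "(\<lambda>n. 1 / (real n)\<^sup>2) \<longlonglongrightarrow> 0" by real_asymp
  qed (use conv rll_square_neg in auto)
  with conv ri(1) show thesis by (rule that)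
qed

text \<open>Truncating the gain from above at a large level \<open>m\<close> keeps it a minorant and
  makes it integrable, and by monotone convergence its positive part still has mean above
  \<open>k + 2\<close>. Of the surplus 2, the negative part may consume 1, and the rest makes the
  inequality strict.\<close>

lemma unbounded_gain_divergence:
  assumes "\<not> bounded_gain"
  shows "AE x in M. filterlim (\<lambda>n. mean_rll n x) at_top sequentially"
proof -
  have "AE x in M. \<forall>\<^sub>F n in sequentially. real k < mean_rll n x" for k
  proof -
    have "\<exists>A. finite A \<and> A \<subseteq> halfplane \<and> \<not> (\<integral>\<^sup>+x. ennreal (cll (0, 0) A x) \<partial>M) \<le> ennreal (real k + 2)"
      using assms unfolding bounded_gain_def by (simp only: not_ex not_all not_imp)
    then obtain A where A: "finite A" "A \<subseteq> halfplane"
      "ennreal (real k + 2) < (\<integral>\<^sup>+x. ennreal (cll (0, 0) A x) \<partial>M)"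
      by (auto simp: not_le)
    define t where "t m x = min (cll (0, 0) A x) (real m)" for m x
    have [measurable]: "t m \<in> borel_measurable M" for m unfolding t_def by measurable
    have "(\<integral>\<^sup>+x. ennreal (cll (0, 0) A x) \<partial>M) = (\<integral>\<^sup>+x. (SUP m. ennreal (t m x)) \<partial>M)"
    proof (rule nn_integral_cong)
      fix x
      obtain m0 :: nat where m0: "cll (0, 0) A x \<le> real m0" using real_arch_simple by blast
      show "ennreal (cll (0, 0) A x) = (SUP m. ennreal (t m x))"
      proof (rule antisym)
        have "ennreal (cll (0, 0) A x) = ennreal (t m0 x)" using m0 by (simp add: t_def)
        then show "ennreal (cll (0, 0) A x) \<le> (SUP m. ennreal (t m x))"
          by (metis SUP_upper UNIV_I)
        show "(SUP m. ennreal (t m x)) \<le> ennreal (cll (0, 0) A x)"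
          by (intro SUP_least ennreal_leI) (simp add: t_def)
      qed
    qed
    also have "\<dots> = (SUP m. \<integral>\<^sup>+x. ennreal (t m x) \<partial>M)"
      by (rule nn_integral_monotone_convergence_SUP)
         (auto simp: incseq_def le_fun_def t_def intro!: ennreal_leI)
    finally have "ennreal (real k + 2) < (SUP m. \<integral>\<^sup>+x. ennreal (t m x) \<partial>M)" using A(3) by simp
    then obtain m where m: "ennreal (real k + 2) < (\<integral>\<^sup>+x. ennreal (t m x) \<partial>M)"
      by (auto simp: less_SUP_iff)
    have "(\<integral>\<^sup>+x. ennreal (t m x) \<partial>M) \<le> (\<integral>\<^sup>+x. ennreal (real m) \<partial>M)"
      by (intro nn_integral_mono ennreal_leI) (simp add: t_def)
    then have pos: "(\<integral>\<^sup>+x. ennreal (t m x) \<partial>M) \<le> ennreal (real m)"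
      by (simp add: emeasure_space_1)
    have "- t m x \<le> exp (- cll (0, 0) A x)" for x
      using exp_ge_add_one_self[of "- cll (0, 0) A x"] exp_ge_zero[of "- cll (0, 0) A x"]
      unfolding t_def by linarith
    from order_trans[OF nn_integral_neg_le_exp[OF this] cll_neg[OF A(1,2)]]
    have neg: "(\<integral>\<^sup>+x. ennreal (- t m x) \<partial>M) \<le> 1" .
    have it: "integrable M (t m)"
      by (rule integrable_of_nn_integral_pos_neg[OF _ pos neg]) measurable
    have "enn2real (\<integral>\<^sup>+x. ennreal (- t m x) \<partial>M) \<le> 1"
      using enn2real_mono[OF neg] by simp
    moreover have "enn2real (ennreal (real k + 2)) \<le> enn2real (\<integral>\<^sup>+x. ennreal (t m x) \<partial>M)"
      using pos by (intro enn2real_mono less_imp_le[OF m]) (simp add: le_less_trans)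
    then have "real k + 2 \<le> enn2real (\<integral>\<^sup>+x. ennreal (t m x) \<partial>M)"
      by (subst (asm) enn2real_ennreal) auto
    ultimately have "real k < (\<integral>x. t m x \<partial>M)"
      unfolding real_lebesgue_integral_def[OF it] by linarith
    then show ?thesis by (intro rll_lower_bound[OF A(1,2) it]) (simp add: t_def)
  qed
  then have "AE x in M. \<forall>k::nat. \<forall>\<^sub>F n in sequentially. real k < mean_rll n x"
    by (simp add: AE_all_countable)
  then show ?thesis
  proof eventually_elim
    case (elim x)
    note h = elim
    show ?case
      unfolding filterlim_at_top
    proof
      fix Z :: real
      obtain k :: nat where k: "Z \<le> real k" using real_arch_simple by blast
      from h[rule_format, of k] show "\<forall>\<^sub>F n in sequentially. Z \<le> mean_rll n x"
        by eventually_elim (use k in linarith)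
    qed
  qed
qed

end

section \<open>Relative entropy of the decoupled law\<close>

text \<open>The errors in the two measures are added, so that one set of the algebra approximates
  \<open>E\<close> in both at once.\<close>

lemma algebra_approximation:
  assumes alg: "algebra \<Omega> G" and N: "finite_measure N" "finite_measure N'"
    and sets: "sets N = sigma_sets \<Omega> G" "sets N' = sigma_sets \<Omega> G"
    and E: "E \<in> sigma_sets \<Omega> G" and e: "e > (0::real)"
  shows "\<exists>A\<in>G. measure N ((E - A) \<union> (A - E)) + measure N' ((E - A) \<union> (A - E)) < e"
  using E e
proof (induction arbitrary: e rule: sigma_sets.induct)
  interpret algebra \<Omega> G by (rule alg)
  {
    case (Basic a)
    then show ?case by (intro bexI[of _ a]) auto
  next
    case Empty
    then show ?case by (intro bexI[of _ "{}"]) auto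
  next
    case (Compl a)
    then obtain A where A: "A \<in> G" "measure N ((a - A) \<union> (A - a)) + measure N' ((a - A) \<union> (A - a)) < e" by blast
    have "a \<subseteq> \<Omega>" using Compl(1) sigma_sets_into_sp[OF space_closed] by blast
    moreover have "A \<subseteq> \<Omega>" using A(1) sets_into_space by auto
    ultimately have "((\<Omega> - a) - (\<Omega> - A)) \<union> ((\<Omega> - A) - (\<Omega> - a)) = (a - A) \<union> (A - a)" by auto
    then show ?case using A by (intro bexI[of _ "\<Omega> - A"]) auto
  next
    case (Union a)
    interpret N: finite_measure N by (rule N(1))
    interpret N': finite_measure N' by (rule N(2))
    have aN [measurable]: "a i \<in> sets N" "a i \<in> sets N'" for i
      using Union(1) by (simp_all add: sets)
    have tail: "(\<lambda>n. measure R ((\<Union>i. a i) - (\<Union>i<n. a i))) \<longlonglongrightarrow> 0" if "finite_measure R" "sets R = sigma_sets \<Omega> G" for R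
    proof -
      interpret R: finite_measure R by fact
      have [measurable]: "a i \<in> sets R" for i using Union(1) that(2) by simp
      have "(\<lambda>n. measure R ((\<Union>i. a i) - (\<Union>i<n. a i))) \<longlonglongrightarrow> measure R (\<Inter>n. (\<Union>i. a i) - (\<Union>i<n. a i))"
        by (rule R.finite_Lim_measure_decseq) (auto simp: decseq_def)
      moreover have "(\<Inter>n. (\<Union>i. a i) - (\<Union>i<n. a i)) = {}" by auto
      ultimately show ?thesis by (simp only: measure_empty)
    qed
    have "(\<lambda>n. measure N ((\<Union>i. a i) - (\<Union>i<n. a i)) + measure N' ((\<Union>i. a i) - (\<Union>i<n. a i))) \<longlonglongrightarrow> 0 + 0"
      by (intro tendsto_add tail N sets)
    then have "\<forall>\<^sub>F n in sequentially. measure N ((\<Union>i. a i) - (\<Union>i<n. a i)) + measure N' ((\<Union>i. a i) - (\<Union>i<n. a i)) < e / 2"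
      by (rule order_tendstoD) (use Union.prems in simp)
    then obtain n where n: "measure N ((\<Union>i. a i) - (\<Union>i<n. a i)) + measure N' ((\<Union>i. a i) - (\<Union>i<n. a i)) < e / 2"
      by (auto simp: eventually_sequentially)
    \<comment> \<open>Half of \<open>e\<close> is spent on the tail of the union, the other half on
      \<open>n\<close> errors of size \<open>d\<close>; \<open>Suc n\<close> avoids division by
      0.\<close>
    define d where "d = e / (2 * real (Suc n))"
    have "d > 0" using Union.prems by (simp add: d_def)
    then have "\<forall>i. \<exists>A\<in>G. measure N ((a i - A) \<union> (A - a i)) + measure N' ((a i - A) \<union> (A - a i)) < d"
      using Union.IH by blast
    then obtain A where A: "\<And>i. A i \<in> G" "\<And>i. measure N ((a i - A i) \<union> (A i - a i)) + measure N' ((a i - A i) \<union> (A i - a i)) < d"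
      by metis
    have AN [measurable]: "A i \<in> sets N" "A i \<in> sets N'" for i using A(1) by (auto simp: sets)
    let ?a = "\<Union>i. a i" and ?A = "\<Union>i<n. A i"
    have sub: "(?a - ?A) \<union> (?A - ?a) \<subseteq> (?a - (\<Union>i<n. a i)) \<union> (\<Union>i<n. (a i - A i) \<union> (A i - a i))"
      by auto
    have bound: "measure R ((?a - ?A) \<union> (?A - ?a)) \<le> measure R (?a - (\<Union>i<n. a i)) + (\<Sum>i<n. measure R ((a i - A i) \<union> (A i - a i)))"
      if "finite_measure R" "sets R = sigma_sets \<Omega> G" for R
    proof -
      interpret R: finite_measure R by fact
      have [measurable]: "a i \<in> sets R" "A i \<in> sets R" for i using Union(1) A(1) that(2) by auto
      have "measure R ((?a - ?A) \<union> (?A - ?a)) \<le> measure R ((?a - (\<Union>i<n. a i)) \<union> (\<Union>i<n. (a i - A i) \<union> (A i - a i)))"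
        by (rule R.finite_measure_mono[OF sub]) measurable
      also have "\<dots> \<le> measure R (?a - (\<Union>i<n. a i)) + measure R (\<Union>i<n. (a i - A i) \<union> (A i - a i))"
        by (rule measure_Un_le) measurable
      also have "\<dots> \<le> measure R (?a - (\<Union>i<n. a i)) + (\<Sum>i<n. measure R ((a i - A i) \<union> (A i - a i)))"
        by (intro add_left_mono R.finite_measure_subadditive_finite) auto
      finally show ?thesis .
    qed
    have "measure N ((?a - ?A) \<union> (?A - ?a)) + measure N' ((?a - ?A) \<union> (?A - ?a))
      \<le> (measure N (?a - (\<Union>i<n. a i)) + measure N' (?a - (\<Union>i<n. a i)))
        + (\<Sum>i<n. measure N ((a i - A i) \<union> (A i - a i)) + measure N' ((a i - A i) \<union> (A i - a i)))"
      using bound[OF N(1) sets(1)] bound[OF N(2) sets(2)] by (simp add: sum.distrib)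
    also have "\<dots> \<le> (measure N (?a - (\<Union>i<n. a i)) + measure N' (?a - (\<Union>i<n. a i))) + (\<Sum>i<n. d)"
      using A(2) by (intro add_left_mono sum_mono less_imp_le)
    also have "\<dots> < e / 2 + e / 2"
    proof (rule add_less_le_mono[OF n])
      show "(\<Sum>i<n. d) \<le> e / 2" using Union.prems by (simp add: d_def field_simps)
    qed
    finally have "measure N ((?a - ?A) \<union> (?A - ?a)) + measure N' ((?a - ?A) \<union> (?A - ?a)) < e" by simp
    moreover have "?A \<in> G" using A(1) by auto
    ultimately show ?case by (intro bexI[of _ ?A])
  }
qed

text \<open>An inequality between measures is not inherited by complements, so a Dynkin class
  argument does not apply. It does survive approximation by sets of the algebra, taken in both
  measures at once.\<close>

lemma measure_le_from_algebra:
  assumes alg: "algebra \<Omega> G" and N: "finite_measure N" "finite_measure N'"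
    and sets: "sets N = sigma_sets \<Omega> G" "sets N' = sigma_sets \<Omega> G"
    and le: "\<And>A. A \<in> G \<Longrightarrow> measure N A \<le> measure N' A" and E: "E \<in> sigma_sets \<Omega> G"
  shows "measure N E \<le> measure N' E"
proof (rule field_le_epsilon)
  fix e :: real assume "e > 0"
  then obtain A where A: "A \<in> G" "measure N ((E - A) \<union> (A - E)) + measure N' ((E - A) \<union> (A - E)) < e"
    using algebra_approximation[OF alg N sets E] by blast
  interpret N: finite_measure N by (rule N(1))
  interpret N': finite_measure N' by (rule N(2))
  have [measurable]: "E \<in> sets N" "A \<in> sets N" "E \<in> sets N'" "A \<in> sets N'"
    using E A(1) by (auto simp: sets)
  have "measure N E \<le> measure N (A \<union> ((E - A) \<union> (A - E)))"
    by (rule N.finite_measure_mono) auto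
  also have "\<dots> \<le> measure N A + measure N ((E - A) \<union> (A - E))"
    by (rule measure_Un_le) auto
  also have "measure N A \<le> measure N' A" by (rule le[OF A(1)])
  also have "measure N' A \<le> measure N' (E \<union> ((E - A) \<union> (A - E)))"
    by (rule N'.finite_measure_mono) auto
  also have "\<dots> \<le> measure N' E + measure N' ((E - A) \<union> (A - E))"
    by (rule measure_Un_le) auto
  finally show "measure N E \<le> measure N' E + e" using A(2) by linarith
qed

text \<open>The last assumption says that \<open>exp (- l)\<close>, as a density for
  \<open>M\<close>, pushes forward to a measure below \<open>Q\<close>. On each cell
  \<open>E\<close> this gives a log-sum inequality, from \<open>1 + x \<le> exp x\<close> at
  \<open>x = t - l\<close> with the optimal constant \<open>t = ln (P E / q)\<close>; the cells then
  add up to the integral of \<open>l\<close>.\<close>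

lemma (in prob_space) relative_entropy_distr_le:
  fixes l :: "'a \<Rightarrow> real"
  assumes f [measurable]: "f \<in> M \<rightarrow>\<^sub>M R" and Q: "prob_space Q" "sets Q = sets R"
    and l: "integrable M l"
    and le: "\<And>E. E \<in> sets R \<Longrightarrow> (\<integral>\<^sup>+x. indicator E (f x) * ennreal (exp (- l x)) \<partial>M) \<le> emeasure Q E"
  shows "relative_entropy Q (distr M R f) \<le> ereal (\<integral>x. l x \<partial>M)"
  unfolding relative_entropy_def
proof (rule SUP_least)
  interpret Q: prob_space Q by (rule Q(1))
  have [measurable]: "l \<in> borel_measurable M" using l by auto
  fix C assume "C \<in> {C. finite C \<and> C \<subseteq> sets (distr M R f) \<and> partition_on (space (distr M R f)) C}"
  then have C: "finite C" "C \<subseteq> sets R" "partition_on (space R) C" by auto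
  define P where "P E = measure (distr M R f) E" for E
  have PE: "P E = prob (f -` E \<inter> space M)" if "E \<in> sets R" for E
    using that by (simp add: P_def measure_distr)
  have il: "integrable M (\<lambda>x. indicator E (f x) * l x)" if [measurable]: "E \<in> sets R" for E
    by (rule Bochner_Integration.integrable_bound[OF l]) (auto simp: indicator_def)
  have bound: "(if P E = 0 then 0 else if measure Q E = 0 then \<infinity> else ereal (P E * ln (P E / measure Q E)))
      \<le> ereal (\<integral>x. indicator E (f x) * l x \<partial>M)" if E [measurable]: "E \<in> sets R" for E
  proof (cases "P E = 0")
    case True
    then have "AE x in M. f x \<notin> E"
      using PE[OF E] prob_eq_0[of "f -` E \<inter> space M"] AE_space by (auto elim: eventually_elim2)
    then have "(\<integral>x. indicator E (f x) * l x \<partial>M) = (\<integral>x. 0 \<partial>M)"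
      by (intro integral_cong_AE) (auto elim: eventually_mono)
    then show ?thesis using True by simp
  next
    case False
    have Ppos: "P E > 0" using False by (simp add: P_def zero_less_measure_iff)
    define q where "q = measure Q E"
    have le': "(\<integral>\<^sup>+x. indicator E (f x) * ennreal (exp (- l x)) \<partial>M) \<le> ennreal q"
      using le[OF E] by (simp add: q_def Q.emeasure_eq_measure)
    have ex: "ennreal (indicator E (f x) * exp (- l x)) = indicator E (f x) * ennreal (exp (- l x))" for x
      by (auto simp: indicator_def)
    have ie: "integrable M (\<lambda>x. indicator E (f x) * exp (- l x))"
      using le' by (intro integrableI_nonneg) (auto simp: ex order_le_less_trans)
    have "ennreal (\<integral>x. indicator E (f x) * exp (- l x) \<partial>M) \<le> ennreal q"
      using le' nn_integral_eq_integral[OF ie] by (simp add: ex)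
    then have Iq: "(\<integral>x. indicator E (f x) * exp (- l x) \<partial>M) \<le> q"
      by (subst (asm) ennreal_le_iff) (auto simp: q_def)
    have iP: "(\<integral>x. indicator E (f x) \<partial>M) = P E"
    proof -
      have "(\<integral>x. (indicator E (f x) :: real) \<partial>M) = (\<integral>x. indicator (f -` E \<inter> space M) x \<partial>M)"
        by (intro Bochner_Integration.integral_cong) (auto simp: indicator_def)
      then show ?thesis using PE[OF E] by simp
    qed
    have iI: "integrable M (\<lambda>x. indicator E (f x) :: real)"
      by (rule integrable_const_bound[where B = 1]) (auto simp: indicator_def)
    \<comment> \<open>If \<open>q\<close> were 0, the positive weight \<open>exp (- l)\<close> would
      force \<open>f\<close> to avoid \<open>E\<close> almost surely. So the infinite value in the
      definition does not occur.\<close>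
    have "q > 0"
    proof (rule ccontr)
      assume "\<not> q > 0"
      then have "q = 0" using measure_nonneg[of Q E] by (simp add: q_def)
      then have "AE x in M. indicator E (f x) * ennreal (exp (- l x)) = 0"
        using le' by (subst nn_integral_0_iff_AE[symmetric]) auto
      then have "AE x in M. indicator E (f x) = (0 :: real)"
        by eventually_elim (auto simp: indicator_def split: if_splits)
      then have "(\<integral>x. indicator E (f x) \<partial>M) = (0 :: real)"
        by (rule integral_eq_zero_AE)
      then show False using iP Ppos by simp
    qed
    define t where "t = ln (P E / q)"
    have et: "exp t = P E / q" using Ppos \<open>q > 0\<close> by (simp add: t_def)
    have "indicator E (f x) * (t - l x) \<le> exp t * (indicator E (f x) * exp (- l x)) - indicator E (f x)" for x
    proof -
      have "t - l x \<le> exp t * exp (- l x) - 1"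
        using exp_ge_add_one_self[of "t + (- l x)"] exp_add[of t "- l x"] by linarith
      then show ?thesis by (simp add: indicator_def)
    qed
    then have "(\<integral>x. indicator E (f x) * t - indicator E (f x) * l x \<partial>M)
      \<le> (\<integral>x. exp t * (indicator E (f x) * exp (- l x)) - indicator E (f x) \<partial>M)"
      using iI il[OF E] ie by (intro integral_mono) (auto simp: right_diff_distrib)
    then have "P E * t - (\<integral>x. indicator E (f x) * l x \<partial>M)
      \<le> exp t * (\<integral>x. indicator E (f x) * exp (- l x) \<partial>M) - P E"
      using iI il[OF E] ie by (simp add: iP)
    also have "\<dots> \<le> exp t * q - P E" using Iq by simp
    also have "\<dots> = 0" using \<open>q > 0\<close> by (simp add: et)
    finally have "P E * t \<le> (\<integral>x. indicator E (f x) * l x \<partial>M)" by simp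
    then show ?thesis using False \<open>q > 0\<close> by (simp add: t_def q_def)
  qed
  have dis: "disjoint_family_on (\<lambda>E. E) C"
    using C(3) by (auto simp: partition_on_def disjoint_def disjoint_family_on_def)
  have one: "(\<Sum>E\<in>C. indicator E (f x) * l x) = l x" if "x \<in> space M" for x
  proof -
    have "f x \<in> \<Union>C" using measurable_space[OF f that] C(3) by (simp add: partition_on_def)
    then have "(\<Sum>E\<in>C. indicator E (f x)) = (1 :: real)"
      using indicator_UN_disjoint[OF C(1) dis, of "f x"] by simp
    then show ?thesis by (simp flip: sum_distrib_right)
  qed
  have "(\<Sum>E\<in>C. if P E = 0 then 0 else if measure Q E = 0 then \<infinity> else ereal (P E * ln (P E / measure Q E)))
    \<le> (\<Sum>E\<in>C. ereal (\<integral>x. indicator E (f x) * l x \<partial>M))"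
    using C(2) by (intro sum_mono bound) auto
  also have "\<dots> = ereal (\<integral>x. (\<Sum>E\<in>C. indicator E (f x) * l x) \<partial>M)"
    using C(2) il by (subst Bochner_Integration.integral_sum) auto
  also have "(\<integral>x. (\<Sum>E\<in>C. indicator E (f x) * l x) \<partial>M) = (\<integral>x. l x \<partial>M)"
    by (intro Bochner_Integration.integral_cong one) auto
  finally show "(\<Sum>E\<in>C. if measure (distr M R f) E = 0 then 0 else if measure Q E = 0 then \<infinity>
      else ereal (measure (distr M R f) E * ln (measure (distr M R f) E / measure Q E))) \<le> ereal (\<integral>x. l x \<partial>M)"
    by (simp only: P_def)
qed

section \<open>Decoupling one coordinate\<close>

context density_field
begin

text \<open>The exponential is the product of the densities of the coordinate \<open>k\<close> and
  of the block \<open>A\<close>, divided by their joint density. Weighting with it makes the two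
  independent, up to mass lost where the joint density vanishes.\<close>

lemma decoupling:
  assumes A: "finite A" "k \<notin> A" and [measurable]: "w \<in> borel_measurable (bor (insert k A))"
  shows "(\<integral>\<^sup>+t. w (restr (insert k A) t) * ennreal (exp (cll k {} t - cll k A t)) \<partial>M)
    \<le> (\<integral>\<^sup>+t'. \<integral>\<^sup>+t. w ((restr A t)(k := X k t')) \<partial>M \<partial>M)"
proof -
  let ?C = "insert k A"
  have [measurable]: "(\<lambda>x. restrict x A) \<in> (bor ?C) \<rightarrow>\<^sub>M (bor A)"
    "(\<lambda>x. restrict x {k}) \<in> (bor ?C) \<rightarrow>\<^sub>M (bor {k})"
    by (auto intro!: measurable_restrict_subset)
  define v where "v x = w x * dens A (restrict x A) * dens {k} (restrict x {k})" for x
  have [measurable]: "v \<in> borel_measurable (bor ?C)" unfolding v_def by measurable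
  have up [measurable]: "(\<lambda>(f, y). f(k := y)) \<in> (bor A) \<Otimes>\<^sub>M borel \<rightarrow>\<^sub>M (bor ?C)"
    by (rule measurable_add_dim)
  have "AE t in M. w (restr ?C t) * ennreal (exp (cll k {} t - cll k A t)) = v (restr ?C t) / dens ?C (restr ?C t)"
    using AE_dens_pos_finite[OF A(1)] AE_dens_pos_finite[OF finite.insertI[OF finite.emptyI, of k]]
      AE_dens_pos_finite[OF finite.insertI[OF A(1), of k]]
  proof eventually_elim
    case (elim t)
    note p = elim
    define a where "a K = enn2real (dens K (restr K t))" for K
    have a: "dens A (restr A t) = ennreal (a A)" "dens {k} (restr {k} t) = ennreal (a {k})"
      "dens ?C (restr ?C t) = ennreal (a ?C)" "a A > 0" "a {k} > 0" "a ?C > 0"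
      using p by (auto simp: a_def enn2real_positive_iff)
    have "cll k {} t - cll k A t = ln (a {k}) + ln (a A) - ln (a ?C)"
      using A by (simp add: cll_def rll_empty) (simp add: rll_def a_def)
    then have "exp (cll k {} t - cll k A t) = a {k} * a A / a ?C"
      using a by (simp add: exp_add exp_diff)
    then show ?case
      using a by (simp add: v_def restrict_restr subset_insertI divide_ennreal[symmetric] ennreal_mult ennreal_times_divide mult_ac)
  qed
  then have "(\<integral>\<^sup>+t. w (restr ?C t) * ennreal (exp (cll k {} t - cll k A t)) \<partial>M)
      = (\<integral>\<^sup>+t. v (restr ?C t) / dens ?C (restr ?C t) \<partial>M)"
    by (rule nn_integral_cong_AE)
  also have "\<dots> \<le> (\<integral>\<^sup>+x. v x \<partial>leb ?C)"
    using A by (intro nn_integral_weight_le) auto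
  also have "\<dots> = (\<integral>\<^sup>+y. \<integral>\<^sup>+x. v (x(k := y)) \<partial>leb A \<partial>lborel)"
    using A by (intro lborel_prod.product_nn_integral_insert_rev) auto
  also have "\<dots> = (\<integral>\<^sup>+y. dens {k} (\<lambda>i\<in>{k}. y) * (\<integral>\<^sup>+x. dens A x * w (x(k := y)) \<partial>leb A) \<partial>lborel)"
  proof (rule nn_integral_cong)
    fix y :: real
    have "(\<integral>\<^sup>+x. v (x(k := y)) \<partial>leb A) = (\<integral>\<^sup>+x. dens {k} (\<lambda>i\<in>{k}. y) * (dens A x * w (x(k := y))) \<partial>leb A)"
    proof (rule nn_integral_cong)
      fix x assume x: "x \<in> space (leb A)"
      have "restrict (x(k := y)) A = x" "restrict (x(k := y)) {k} = (\<lambda>i\<in>{k}. y)"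
        using x A(2) by (auto simp: space_PiM PiE_iff extensional_def fun_eq_iff restrict_def)
      then show "v (x(k := y)) = dens {k} (\<lambda>i\<in>{k}. y) * (dens A x * w (x(k := y)))"
        unfolding v_def by (simp only: mult_ac)
    qed
    also have "\<dots> = dens {k} (\<lambda>i\<in>{k}. y) * (\<integral>\<^sup>+x. dens A x * w (x(k := y)) \<partial>leb A)"
      by (rule nn_integral_cmult) measurable
    finally show "(\<integral>\<^sup>+x. v (x(k := y)) \<partial>leb A) = dens {k} (\<lambda>i\<in>{k}. y) * (\<integral>\<^sup>+x. dens A x * w (x(k := y)) \<partial>leb A)" .
  qed
  \<comment> \<open>Rewritten over \<open>leb {k}\<close>, so that \<open>nn_integral_restr\<close>
    also turns the integral over the coordinate \<open>k\<close> into an expectation.\<close>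
  also have "\<dots> = (\<integral>\<^sup>+z. dens {k} (\<lambda>i\<in>{k}. z k) * (\<integral>\<^sup>+x. dens A x * w (x(k := z k)) \<partial>leb A) \<partial>leb {k})"
  proof (rule lborel_prod.product_nn_integral_singleton[symmetric])
    interpret sigma_finite_measure "leb A" by (rule sigma_finite_leb[OF A(1)])
    show "(\<lambda>y. dens {k} (\<lambda>i\<in>{k}. y) * (\<integral>\<^sup>+x. dens A x * w (x(k := y)) \<partial>leb A)) \<in> borel_measurable lborel"
      by measurable
  qed
  also have "\<dots> = (\<integral>\<^sup>+z. dens {k} z * (\<integral>\<^sup>+x. dens A x * w (x(k := z k)) \<partial>leb A) \<partial>leb {k})"
  proof (rule nn_integral_cong)
    fix z assume "z \<in> space (leb {k})"
    then have "(\<lambda>i\<in>{k}. z k) = z" by (auto simp: space_PiM PiE_iff extensional_def fun_eq_iff restrict_def)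
    then show "dens {k} (\<lambda>i\<in>{k}. z k) * (\<integral>\<^sup>+x. dens A x * w (x(k := z k)) \<partial>leb A)
       = dens {k} z * (\<integral>\<^sup>+x. dens A x * w (x(k := z k)) \<partial>leb A)" by simp
  qed
  also have "\<dots> = (\<integral>\<^sup>+t'. (\<integral>\<^sup>+x. dens A x * w (x(k := restr {k} t' k)) \<partial>leb A) \<partial>M)"
  proof (rule nn_integral_restr[symmetric])
    interpret sigma_finite_measure "leb A" by (rule sigma_finite_leb[OF A(1)])
    have [measurable]: "(\<lambda>z. z k) \<in> (bor {k}) \<rightarrow>\<^sub>M (borel :: real measure)"
      by (rule measurable_component_singleton) simp
    show "(\<lambda>z. \<integral>\<^sup>+x. dens A x * w (x(k := z k)) \<partial>leb A) \<in> borel_measurable (bor {k})"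
      by measurable
  qed simp
  also have "\<dots> = (\<integral>\<^sup>+t'. \<integral>\<^sup>+t. w ((restr A t)(k := X k t')) \<partial>M \<partial>M)"
  proof (rule nn_integral_cong)
    fix t'
    have [measurable]: "(\<lambda>x. x(k := X k t')) \<in> (bor A) \<rightarrow>\<^sub>M (bor ?C)"
      by measurable
    show "(\<integral>\<^sup>+x. dens A x * w (x(k := restr {k} t' k)) \<partial>leb A) = (\<integral>\<^sup>+t. w ((restr A t)(k := X k t')) \<partial>M)"
      using nn_integral_restr[OF A(1), of "\<lambda>x. w (x(k := X k t'))"] by (simp add: restr_def)
  qed
  finally show ?thesis .
qed

text \<open>Built on two copies of \<open>M\<close>, which matches the double integral in
  \<open>decoupling\<close>. At the origin of the quadrant it is the decoupled law, by
  \<open>decoupled_law_eq_resampled\<close>.\<close>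

definition resampled :: "'i \<Rightarrow> 'i set \<Rightarrow> ('i \<Rightarrow> real) measure" where
  "resampled k I = distr (M \<Otimes>\<^sub>M M) (bor I) (\<lambda>(x', x). (restr I x)(k := X k x'))"

lemma resampled_measurable [measurable]:
  assumes "k \<in> I"
  shows "(\<lambda>(x', x). (restr I x)(k := X k x')) \<in> M \<Otimes>\<^sub>M M \<rightarrow>\<^sub>M (bor I)"
proof -
  have "(\<lambda>(x', x). (restr I x)(k := X k x')) = (\<lambda>p. \<lambda>i\<in>I. if i = k then X k (fst p) else X i (snd p))"
    using assms by (auto simp: fun_eq_iff restr_def)
  also have "\<dots> \<in> M \<Otimes>\<^sub>M M \<rightarrow>\<^sub>M (bor I)"
    by measurable
  finally show ?thesis .
qed

lemma prob_space_resampled: "k \<in> I \<Longrightarrow> prob_space (resampled k I)"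
proof -
  interpret P: pair_prob_space M M by standard
  show "k \<in> I \<Longrightarrow> prob_space (resampled k I)"
    unfolding resampled_def by (intro P.prob_space_distr resampled_measurable)
qed

lemma emeasure_resampled:
  assumes k: "k \<in> I" and [measurable]: "E \<in> sets (bor I)"
  shows "emeasure (resampled k I) E = (\<integral>\<^sup>+y'. \<integral>\<^sup>+y. indicator E ((restr I y)(k := X k y')) \<partial>M \<partial>M)"
proof -
  note [measurable] = resampled_measurable[OF k]
  have "emeasure (resampled k I) E = (\<integral>\<^sup>+x. indicator E x \<partial>resampled k I)"
    by (simp add: resampled_def)
  also have "\<dots> = (\<integral>\<^sup>+p. indicator E ((\<lambda>(y', y). (restr I y)(k := X k y')) p) \<partial>(M \<Otimes>\<^sub>M M))"
    unfolding resampled_def by (rule nn_integral_distr) measurable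
  also have "\<dots> = (\<integral>\<^sup>+y'. \<integral>\<^sup>+y. indicator E ((\<lambda>(y', y). (restr I y)(k := X k y')) (y', y)) \<partial>M \<partial>M)"
    by (rule nn_integral_fst[symmetric]) measurable
  finally show ?thesis by simp
qed

text \<open>Supplies \<open>generator\<close>, the algebra of cylinder events on which the two
  measures are compared first.\<close>

lemma projective_law: "projective_family I law (\<lambda>_. borel)"
proof (rule projective_family.intro)
  fix J H :: "'i set" assume JH: "J \<subseteq> H"
  have [measurable]: "(\<lambda>x. restrict x J) \<in> (bor H) \<rightarrow>\<^sub>M (bor J)"
    by (rule measurable_restrict_subset[OF JH])
  show "law J = distr (law H) (bor J) (\<lambda>f. restrict f J)"
    unfolding law_def by (subst distr_distr) (simp_all add: comp_def restrict_restr[OF JH])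
qed (rule prob_law)

text \<open>If \<open>L\<close> is the limiting gain at \<open>k\<close>, the integral of \<open>exp (cll k {} - L)\<close> over a cylinder event is at most the
  resampled probability of that event; the inequality passes from the algebra of cylinders to all measurable sets.\<close>

lemma relative_entropy_resampled_finite:
  assumes k: "k \<in> I"
    and gb: "gain_bound k (I - {k}) a"
  shows "relative_entropy (resampled k I) (law I) < \<infinity>"
proof -
  have "k \<notin> I - {k}" by simp
  then obtain L where pl: "past_limit k (I - {k}) L"
    using ex_past_limit[OF _ gb] by blast
  note L = past_limit_integrable[OF pl] and bnd = gain_boundD(1)[OF gb]
  have [measurable]: "L \<in> borel_measurable M" using L by auto
  define l where "l z = L z - cll k {} z" for z
  have l: "integrable M l" unfolding l_def using L bnd[of "{}"] by simp
  have [measurable]: "l \<in> borel_measurable M" using l by auto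
  define N where "N = distr (density M (\<lambda>z. ennreal (exp (- l z)))) (bor I) (restr I)"
  have sN: "sets N = sets (bor I)" and sQ: "sets (resampled k I) = sets (bor I)"
    by (simp_all add: N_def resampled_def)
  interpret Q: prob_space "resampled k I" by (rule prob_space_resampled[OF k])
  have N: "emeasure N E = (\<integral>\<^sup>+z. indicator E (restr I z) * ennreal (exp (- l z)) \<partial>M)"
    if [measurable]: "E \<in> sets (bor I)" for E
  proof -
    have "emeasure N E = (\<integral>\<^sup>+x. indicator E x \<partial>N)" using sN by simp
    also have "\<dots> = (\<integral>\<^sup>+z. indicator E (restr I z) \<partial>density M (\<lambda>z. ennreal (exp (- l z))))"
      unfolding N_def by (rule nn_integral_distr) measurable
    also have "\<dots> = (\<integral>\<^sup>+z. ennreal (exp (- l z)) * indicator E (restr I z) \<partial>M)"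
      by (rule nn_integral_density) measurable
    finally show ?thesis by (simp add: mult.commute)
  qed
  interpret pf: projective_family I law "\<lambda>_. borel" by (rule projective_law)
  have cyl: "emeasure N E \<le> emeasure (resampled k I) E" if "E \<in> pf.generator" for E
    using that
  proof cases
    case (1 J B)
    have E [measurable]: "E \<in> sets (bor I)"
      unfolding 1(1) using 1 by (intro measurable_prod_emb) auto
    have [measurable]: "B \<in> sets (bor J)" by (rule 1(4))
    \<comment> \<open>The sets are enlarged by \<open>J - {k}\<close>, so that the cylinder event
      depends only on the coordinates in \<open>insert k A\<close> and \<open>decoupling\<close>
      applies to it.\<close>
    have "\<exists>A. finite A \<and> A \<subseteq> I - {k} \<and> J - {k} \<subseteq> A \<and> (\<integral>z. \<bar>cll k A z - L z\<bar> \<partial>M) \<le> 1 / real (Suc n)" for n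
    proof -
      have "1 / real (Suc n) > 0" by simp
      from pl this obtain A where A: "finite A" "A \<subseteq> I - {k}"
        "\<And>B. finite B \<Longrightarrow> A \<subseteq> B \<Longrightarrow> B \<subseteq> I - {k} \<Longrightarrow> (\<integral>z. \<bar>cll k B z - L z\<bar> \<partial>M) \<le> 1 / real (Suc n)"
        by (rule past_limitE) blast
      have "finite (A \<union> (J - {k}))" "A \<union> (J - {k}) \<subseteq> I - {k}" using A(1,2) 1(2,3) by auto
      then show ?thesis using A(3)[of "A \<union> (J - {k})"]
        by (intro exI[of _ "A \<union> (J - {k})"]) auto
    qed
    then obtain A where A: "\<And>n. finite (A n)" "\<And>n. A n \<subseteq> I - {k}" "\<And>n. J - {k} \<subseteq> A n"
      "\<And>n. (\<integral>z. \<bar>cll k (A n) z - L z\<bar> \<partial>M) \<le> 1 / real (Suc n)" by metis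
    define u where "u n z = cll k (A n) z - L z" for n z
    have iu: "integrable M (u n)" for n unfolding u_def using bnd[OF A(1,2)] L by simp
    have "(\<lambda>n. \<integral>z. norm (u n z) \<partial>M) \<longlonglongrightarrow> 0"
    proof (rule tendsto_sandwich[where f = "\<lambda>_. 0" and h = "\<lambda>n. 1 / real (Suc n)"])
      show "(\<lambda>n. 1 / real (Suc n)) \<longlonglongrightarrow> 0" by real_asymp
    qed (use A(4) in \<open>auto simp: u_def intro!: always_eventually\<close>)
    from tendsto_L1_AE_subseq[OF iu this] obtain r :: "nat \<Rightarrow> nat"
      where r: "strict_mono r" "AE z in M. (\<lambda>n. u (r n) z) \<longlonglongrightarrow> 0" by auto
    define h where "h n z = indicator E (restr I z) * ennreal (exp (cll k {} z - cll k (A n) z))" for n z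
    have [measurable]: "h n \<in> borel_measurable M" for n unfolding h_def by measurable
    have h: "(\<integral>\<^sup>+z. h n z \<partial>M) \<le> emeasure (resampled k I) E" for n
    proof -
      define w where "w x = (indicator B (restrict x J) :: ennreal)" for x
      have Jsub: "J \<subseteq> insert k (A n)" using A(3)[of n] by auto
      have [measurable]: "(\<lambda>x. restrict x J) \<in> (bor (insert k (A n))) \<rightarrow>\<^sub>M (bor J)"
        by (rule measurable_restrict_subset[OF Jsub])
      have [measurable]: "w \<in> borel_measurable (bor (insert k (A n)))" unfolding w_def by measurable
      have memE: "x \<in> E \<longleftrightarrow> restrict x J \<in> B" if "x \<in> space (bor I)" for x
        using that unfolding 1(1) by (simp add: prod_emb_def space_PiM)
      have rI: "restr I z \<in> space (bor I)"
        "(restr I z)(k := y) \<in> space (bor I)" for z y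
        using k by (auto simp: restr_def space_PiM PiE_iff extensional_def)
      have e1: "indicator E (restr I z) = w (restr (insert k (A n)) z)" for z
        unfolding w_def indicator_def using memE[OF rI(1)] restrict_restr[OF Jsub] restrict_restr[OF 1(3)] by simp
      have rJ: "restrict ((restr I z)(k := y)) J = restrict ((restr (A n) z)(k := y)) J" for z y
        using 1(3) A(3)[of n] by (auto simp: restr_def restrict_def fun_eq_iff)
      have e2: "indicator E ((restr I z)(k := y)) = w ((restr (A n) z)(k := y))" for z y
        unfolding w_def indicator_def using memE[OF rI(2)] rJ by simp
      have kA: "k \<notin> A n" using A(2)[of n] by auto
      have "(\<integral>\<^sup>+z. h n z \<partial>M) = (\<integral>\<^sup>+z. w (restr (insert k (A n)) z) * ennreal (exp (cll k {} z - cll k (A n) z)) \<partial>M)"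
        unfolding h_def e1 ..
      also have "\<dots> \<le> (\<integral>\<^sup>+z'. \<integral>\<^sup>+z. w ((restr (A n) z)(k := X k z')) \<partial>M \<partial>M)"
        by (rule decoupling[OF A(1) kA]) measurable
      also have "\<dots> = emeasure (resampled k I) E"
        unfolding emeasure_resampled[OF k E] e2 ..
      finally show ?thesis .
    qed
    have "emeasure N E = (\<integral>\<^sup>+z. liminf (\<lambda>n. h (r n) z) \<partial>M)"
      unfolding N[OF E]
    proof (rule nn_integral_cong_AE)
      show "AE z in M. indicator E (restr I z) * ennreal (exp (- l z)) = liminf (\<lambda>n. h (r n) z)"
        using r(2)
      proof eventually_elim
        case (elim z)
        note lim = elim
        have "(\<lambda>n. ennreal (exp (- l z - u (r n) z))) \<longlonglongrightarrow> ennreal (exp (- l z - 0))"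
          by (intro tendsto_ennrealI tendsto_intros lim)
        moreover have "h n z = indicator E (restr I z) * ennreal (exp (- l z - u n z))" for n
          by (simp add: h_def u_def l_def)
        ultimately have "(\<lambda>n. h (r n) z) \<longlonglongrightarrow> indicator E (restr I z) * ennreal (exp (- l z))"
          by (auto simp: indicator_def)
        from lim_imp_Liminf[OF _ this]
        show ?case by simp
      qed
    qed
    also have "\<dots> \<le> liminf (\<lambda>n. \<integral>\<^sup>+z. h (r n) z \<partial>M)"
      by (rule nn_integral_liminf) measurable
    also have "\<dots> \<le> liminf (\<lambda>n::nat. emeasure (resampled k I) E)"
      by (intro Liminf_mono always_eventually allI h)
    also have "\<dots> = emeasure (resampled k I) E" by (simp add: Liminf_const)
    finally show ?thesis .
  qed
  \<comment> \<open>The whole space is a cylinder, so the comparison already bounds the mass of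
    \<open>N\<close>; this finiteness is what \<open>measure_le_from_algebra\<close> asks
    for.\<close>
  have "space (bor I) \<in> pf.generator"
    using pf.algebra_generator algebra.top by blast
  from cyl[OF this] have "emeasure N (space N) \<le> 1"
    using Q.emeasure_space_1 sets_eq_imp_space_eq[OF sN] sets_eq_imp_space_eq[OF sQ] by simp
  then have finN: "finite_measure N" by (intro finite_measureI) (auto simp: top_unique)
  interpret N: finite_measure N by (rule finN)
  have le: "measure N E \<le> measure (resampled k I) E" if "E \<in> sets (bor I)" for E
  proof (rule measure_le_from_algebra[OF pf.algebra_generator finN Q.finite_measure_axioms])
    show "measure N E \<le> measure (resampled k I) E" if "E \<in> pf.generator" for E
      using cyl[OF that] by (simp add: N.emeasure_eq_measure Q.emeasure_eq_measure)
  qed (use that in \<open>simp_all add: sN sQ pf.sets_PiM_generator\<close>)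
  have "relative_entropy (resampled k I) (distr M (bor I) (restr I)) \<le> ereal (\<integral>z. l z \<partial>M)"
  proof (rule relative_entropy_distr_le)
    show "(\<integral>\<^sup>+z. indicator E (restr I z) * ennreal (exp (- l z)) \<partial>M) \<le> emeasure (resampled k I) E"
      if "E \<in> sets (bor I)" for E
      using le[OF that] N[OF that] by (simp add: N.emeasure_eq_measure Q.emeasure_eq_measure flip: ennreal_le_iff)
  qed (use l sQ in \<open>auto intro: Q.prob_space_axioms\<close>)
  then show ?thesis unfolding law_def by (rule order.strict_trans1) simp
qed

end

section \<open>Fields generated by two commuting transformations\<close>

lemma int_iterate_shift:
  assumes bij: "bij_betw T (space M) (space M)" and x: "x \<in> space M"
  shows "int_iterate M T k (T x) = int_iterate M T (k + 1) x"
proof (cases "0 \<le> k")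
  case True
  then have "nat (k + 1) = Suc (nat k)" by simp
  then show ?thesis using True by (simp add: int_iterate_def funpow_swap1)
next
  case False
  then obtain n where n: "nat (- k) = Suc n" by (cases "nat (- k)") auto
  have inv: "inv_into (space M) T (T x) = x" by (rule bij_betw_inv_into_left[OF bij x])
  have "int_iterate M T k (T x) = (inv_into (space M) T ^^ n) x"
    using False n by (simp add: int_iterate_def inv funpow_swap1)
  also have "\<dots> = int_iterate M T (k + 1) x"
  proof (cases "k = - 1")
    case True
    then show ?thesis using n by (simp add: int_iterate_def)
  next
    case k: False
    then have "nat (- (k + 1)) = n" using n False by simp
    then show ?thesis using k False by (simp add: int_iterate_def)
  qed
  finally show ?thesis .
qed

lemma int_iterate_space:
  assumes bij: "bij_betw T (space M) (space M)" and x: "x \<in> space M"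
  shows "int_iterate M T k x \<in> space M"
proof -
  have "(T ^^ n) x \<in> space M" "(inv_into (space M) T ^^ n) x \<in> space M" for n
    using x bij_betwE[OF bij] bij_betwE[OF bij_betw_inv_into[OF bij]] by (induction n) auto
  then show ?thesis by (simp add: int_iterate_def)
qed

text \<open>For negative \<open>k\<close> the relation is first passed to the inverse of
  \<open>S\<close>, by writing a point as \<open>S\<close> of its preimage.\<close>

lemma int_iterate_commute:
  assumes bij: "bij_betw S (space M) (space M)" and T: "\<And>x. x \<in> space M \<Longrightarrow> T x \<in> space M"
    and c: "\<And>x. x \<in> space M \<Longrightarrow> T (S x) = S (T x)" and x: "x \<in> space M"
  shows "int_iterate M S k (T x) = T (int_iterate M S k x)"
proof -
  let ?I = "inv_into (space M) S"
  have sp: "S y \<in> space M" "?I y \<in> space M" if "y \<in> space M" for y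
    using that bij_betwE[OF bij] bij_betwE[OF bij_betw_inv_into[OF bij]] by auto
  have inv: "?I (T y) = T (?I y)" if y: "y \<in> space M" for y
  proof -
    have "T y = S (T (?I y))"
      using c[OF sp(2)[OF y]] bij_betw_inv_into_right[OF bij y] by simp
    then show ?thesis using bij_betw_inv_into_left[OF bij T[OF sp(2)[OF y]]] by simp
  qed
  have "(S ^^ n) x \<in> space M \<and> (S ^^ n) (T x) = T ((S ^^ n) x)" for n
    using x sp c by (induction n) auto
  moreover have "(?I ^^ n) x \<in> space M \<and> (?I ^^ n) (T x) = T ((?I ^^ n) x)" for n
    using x sp inv by (induction n) auto
  ultimately show ?thesis by (simp add: int_iterate_def)
qed

lemma int_iterate_measurable:
  assumes [measurable]: "T \<in> M \<rightarrow>\<^sub>M M" "inv_into (space M) T \<in> M \<rightarrow>\<^sub>M M"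
  shows "int_iterate M T k \<in> M \<rightarrow>\<^sub>M M"
proof -
  have "(R ^^ n) \<in> M \<rightarrow>\<^sub>M M" if "R \<in> M \<rightarrow>\<^sub>M M" for R :: "'a \<Rightarrow> 'a" and n
    using that by (induction n) (auto simp: id_def intro: measurable_comp)
  then show ?thesis using assms by (simp add: int_iterate_def)
qed

lemma stationary_field_process:
  fixes M :: "'a measure"
  assumes "prob_space M"
    and T: "invertible_measure_preserving M T" and S: "invertible_measure_preserving M S"
    and comm: "commuting_on M T S" and erg: "jointly_ergodic M T S"
    and F [measurable]: "F \<in> borel_measurable M" and ac: "abs_cont_process M F T S"
  shows "stationary_field M T S (process M F T S)"
proof -
  interpret prob_space M by fact
  have T': "T \<in> M \<rightarrow>\<^sub>M M" "bij_betw T (space M) (space M)" "inv_into (space M) T \<in> M \<rightarrow>\<^sub>M M" "distr M M T = M"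
    using T by (auto simp: invertible_measure_preserving_def)
  have S': "S \<in> M \<rightarrow>\<^sub>M M" "bij_betw S (space M) (space M)" "inv_into (space M) S \<in> M \<rightarrow>\<^sub>M M" "distr M M S = M"
    using S by (auto simp: invertible_measure_preserving_def)
  have [measurable]: "int_iterate M T k \<in> M \<rightarrow>\<^sub>M M" "int_iterate M S k \<in> M \<rightarrow>\<^sub>M M" for k
    by (intro int_iterate_measurable T' S')+
  show ?thesis
  proof
    show "process M F T S g \<in> borel_measurable M" for g
      unfolding process_def[abs_def] by measurable
    show "absolutely_continuous (leb K) (distr M (bor K) (\<lambda>x. \<lambda>i\<in>K. process M F T S i x))"
      if "finite K" for K
      using ac that unfolding abs_cont_process_def process_law_def process_restr_def[abs_def] by simp
    fix x g assume x: "x \<in> space M"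
    show "process M F T S g (T x) = process M F T S (g + (1, 0)) x"
    proof -
      have "int_iterate M S (snd g) (T x) = T (int_iterate M S (snd g) x)"
        using comm by (intro int_iterate_commute[OF S'(2) _ _ x]) (auto simp: commuting_on_def measurable_space[OF T'(1)])
      then show ?thesis
        by (simp add: process_def int_iterate_shift[OF T'(2) int_iterate_space[OF S'(2) x]])
    qed
    show "process M F T S g (S x) = process M F T S (g + (0, 1)) x"
      by (simp add: process_def int_iterate_shift[OF S'(2) x])
  qed (use T' S' comm erg in auto)
qed

lemma (in prob_space) extended_integral_eq_integral:
  fixes f :: "'a \<Rightarrow> real"
  assumes f: "integrable M f"
  shows "extended_integral M f = ereal (\<integral>x. f x \<partial>M)"
proof -
  have fin: "(\<integral>\<^sup>+x. ennreal (f x) \<partial>M) < \<infinity>" "(\<integral>\<^sup>+x. ennreal (- f x) \<partial>M) < \<infinity>"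
    using f by (auto simp: real_integrable_def less_top)
  have "enn2ereal a - enn2ereal b = ereal (enn2real a - enn2real b)" if "a < \<infinity>" "b < \<infinity>" for a b
    using that by (cases a; cases b) (auto simp: enn2ereal_ennreal)
  from this[OF fin] show ?thesis
    unfolding extended_integral_def real_lebesgue_integral_def[OF f] .
qed

lemma ln_std_normal_density: "ln (std_normal_density x) = - (x\<^sup>2 / 2 + ln (2 * pi) / 2)"
  by (simp add: std_normal_density_def ln_mult ln_div ln_sqrt)

lemma decoupled_law_eq_resampled:
  fixes M :: "'a measure"
  assumes "stationary_field M T S (process M F T S)" and [measurable]: "F \<in> borel_measurable M"
  shows "decoupled_law M F T S = density_field.resampled M (process M F T S) (0, 0) quadrant"
proof -
  interpret stationary_field M T S "process M F T S" by fact
  define V where "V = quadrant - {(0, 0)}"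
  have q: "quadrant = insert (0, 0) V" by (auto simp: V_def quadrant_def)
  have X0: "process M F T S (0, 0) = F" by (simp add: fun_eq_iff process_def int_iterate_def)
  have pl: "process_law M F T S V = distr M (bor V) (restr V)"
    by (simp add: process_law_def process_restr_def[abs_def] restr_def[abs_def])
  have [measurable]: "(\<lambda>(x, y). y((0, 0) := x)) \<in> borel \<Otimes>\<^sub>M (bor V) \<rightarrow>\<^sub>M (bor quadrant)"
    using measurable_compose[OF measurable_pair_swap' measurable_add_dim[of "(0, 0)" V "\<lambda>_. borel :: real measure"]]
    by (simp add: q case_prod_beta)
  interpret V: prob_space "distr M (bor V) (restr V)" by (rule prob_space_distr) measurable
  have "distr M borel F \<Otimes>\<^sub>M distr M (bor V) (restr V)
    = distr (M \<Otimes>\<^sub>M M) (borel \<Otimes>\<^sub>M (bor V)) (\<lambda>(x, y). (F x, restr V y))"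
    by (rule pair_measure_distr) (auto intro: V.sigma_finite_measure_axioms)
  then have "decoupled_law M F T S = distr (M \<Otimes>\<^sub>M M) (bor quadrant)
      ((\<lambda>(x, y). y((0, 0) := x)) \<circ> (\<lambda>(x, y). (F x, restr V y)))"
    unfolding decoupled_law_def V_def[symmetric] pl by (simp add: distr_distr)
  also have "(\<lambda>(x, y). y((0, 0) := x)) \<circ> (\<lambda>(x, y). (F x, restr V y))
      = (\<lambda>(z', z). (restr quadrant z)((0, 0) := process M F T S (0, 0) z'))"
    by (auto simp: fun_eq_iff restr_def V_def X0)
  finally show ?thesis by (simp add: resampled_def)
qed

theorem theorem4p1:
  fixes M :: "'a measure" and T S :: "'a \<Rightarrow> 'a" and F :: "'a \<Rightarrow> real"
  assumes "prob_space M"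
    and "invertible_measure_preserving M T"
    and "invertible_measure_preserving M S"
    and "commuting_on M T S"
    and "jointly_ergodic M T S"
    and "F \<in> borel_measurable M"
    and "integrable M (\<lambda>\<omega>. (F \<omega>)\<^sup>2)"
    and "abs_cont_process M F T S"
  shows "(\<bar>shannon_entropy M F T S\<bar> \<noteq> \<infinity> \<longrightarrow>
            relative_entropy (decoupled_law M F T S) (process_law M F T S quadrant) < \<infinity> \<and>
            (AE \<omega> in M. (\<lambda>n. ereal (information M F T S n \<omega> / real (n\<^sup>2)))
                          \<longlonglongrightarrow> shannon_entropy M F T S) \<and>
            (\<forall>n\<ge>1. integrable M (information M F T S n)) \<and>
            (\<lambda>n. \<integral>\<^sup>+ \<omega>. ennreal \<bar>information M F T S n \<omega> / real (n\<^sup>2)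
                            - real_of_ereal (shannon_entropy M F T S)\<bar> \<partial>M) \<longlonglongrightarrow> 0)
       \<and> (shannon_entropy M F T S = - \<infinity> \<longrightarrow>
            (AE \<omega> in M. (\<lambda>n. ereal (information M F T S n \<omega> / real (n\<^sup>2)))
                          \<longlonglongrightarrow> shannon_entropy M F T S))"
proof -
  interpret prob_space M by fact
  have field: "stationary_field M T S (process M F T S)"
    by (rule stationary_field_process) fact+
  interpret stationary_field M T S "process M F T S" by (rule field)
  have [measurable]: "F \<in> borel_measurable M" by fact
  have X0: "process M F T S (0, 0) = F" by (simp add: fun_eq_iff process_def int_iterate_def)
  \<comment> \<open>Minus the logarithm of the standard normal density at \<open>F x\<close>. It is
    nonnegative since \<open>2 * pi\<close> exceeds 1, and integrable because \<open>F\<close> is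
    square integrable.\<close>
  define q where "q x = (F x)\<^sup>2 / 2 + ln (2 * pi) / 2" for x
  have iq: "integrable M q" unfolding q_def using assms(7) by simp
  have q0: "0 \<le> q x" for x unfolding q_def using pi_ge_two by (intro add_nonneg_nonneg) auto
  have [measurable]: "q \<in> borel_measurable M" using iq by auto
  define c where "c = (\<integral>x. q x \<partial>M)"
  have c0: "0 \<le> c" unfolding c_def using q0 by simp
  have avgq: "AE x in M. (\<lambda>n. avg q n x) \<longlonglongrightarrow> c"
    unfolding c_def by (rule ergodic_average[OF iq])
  let ?s = "\<lambda>n x. \<Sum>g\<in>{..<n} \<times> {..<n}. q (act g x)"
  have info: "information M F T S n x = (?s n x) - rll (square n) x"
    if x: "x \<in> space M" for n x
  proof -
    have "(\<Sum>i\<in>square n. ln (std_normal_density (process M F T S i x))) = - (?s n x)"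
    proof -
      have "q (act g x) = - ln (std_normal_density (process M F T S (int_pair g) x))" for g
        using X_act[OF x, of "(0, 0)" g] by (simp add: q_def ln_std_normal_density X0 int_pair_def)
      then show ?thesis by (simp add: sum_square sum_negf)
    qed
    then show ?thesis
      by (simp add: information_def square_density_def rll_def dens_def law_def process_law_def
          process_restr_def[abs_def] restr_def[abs_def])
  qed
  let ?i = "\<lambda>n x. information M F T S n x / real (n\<^sup>2)"
  have info_div: "?i n x = avg q n x - mean_rll n x"
    if "x \<in> space M" for n x
    by (simp add: info[OF that] avg_def diff_divide_distrib)
  have info_meas [measurable]: "information M F T S n \<in> borel_measurable M" for n
  proof -
    have "(\<lambda>x. (?s n x) - rll (square n) x) \<in> borel_measurable M" by measurable
    then show ?thesis using info by (subst measurable_cong) auto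
  qed
  show ?thesis
  \<comment> \<open>The entropy turns out to be real when the mean gains are bounded and
    -\<infinity> otherwise, so in each case one of the two implications is void.\<close>
  proof (cases bounded_gain)
    case True
    obtain a where a: "AE x in M. (\<lambda>n. mean_rll n x) \<longlonglongrightarrow> a"
      "\<And>n. integrable M (rll (square n))"
      "(\<lambda>n. \<integral>x. \<bar>mean_rll n x - a\<bar> \<partial>M) \<longlonglongrightarrow> 0"
      by (fact bounded_gain_convergence[OF True])
    define s where "s = c - a"
    have ii: "integrable M (information M F T S n)" for n
    proof -
      have "integrable M (\<lambda>x. (?s n x) - rll (square n) x)"
        using a(2) iq by (intro Bochner_Integration.integrable_diff Bochner_Integration.integrable_sum integrable_act)
      then show ?thesis using info by (subst Bochner_Integration.integrable_cong[OF refl]) auto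
    qed
    have conv: "AE x in M. (\<lambda>n. ereal (?i n x)) \<longlonglongrightarrow> ereal s"
      using a(1) avgq AE_space
    proof eventually_elim
      case (elim x)
      note h = elim
      have "(\<lambda>n. ereal (avg q n x - mean_rll n x)) \<longlonglongrightarrow> ereal (c - a)"
        by (intro tendsto_ereal tendsto_diff h)
      then show ?case
        by (simp only: info_div[OF h(3)] s_def)
    qed
    \<comment> \<open>As \<open>q\<close> is nonnegative, the negative parts vanish and
      \<open>b = 0\<close> is admissible.\<close>
    have avgL1: "(\<lambda>n. \<integral>x. \<bar>avg q n x - c\<bar> \<partial>M) \<longlonglongrightarrow> 0"
    proof (rule L1_tendsto_of_AE_tendsto[where b = "\<lambda>_. 0"])
      show "integrable M (avg q n)" for n by (rule integrable_avg[OF iq])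
      show "(\<integral>x. avg q n x \<partial>M) \<le> c" for n
      proof (cases "n = 0")
        case True
        then show ?thesis using c0 by (simp add: avg_def)
      next
        case False
        then show ?thesis using integral_avg[OF iq, of n] by (simp add: c_def)
      qed
      have "0 \<le> avg q n x" for n x unfolding avg_def using q0 by (intro divide_nonneg_nonneg sum_nonneg) auto
      then show "(\<integral>\<^sup>+x. ennreal (- avg q n x) \<partial>M) \<le> ennreal 0" for n
        by (simp add: ennreal_neg)
    qed (use avgq in auto)
    have L1: "(\<lambda>n. \<integral>x. \<bar>?i n x - s\<bar> \<partial>M) \<longlonglongrightarrow> 0"
    proof (rule tendsto_sandwich[where f = "\<lambda>_. 0"])
      show "\<forall>\<^sub>F n in sequentially. (\<integral>x. \<bar>?i n x - s\<bar> \<partial>M)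
        \<le> (\<integral>x. \<bar>avg q n x - c\<bar> \<partial>M) + (\<integral>x. \<bar>mean_rll n x - a\<bar> \<partial>M)"
      proof (rule always_eventually, rule allI)
        fix n
        have i1: "integrable M (\<lambda>x. \<bar>avg q n x - c\<bar>)" using integrable_avg[OF iq, of n] by simp
        have i2: "integrable M (\<lambda>x. \<bar>mean_rll n x - a\<bar>)" using a(2)[of n] by simp
        have i3: "integrable M (\<lambda>x. \<bar>?i n x - s\<bar>)" using ii[of n] by simp
        have "(\<integral>x. \<bar>?i n x - s\<bar> \<partial>M)
          \<le> (\<integral>x. \<bar>avg q n x - c\<bar> + \<bar>mean_rll n x - a\<bar> \<partial>M)"
          using i1 i2 i3 by (intro integral_mono) (auto simp: info_div s_def simp del: of_nat_power)
        also have "\<dots> = (\<integral>x. \<bar>avg q n x - c\<bar> \<partial>M) + (\<integral>x. \<bar>mean_rll n x - a\<bar> \<partial>M)"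
          using i1 i2 by simp
        finally show "(\<integral>x. \<bar>?i n x - s\<bar> \<partial>M)
          \<le> (\<integral>x. \<bar>avg q n x - c\<bar> \<partial>M) + (\<integral>x. \<bar>mean_rll n x - a\<bar> \<partial>M)" .
      qed
      show "(\<lambda>n. (\<integral>x. \<bar>avg q n x - c\<bar> \<partial>M) + (\<integral>x. \<bar>mean_rll n x - a\<bar> \<partial>M)) \<longlonglongrightarrow> 0"
        using tendsto_add[OF avgL1 a(3)] by simp
    qed auto
    have lim_int: "(\<lambda>n. \<integral>x. ?i n x \<partial>M) \<longlonglongrightarrow> s"
    proof (rule LIM_zero_cancel, rule Lim_null_comparison[OF always_eventually L1], rule allI)
      fix n
      have "(\<integral>x. ?i n x \<partial>M) - s = (\<integral>x. ?i n x - s \<partial>M)"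
        using ii[of n] by (simp add: prob_space)
      then show "norm ((\<integral>x. ?i n x \<partial>M) - s) \<le> (\<integral>x. \<bar>?i n x - s\<bar> \<partial>M)"
        using integral_abs_bound[of M "\<lambda>x. ?i n x - s"] by simp
    qed
    have se: "square_entropy M F T S n / ereal (real (n\<^sup>2)) = ereal (\<integral>x. ?i n x \<partial>M)" if "n \<ge> 1" for n
      using that ii[of n] by (simp add: square_entropy_def extended_integral_eq_integral)
    have "(\<lambda>n. square_entropy M F T S n / ereal (real (n\<^sup>2))) \<longlonglongrightarrow> ereal s"
    proof (rule Lim_transform_eventually)
      show "(\<lambda>n. ereal (\<integral>x. ?i n x \<partial>M)) \<longlonglongrightarrow> ereal s"
        by (intro tendsto_ereal lim_int)
      show "\<forall>\<^sub>F n in sequentially. ereal (\<integral>x. ?i n x \<partial>M) = square_entropy M F T S n / ereal (real (n\<^sup>2))"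
        using eventually_ge_at_top[of 1] by eventually_elim (simp only: se)
    qed
    then have sh: "shannon_entropy M F T S = ereal s"
      unfolding shannon_entropy_def by (rule limI)
    obtain b where b: "gain_bound (0, 0) halfplane b" using bounded_gain_integrable[OF True] .
    have qh: "quadrant - {(0, 0)} \<subseteq> halfplane"
      by (auto simp: quadrant_def halfplane_def)
    have "relative_entropy (resampled (0, 0) quadrant) (law quadrant) < \<infinity>"
    proof (rule relative_entropy_resampled_finite)
      show "(0, 0) \<in> quadrant" by (simp add: quadrant_def)
      show "gain_bound (0, 0) (quadrant - {(0, 0)}) b"
        using b qh unfolding gain_bound_def by (meson order_trans)
    qed
    moreover have "law quadrant = process_law M F T S quadrant"
      by (simp add: law_def process_law_def process_restr_def[abs_def] restr_def[abs_def])
    ultimately have re: "relative_entropy (decoupled_law M F T S) (process_law M F T S quadrant) < \<infinity>"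
      using decoupled_law_eq_resampled[OF field] by simp
    have "(\<integral>\<^sup>+x. ennreal \<bar>?i n x - s\<bar> \<partial>M)
      = ennreal (\<integral>x. \<bar>?i n x - s\<bar> \<partial>M)" for n
      using ii[of n] by (intro nn_integral_eq_integral) auto
    moreover have "(\<lambda>n. ennreal (\<integral>x. \<bar>?i n x - s\<bar> \<partial>M)) \<longlonglongrightarrow> ennreal 0"
      by (rule tendsto_ennrealI[OF L1])
    ultimately have "(\<lambda>n. \<integral>\<^sup>+x. ennreal \<bar>?i n x - s\<bar> \<partial>M) \<longlonglongrightarrow> 0"
      by simp
    then show ?thesis using re conv ii unfolding sh by simp
  next
    case False
    have div: "AE x in M. filterlim (\<lambda>n. ?i n x) at_bot sequentially"
      using unbounded_gain_divergence[OF False] avgq AE_space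
    proof eventually_elim
      case (elim x)
      note h = elim
      have "filterlim (\<lambda>n. - avg q n x + mean_rll n x) at_top sequentially"
        by (rule filterlim_tendsto_add_at_top[OF tendsto_minus[OF h(2)] h(1)])
      then have "filterlim (\<lambda>n. - (avg q n x - mean_rll n x)) at_top sequentially"
        by (simp add: algebra_simps)
      then have "filterlim (\<lambda>n. avg q n x - mean_rll n x) at_bot sequentially"
        by (simp only: filterlim_uminus_at_bot)
      then show ?case
        by (simp only: info_div[OF h(3)])
    qed
    \<comment> \<open>Keeps the positive part finite, so that the difference in
      \<open>extended_integral\<close> is never \<infinity> - \<infinity>.\<close>
    have pos: "(\<integral>\<^sup>+x. ennreal (information M F T S n x) \<partial>M) \<le> ennreal (1 + (real n)\<^sup>2 * c)" for n
    proof -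
      have "(\<integral>\<^sup>+x. ennreal (information M F T S n x) \<partial>M)
        \<le> (\<integral>\<^sup>+x. ennreal (exp (- rll (square n) x)) + ennreal (?s n x) \<partial>M)"
      proof (rule nn_integral_mono)
        fix x assume x: "x \<in> space M"
        have "0 \<le> (?s n x)" using q0 by (intro sum_nonneg) auto
        moreover have "information M F T S n x \<le> exp (- rll (square n) x) + (?s n x)"
          using exp_ge_add_one_self[of "- rll (square n) x"] unfolding info[OF x] by linarith
        ultimately show "ennreal (information M F T S n x) \<le> ennreal (exp (- rll (square n) x)) + ennreal (?s n x)"
          by (simp add: ennreal_leI flip: ennreal_plus)
      qed
      also have "\<dots> = (\<integral>\<^sup>+x. ennreal (exp (- rll (square n) x)) \<partial>M) + (\<integral>\<^sup>+x. ennreal (?s n x) \<partial>M)"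
        by (rule nn_integral_add) auto
      also have "(\<integral>\<^sup>+x. ennreal (?s n x) \<partial>M) = ennreal ((real n)\<^sup>2 * c)"
      proof -
        have "(\<integral>\<^sup>+x. ennreal (?s n x) \<partial>M) = ennreal (\<integral>x. (?s n x) \<partial>M)"
          using iq q0 by (intro nn_integral_eq_integral Bochner_Integration.integrable_sum integrable_act AE_I2 sum_nonneg)
        also have "(\<integral>x. (?s n x) \<partial>M) = (real n)\<^sup>2 * c"
          using iq by (simp add: integrable_act integral_act c_def power2_eq_square)
        finally show ?thesis .
      qed
      also have "(\<integral>\<^sup>+x. ennreal (exp (- rll (square n) x)) \<partial>M) \<le> 1"
        using chain_bound[OF before_order(1,2), of "square n" "{}" "\<lambda>_. {}"] by simp
      finally show ?thesis using c0 by simp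
    qed
    define \<beta> where "\<beta> n = (\<integral>\<^sup>+x. ennreal (- (?i n x)) \<partial>M)" for n
    \<comment> \<open>Fatou's lemma for the negative parts, which tend to \<infinity> almost surely,
      transfers the divergence to their integrals.\<close>
    have "\<infinity> = (\<integral>\<^sup>+x. \<infinity> \<partial>M)" by (simp add: emeasure_space_1)
    also have "\<dots> = (\<integral>\<^sup>+x. liminf (\<lambda>n. ennreal (- (?i n x))) \<partial>M)"
    proof (rule nn_integral_cong_AE)
      show "AE x in M. \<infinity> = liminf (\<lambda>n. ennreal (- (?i n x)))"
        using div
      proof eventually_elim
        case (elim x)
        then have "filterlim (\<lambda>n. - (?i n x)) at_top sequentially"
          by (simp only: filterlim_uminus_at_bot[symmetric])
        then have "(\<lambda>n. ennreal (- (?i n x))) \<longlonglongrightarrow> \<infinity>"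
          by (simp only: ennreal_tendsto_top_eq_at_top infinity_ennreal_def)
        from lim_imp_Liminf[OF _ this]
        show ?case by simp
      qed
    qed
    also have "\<dots> \<le> liminf \<beta>" unfolding \<beta>_def by (rule nn_integral_liminf) measurable
    finally have lb: "liminf \<beta> = \<infinity>" by (simp add: top_unique)
    have "(\<lambda>n. square_entropy M F T S n / ereal (real (n\<^sup>2))) \<longlonglongrightarrow> - \<infinity>"
      unfolding tendsto_MInfty
    proof
      fix r :: real
      \<comment> \<open>\<open>C\<close> leaves at most \<open>1 + c - (c + 2 - r)\<close>, that is
        \<open>r - 1\<close>, for the normalised entropy; the maximum with 0 keeps
        \<open>ennreal C\<close> faithful.\<close>
      define C where "C = max 0 (c + 2 - r)"
      have "ennreal C < liminf \<beta>" by (simp add: lb)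
      then have "\<forall>\<^sub>F n in sequentially. ennreal C < \<beta> n" by (rule less_LiminfD)
      then show "\<forall>\<^sub>F n in sequentially. square_entropy M F T S n / ereal (real (n\<^sup>2)) < ereal r"
        using eventually_ge_at_top[of 1]
      proof eventually_elim
        case (elim n)
        note n = elim
        have n2: "(real n)\<^sup>2 \<ge> 1" using n(2) by simp
        have "ennreal ((real n)\<^sup>2 * C) = ennreal ((real n)\<^sup>2) * ennreal C"
          by (rule ennreal_mult) (auto simp: C_def)
        also have "\<dots> \<le> ennreal ((real n)\<^sup>2) * \<beta> n" using n(1) by (intro mult_left_mono) auto
        also have "\<dots> = (\<integral>\<^sup>+x. ennreal ((real n)\<^sup>2) * ennreal (- (?i n x)) \<partial>M)"
          unfolding \<beta>_def by (rule nn_integral_cmult[symmetric]) measurable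
        also have "\<dots> = (\<integral>\<^sup>+x. ennreal (- information M F T S n x) \<partial>M)"
          using n(2) by (intro nn_integral_cong) (simp add: ennreal_mult'[symmetric])
        finally have neg: "ennreal ((real n)\<^sup>2 * C) \<le> (\<integral>\<^sup>+x. ennreal (- information M F T S n x) \<partial>M)" .
        have "square_entropy M F T S n \<le> enn2ereal (ennreal (1 + (real n)\<^sup>2 * c)) - enn2ereal (ennreal ((real n)\<^sup>2 * C))"
          unfolding square_entropy_def extended_integral_def
          using pos neg by (intro ereal_minus_mono) (simp_all only: less_eq_ennreal.rep_eq[symmetric])
        also have "\<dots> = ereal (1 + (real n)\<^sup>2 * c - (real n)\<^sup>2 * C)"
        proof -
          have "0 \<le> 1 + (real n)\<^sup>2 * c" "0 \<le> (real n)\<^sup>2 * C" using c0 by (auto simp: C_def)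
          then show ?thesis by (simp only: enn2ereal_ennreal ereal_minus)
        qed
        finally have "square_entropy M F T S n / ereal (real (n\<^sup>2)) \<le> ereal (1 + (real n)\<^sup>2 * c - (real n)\<^sup>2 * C) / ereal (real (n\<^sup>2))"
          using n(2) by (intro ereal_divide_right_mono) auto
        also have "\<dots> = ereal (1 / (real n)\<^sup>2 + c - C)"
          using n(2) by (simp add: field_simps)
        also have "\<dots> < ereal r"
        proof -
          have "1 / (real n)\<^sup>2 \<le> 1" using n2 by (subst divide_le_eq_1) linarith
          then show ?thesis unfolding C_def by simp
        qed
        finally show ?case .
      qed
    qed
    then have sh: "shannon_entropy M F T S = - \<infinity>"
      unfolding shannon_entropy_def by (rule limI)
    have "AE x in M. (\<lambda>n. ereal (?i n x)) \<longlonglongrightarrow> - \<infinity>"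
      using div by eventually_elim (simp only: ereal_tendsto_simps2[unfolded comp_def])
    then show ?thesis unfolding sh by simp
  qed
qed

end
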